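(* Let $\alpha>0$ and $\nu>-1$, and put $q=e^{-2\pi\alpha}$ and $x=e^{-2\pi(1+\nu)\alpha}$. Let $B(t)=\frac{1}{e^{2\pi t}-1}-\frac{1}{2\pi t}+\frac12$. Then $$\log(x;q)_\infty=-\frac{\pi}{12\alpha}-\Bigl(\nu+\frac12\Bigr)\log(2\pi\alpha)+\log\frac{\sqrt{2\pi}}{\Gamma(\nu+1)}+\frac{\pi}{2}(\nu+1)\nu\alpha+\frac{\pi}{12}\alpha+2\pi\alpha\int_0^\nu\Bigl(t-\nu-\frac12\Bigr)B(\alpha t)\,dt+M(\alpha,\nu),$$ where $$M(\alpha,\nu)=-\sum_{n=1}^\infty\frac{\cos 2n\pi\nu}{n\,(e^{2n\pi/\alpha}-1)}-\frac{2}{\pi}\,\mathrm{PV}\!\int_0^\infty\sum_{n=1}^\infty\frac{\sin 2n\nu\pi t}{n\,(e^{2n\pi t/\alpha}-1)}\,\frac{dt}{1-t^2}.$$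
   Context: For $|q|<1$, $(x;q)_\infty=\prod_{n\ge0}(1-xq^n)$. Here $\log$ is the real logarithm, $\Gamma$ is Euler's Gamma function, and $\mathrm{PV}\int$ denotes the Cauchy principal value of the integral (singularity at $t=1$). *)

theory Defs
  imports "HOL-Analysis.Analysis"
begin

definition qpoch_inf :: "'a::real_normed_field \<Rightarrow> 'a \<Rightarrow> 'a" where
  "qpoch_inf x q = (\<Prod>n. 1 - x * q ^ n)"

(* The singularity at 0 is removable with limit 0; division by zero instead gives 1/2 there,
   which does not affect integrals of this function. *)
definition B :: "real \<Rightarrow> real" where
  "B t = 1 / (exp (2 * pi * t) - 1) - 1 / (2 * pi * t) + 1 / 2"

(* Cauchy principal value over A with a single singularity at c: a symmetric
   neighbourhood of c is cut out and shrunk. *)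
definition has_pv_integral :: "(real \<Rightarrow> real) \<Rightarrow> real \<Rightarrow> real set \<Rightarrow> real \<Rightarrow> bool" where
  "has_pv_integral f c A I \<longleftrightarrow>
     (\<forall>\<epsilon>>0. set_integrable lborel (A - {c - \<epsilon><..<c + \<epsilon>}) f) \<and>
     ((\<lambda>\<epsilon>. LINT t:(A - {c - \<epsilon><..<c + \<epsilon>})|lborel. f t) \<longlongrightarrow> I) (at_right 0)"

definition pv_integrable :: "(real \<Rightarrow> real) \<Rightarrow> real \<Rightarrow> real set \<Rightarrow> bool" where
  "pv_integrable f c A \<longleftrightarrow> (\<exists>I. has_pv_integral f c A I)"

definition pv_integral :: "(real \<Rightarrow> real) \<Rightarrow> real \<Rightarrow> real set \<Rightarrow> real" where
  "pv_integral f c A = (THE I. has_pv_integral f c A I)"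

(* The sums over n \<ge> 1 are indexed from 0, with Suc n in place of n. *)

definition cos_term :: "real \<Rightarrow> real \<Rightarrow> nat \<Rightarrow> real" where
  "cos_term \<alpha> \<nu> n =
     cos (2 * real (Suc n) * pi * \<nu>) / (real (Suc n) * (exp (2 * real (Suc n) * pi / \<alpha>) - 1))"

definition sin_term :: "real \<Rightarrow> real \<Rightarrow> real \<Rightarrow> nat \<Rightarrow> real" where
  "sin_term \<alpha> \<nu> t n =
     sin (2 * real (Suc n) * \<nu> * pi * t) / (real (Suc n) * (exp (2 * real (Suc n) * pi * t / \<alpha>) - 1))"

definition pv_integrand :: "real \<Rightarrow> real \<Rightarrow> real \<Rightarrow> real" where
  "pv_integrand \<alpha> \<nu> t = (\<Sum>n. sin_term \<alpha> \<nu> t n) * (1 / (1 - t\<^sup>2))"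

definition M :: "real \<Rightarrow> real \<Rightarrow> real" where
  "M \<alpha> \<nu> = - (\<Sum>n. cos_term \<alpha> \<nu> n) - (2 / pi) * pv_integral (pv_integrand \<alpha> \<nu>) 1 {0<..}"

end

theory Submission
  imports Defs "HOL-Probability.Probability" "HOL-Real_Asymp.Real_Asymp"
begin

text \<open>
  Fix \<open>\<alpha>\<close> and regard both sides as functions of \<open>\<nu>\<close>. The left-hand side is the sum over \<open>n \<ge> 1\<close>
  of \<open>ln (1 - exp (- 2 \<pi> \<alpha> (\<nu> + n)))\<close>, so it suffices that the right-hand side \<open>G\<close> satisfies
  \<open>G \<nu> - G (\<nu> + 1) = ln (1 - exp (- 2 \<pi> \<alpha> (\<nu> + 1)))\<close> and that \<open>G (\<nu> + N)\<close> tends to \<open>0\<close>.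

  Both facts are read off termwise in \<open>n\<close> from the principal value integral. From
  \<open>\<integral>\<^sub>0\<^sup>\<infinity> sin (y t) / (exp (c t) - 1) dt = \<pi>/c B (y/c)\<close> and Fubini, the \<open>n\<close>-th principal values at \<open>\<nu>\<close> and at
  \<open>\<nu> + N\<close> differ by a multiple of \<open>\<integral>\<^sub>0\<^sup>N sin (2 \<pi> n s) B (\<alpha> (\<nu> + s)) ds\<close>; for \<open>N = 1\<close> the sum over \<open>n\<close> is
  evaluated by the Fourier series of the sawtooth. As \<open>N \<rightarrow> \<infinity>\<close> the Riemann-Lebesgue lemma leaves only the
  contributions of the poles at \<open>t = 0\<close> and \<open>t = 1\<close>; the latter cancels the cosine series, the former
  produces \<open>\<pi> \<alpha> / 12\<close>, and Stirling's formula takes care of the elementary terms.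
\<close>

section \<open>Principal values by subtraction of the pole\<close>

text \<open>The cosine series is 1-periodic in \<nu>, so shifts only move the principal values. An
  integer shift makes these tractable: the n-th sine keeps its value at t = 1, the poles cancel, and
  the difference is an ordinary double integral. The obstacle is uniformity in n, because both
  interchanges (sum against principal value, sum against N -> infinity) rest on O(1/n^2) bounds for
  the n-th term. Subtracting one fixed kernel, odd about 1, turns each principal value into an
  absolutely convergent integral of size O(1/n), and the series supplies another 1/n. That bound
  grows linearly with \<nu>, so it cannot dominate the limit N -> infinity. There the domination
  comes from the double integral: \<open>B\<close> increases on the positive axis, and the second
  mean value theorem bounds its n-th sine integral over {0..N} independently of N. This step works
  with \<nu> > 0; parameters in (-1, 0] are reached through \<nu> + 1.\<close>

text \<open>
  The kernel has the same pole at \<open>1\<close> as \<open>1 / (1 - t\<^sup>2)\<close> and is odd about \<open>1\<close>, so its own principal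
  value vanishes. At \<open>t = 1\<close> both it and \<open>pv_reg f\<close> take the junk value \<open>0\<close>.
\<close>
definition pv_kernel :: "real \<Rightarrow> real" where
  "pv_kernel t = indicator {1/2..3/2} t / (2 * (1 - t))"

definition pv_reg :: "(real \<Rightarrow> real) \<Rightarrow> real \<Rightarrow> real" where
  "pv_reg f t = f t / (1 - t\<^sup>2) - f 1 * pv_kernel t"

lemma borel_measurable_pv_kernel [measurable]: "pv_kernel \<in> borel_measurable borel"
  unfolding pv_kernel_def by measurable

lemma set_integrable_pv_kernel:
  assumes "e > 0"
  shows "set_integrable lborel ({0<..} - {1 - e<..<1 + e}) pv_kernel"
proof -
  have "integrable lborel (\<lambda>t. indicator {1/2..3/2::real} t * (1 / (2 * e)))"
    by simp
  then show ?thesis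
    unfolding set_integrable_def
  proof (rule Bochner_Integration.integrable_bound)
    have "\<bar>1 / (2 * (1 - t))\<bar> \<le> 1 / (2 * e)" if "\<not> (1 - e < t \<and> t < 1 + e)" for t
    proof -
      have "e \<le> \<bar>1 - t\<bar>" using that by auto
      then show ?thesis using assms by (auto simp: abs_mult intro!: divide_left_mono)
    qed
    then show "AE t in lborel. norm (indicat_real ({0<..} - {1 - e<..<1 + e}) t *\<^sub>R pv_kernel t)
        \<le> norm (indicat_real {1 / 2..3 / 2} t * (1 / (2 * e)))"
      using assms by (auto simp: pv_kernel_def indicator_def)
  qed measurable
qed

lemma LINT_pv_kernel:
  "(LINT t:({0<..} - {1 - e<..<1 + e})|lborel. pv_kernel t) = 0"
proof -
  define h where "h = (\<lambda>t. indicat_real ({0<..} - {1 - e<..<1 + e}) t *\<^sub>R pv_kernel t)"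
  have "h (2 + -1 * x) = - h x" for x
    by (auto simp: h_def pv_kernel_def indicator_def divide_simps)
  then have "integral\<^sup>L lborel h = - integral\<^sup>L lborel h"
    using lborel_integral_real_affine[of "-1" h 2] by simp
  then show ?thesis by (simp add: h_def set_lebesgue_integral_def)
qed

text \<open>The cut-outs are symmetric about 1, so the kernel integrates to 0 over each of the
  remaining sets. What is left is an integrable function on growing sets, and dominated convergence
  lets the cut-out shrink.\<close>

lemma has_pv_integral_pv_reg:
  assumes int: "set_integrable lborel {0<..} (pv_reg f)"
  shows "has_pv_integral (\<lambda>t. f t * (1 / (1 - t\<^sup>2))) 1 {0<..} (LINT t:{0<..}|lborel. pv_reg f t)"
proof -
  define A where "A = (\<lambda>e::real. {0<..} - {1 - e<..<1 + e})"
  have eq: "f t * (1 / (1 - t\<^sup>2)) = pv_reg f t + f 1 * pv_kernel t" for t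
    by (simp add: pv_reg_def)
  have intA: "set_integrable lborel (A e) (pv_reg f)" for e
    by (rule set_integrable_subset[OF int]) (auto simp: A_def)
  have intk: "set_integrable lborel (A e) (\<lambda>t. f 1 * pv_kernel t)" if "e > 0" for e
    using set_integrable_pv_kernel[OF that] by (auto simp: A_def)
  have val: "(LINT t:A e|lborel. f t * (1 / (1 - t\<^sup>2))) = (LINT t:A e|lborel. pv_reg f t)" if "e > 0" for e
    unfolding eq using set_integral_add(2)[OF intA intk[OF that]] LINT_pv_kernel[of e]
    by (simp add: A_def)
  have "((\<lambda>e. LINT t:A e|lborel. pv_reg f t) \<longlongrightarrow> (LINT t:{0<..}|lborel. pv_reg f t)) (at_right 0)"
  proof (rule tendsto_at_right_sequentially[where b = 1])
    fix S :: "nat \<Rightarrow> real" assume S: "\<And>n. 0 < S n" "S \<longlonglongrightarrow> 0"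
    show "(\<lambda>n. LINT t:A (S n)|lborel. pv_reg f t) \<longlonglongrightarrow> (LINT t:{0<..}|lborel. pv_reg f t)"
      unfolding set_lebesgue_integral_def
    proof (rule integral_dominated_convergence)
      show "integrable lborel (\<lambda>t. norm (indicat_real {0<..} t *\<^sub>R pv_reg f t))"
        using int unfolding set_integrable_def by (rule integrable_norm)
      show "(\<lambda>t. indicat_real {0<..} t *\<^sub>R pv_reg f t) \<in> borel_measurable lborel"
        using int unfolding set_integrable_def by auto
      show "(\<lambda>t. indicat_real (A (S n)) t *\<^sub>R pv_reg f t) \<in> borel_measurable lborel" for n
        using intA[of "S n"] unfolding set_integrable_def by auto
      show "AE t in lborel. norm (indicat_real (A (S n)) t *\<^sub>R pv_reg f t)
          \<le> norm (indicat_real {0<..} t *\<^sub>R pv_reg f t)" for n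
        by (auto simp: A_def indicator_def)
      show "AE t in lborel. (\<lambda>n. indicat_real (A (S n)) t *\<^sub>R pv_reg f t)
          \<longlonglongrightarrow> indicat_real {0<..} t *\<^sub>R pv_reg f t"
        using AE_lborel_singleton[of 1]
      proof eventually_elim
        fix t :: real assume "t \<noteq> 1"
        then have "\<forall>\<^sub>F n in sequentially. S n < \<bar>t - 1\<bar>"
          using S(2) by (intro order_tendstoD(2)) auto
        then have "\<forall>\<^sub>F n in sequentially. indicat_real (A (S n)) t *\<^sub>R pv_reg f t
            = indicat_real {0<..} t *\<^sub>R pv_reg f t"
          by eventually_elim (auto simp: A_def indicator_def)
        then show "(\<lambda>n. indicat_real (A (S n)) t *\<^sub>R pv_reg f t)
          \<longlonglongrightarrow> indicat_real {0<..} t *\<^sub>R pv_reg f t"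
          by (rule tendsto_eventually)
      qed
    qed
  qed simp
  then have "((\<lambda>e. LINT t:A e|lborel. f t * (1 / (1 - t\<^sup>2))) \<longlongrightarrow> (LINT t:{0<..}|lborel. pv_reg f t)) (at_right 0)"
    by (rule Lim_transform_eventually) (auto simp: eventually_at_right_field intro!: exI[of _ 1] val[symmetric, simplified])
  moreover have "set_integrable lborel (A e) (\<lambda>t. f t * (1 / (1 - t\<^sup>2)))" if "e > 0" for e
    unfolding eq using set_integral_add(1)[OF intA intk[OF that]] .
  ultimately show ?thesis
    by (simp add: has_pv_integral_def A_def)
qed

lemma pv_integral_eqI:
  assumes "has_pv_integral f c A I"
  shows "pv_integral f c A = I"
  unfolding pv_integral_def
proof (rule the_equality[where P = "has_pv_integral f c A", OF assms])
  fix J assume "has_pv_integral f c A J"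
  with assms show "J = I"
    unfolding has_pv_integral_def
    by (intro tendsto_unique[OF trivial_limit_at_right_real[of 0]]) auto
qed

section \<open>The function B\<close>

lemma borel_measurable_B [measurable]: "B \<in> borel_measurable borel"
  unfolding B_def by measurable

lemma B_minus: "x \<noteq> 0 \<Longrightarrow> B (- x) = - B x"
proof -
  assume "x \<noteq> 0"
  then have "exp (2 * pi * x) \<noteq> 1" by simp
  then show ?thesis
    by (simp add: B_def exp_minus field_simps)
qed

text \<open>With y = 2 pi x the claim is -1 \<le> 1/(e^y - 1) - 1/y \<le> 0. The upper half is e^y
  \<ge> 1 + y, the lower half e^(-y) \<ge> 1 - y.\<close>

lemma abs_B_le_pos:
  assumes "x > 0"
  shows "\<bar>B x\<bar> \<le> 1/2"
proof -
  define y where "y = 2 * pi * x"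
  have y: "y > 0" using assms by (simp add: y_def)
  have e: "exp y - 1 \<ge> y" using exp_ge_add_one_self[of y] by linarith
  then have "1 / (exp y - 1) \<le> 1 / y"
    using y by (intro divide_left_mono) auto
  moreover have "1 / (exp y - 1) \<ge> 1 / y - 1"
  proof -
    have "(1 - y) * exp y \<le> exp (- y) * exp y"
      using exp_ge_add_one_self[of "-y"] by (intro mult_right_mono) auto
    then have "(1 - y) * exp y \<le> 1" by (simp add: exp_minus)
    then have "(1 - y) * (exp y - 1) \<le> y" by (simp add: algebra_simps)
    then show ?thesis using y e by (simp add: field_simps)
  qed
  ultimately show ?thesis unfolding B_def y_def[symmetric] by linarith
qed

text \<open>Oddness covers negative arguments, and the default value \<open>B 0 = 1/2\<close>
  attains the bound.\<close>

lemma abs_B_le: "\<bar>B x\<bar> \<le> 1/2"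
  using abs_B_le_pos[of x] abs_B_le_pos[of "- x"] B_minus[of x]
  by (cases "x = 0"; cases "x > 0") (auto simp: B_def[of 0])

text \<open>This is v \<le> 2 sinh (v/2), multiplied by exp (v/2). It serves twice: for the
  monotonicity of \<open>B\<close>, and for a bound on 1/(e^v - 1) that shows both the pole 1/v and
  exponential decay.\<close>

lemma mult_exp_half_le:
  fixes v :: real
  assumes v: "v \<ge> 0"
  shows "v * exp (v/2) \<le> exp v - 1"
proof -
  define h where "h = (\<lambda>s::real. exp (s/2) - exp (-s/2) - s)"
  have "h 0 \<le> h v"
  proof (rule DERIV_nonneg_imp_nondecreasing[where f = h])
    fix s :: real
    have "exp (s/2) + exp (-s/2) - 2 = (exp (s/4) - exp (-s/4))\<^sup>2"
      by (simp add: power2_diff exp_double[symmetric] mult_exp_exp)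
    then have "exp (s/2) / 2 + exp (-s/2) / 2 - 1 \<ge> 0"
      using zero_le_power2[of "exp (s/4) - exp (-s/4)"] by linarith
    moreover have "(h has_real_derivative exp (s/2) / 2 + exp (-s/2) / 2 - 1) (at s)"
      unfolding h_def by (auto intro!: derivative_eq_intros)
    ultimately show "\<exists>y. (h has_real_derivative y) (at s) \<and> 0 \<le> y"
      by blast
  qed (use v in auto)
  then have "v \<le> exp (v/2) - exp (-v/2)" by (simp add: h_def)
  then have "v * exp (v/2) \<le> (exp (v/2) - exp (-v/2)) * exp (v/2)"
    by (intro mult_right_mono) auto
  also have "\<dots> = exp v - 1" by (simp add: algebra_simps mult_exp_exp)
  finally show ?thesis .
qed

text \<open>The second mean value theorem will need this. With v = 2 pi u the derivative is
  nonnegative exactly when v^2 e^v \<le> (e^v - 1)^2, the square of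
  \<open>mult_exp_half_le\<close>.\<close>

lemma B_mono:
  assumes "0 < x" "x \<le> y"
  shows "B x \<le> B y"
proof (rule DERIV_nonneg_imp_nondecreasing[OF assms(2)])
  fix u assume u: "x \<le> u" "u \<le> y"
  define v where "v = 2 * pi * u"
  have v: "v > 0" using assms u by (simp add: v_def)
  have e: "exp v > 1" using v by simp
  have "(B has_real_derivative (- (2 * pi * exp v) / (exp v - 1)\<^sup>2 + 1 / (2 * pi * u\<^sup>2))) (at u)"
    using e v assms u unfolding B_def v_def
    by (auto intro!: derivative_eq_intros simp: power2_eq_square field_simps)
  moreover have "0 \<le> - (2 * pi * exp v) / (exp v - 1)\<^sup>2 + 1 / (2 * pi * u\<^sup>2)"
  proof -
    have "v * exp (v/2) \<le> exp v - 1"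
      using v by (intro mult_exp_half_le) simp
    then have "(v * exp (v/2))\<^sup>2 \<le> (exp v - 1)\<^sup>2"
      using v by (intro power_mono) auto
    moreover have "(v * exp (v/2))\<^sup>2 = v\<^sup>2 * exp v"
      by (simp add: power_mult_distrib exp_double[symmetric])
    ultimately have "(2 * pi * u)\<^sup>2 * exp v \<le> (exp v - 1)\<^sup>2" by (simp add: v_def)
    moreover have "2 * pi * exp v = 1 / (2 * pi * u\<^sup>2) * ((2 * pi * u)\<^sup>2 * exp v)"
      using u assms by (simp add: field_simps power2_eq_square)
    ultimately have "2 * pi * exp v \<le> 1 / (2 * pi * u\<^sup>2) * (exp v - 1)\<^sup>2"
      by (simp only: mult_left_mono) (intro mult_left_mono; simp)
    then have "2 * pi * exp v / (exp v - 1)\<^sup>2 \<le> 1 / (2 * pi * u\<^sup>2)"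
      using e by (subst pos_divide_le_eq) auto
    then show ?thesis by simp
  qed
  ultimately show "\<exists>y. (B has_real_derivative y) (at u) \<and> 0 \<le> y" by blast
qed

section \<open>The dilogarithm and closed antiderivatives of B\<close>

definition dilog :: "real \<Rightarrow> real" where
  "dilog x = (\<Sum>n. x ^ Suc n / (real (Suc n))\<^sup>2)"

lemma summable_inverse_Suc_squares: "summable (\<lambda>n. 1 / (real (Suc n))\<^sup>2)"
  using inverse_squares_sums by (simp add: sums_iff add.commute)

lemma dilog_0: "dilog 0 = 0"
  by (simp add: dilog_def)

lemma dilog_1: "dilog 1 = pi\<^sup>2 / 6"
  using inverse_squares_sums by (simp add: dilog_def sums_iff add.commute)

text \<open>Both endpoints matter: with x = exp (- k t), the point 1 corresponds to t = 0, the lower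
  limit of the integrals of \<open>B\<close>, and the point 0 to t -> infinity.\<close>

lemma continuous_on_dilog: "continuous_on {0..1} dilog"
proof -
  have "uniform_limit {0..1} (\<lambda>n x. \<Sum>i<n. x ^ Suc i / (real (Suc i))\<^sup>2)
      (\<lambda>x. \<Sum>i. x ^ Suc i / (real (Suc i))\<^sup>2) sequentially"
  proof (rule Weierstrass_m_test[OF _ summable_inverse_Suc_squares])
    show "norm (x ^ Suc n / (real (Suc n))\<^sup>2) \<le> 1 / (real (Suc n))\<^sup>2" if "x \<in> {0..1}" for n x
      using that power_le_one[of x "Suc n"] by (auto intro!: divide_right_mono simp del: power_Suc)
  qed
  then have "continuous_on {0..1} (\<lambda>x::real. \<Sum>i. x ^ Suc i / (real (Suc i))\<^sup>2)"
    by (rule uniform_limit_theorem[rotated]) (auto intro!: continuous_intros always_eventually simp del: power_Suc of_nat_Suc)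
  then show ?thesis unfolding dilog_def[abs_def] .
qed

lemma DERIV_dilog:
  assumes "0 < x" "x < 1"
  shows "(dilog has_real_derivative - ln (1 - x) / x) (at x)"
proof -
  \<comment> \<open>Division by zero gives \<open>c 0 = 0\<close>, so the power series may start at
    index 0 although the dilogarithm starts at 1.\<close>
  define c where "c = (\<lambda>n::nat. 1 / (real n)\<^sup>2)"
  have sm: "summable (\<lambda>n. c n * z ^ n)" if "norm z < 1" for z :: real
  proof (rule summable_comparison_test)
    show "\<exists>N. \<forall>n\<ge>N. norm (c n * z ^ n) \<le> \<bar>z\<bar> ^ n"
    proof (intro exI allI impI)
      fix n :: nat assume "n \<ge> 1"
      then have "c n \<le> 1" "c n \<ge> 0" by (auto simp: c_def)
      then show "norm (c n * z ^ n) \<le> \<bar>z\<bar> ^ n"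
        by (simp add: abs_mult power_abs mult_left_le_one_le)
    qed
    show "summable (\<lambda>n. \<bar>z\<bar> ^ n)" using that by simp
  qed
  have eq: "dilog z = (\<Sum>n. c n * z ^ n)" if "norm z < 1" for z
    using suminf_split_head[OF sm[OF that]] by (simp add: dilog_def c_def)
  have "((\<lambda>z. \<Sum>n. c n * z^n) has_field_derivative (\<Sum>n. diffs c n * x^n)) (at x)"
    by (rule termdiffs_strong'[where K = 1]) (use sm assms in auto)
  moreover have "(\<Sum>n. diffs c n * x^n) = - ln (1 - x) / x"
  proof -
    have d: "diffs c n = 1 / real (Suc n)" for n
      by (simp add: diffs_def c_def power2_eq_square)
    have s: "summable (\<lambda>n. 1 / real (Suc n) * x ^ n)"
      by (rule summable_comparison_test'[where g = "\<lambda>n. x ^ n" and N = 0])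
         (use assms in \<open>auto simp: abs_mult field_simps\<close>)
    have "ln (1 - x) = (\<Sum>n. (-1)^n * (1 / real (n + 1)) * (- x)^(Suc n))"
      using ln_series[of "1 - x"] assms by simp
    also have "(\<lambda>n. (-1)^n * (1 / real (n + 1)) * (- x)^(Suc n)) = (\<lambda>n. (- x) * (1 / real (Suc n) * x ^ n))"
    proof
      fix n
      have "(-1)^n * (1 / real (n + 1)) * (- x)^(Suc n) = (-1 * (- x)) ^ n * (- x) * (1 / real (n + 1))"
        by (simp only: power_mult_distrib power_Suc ac_simps)
      then show "(-1)^n * (1 / real (n + 1)) * (- x)^(Suc n) = (- x) * (1 / real (Suc n) * x ^ n)"
        by simp
    qed
    also have "(\<Sum>n. (- x) * (1 / real (Suc n) * x ^ n)) = (- x) * (\<Sum>n. 1 / real (Suc n) * x ^ n)"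
      by (rule suminf_mult[OF s])
    finally show ?thesis using assms unfolding d by simp
  qed
  ultimately have "((\<lambda>z. \<Sum>n. c n * z^n) has_field_derivative - ln (1 - x) / x) (at x)" by simp
  then show ?thesis
    by (rule DERIV_cong_ev[THEN iffD1, OF refl _ refl, rotated])
       (rule eventually_nhds_in_open[of "{-1<..<1}", THEN eventually_mono]; use assms in \<open>auto simp: eq\<close>)
qed

text \<open>For k, t > 0 this is the logarithm of 2 sinh (k t / 2) / (k t). At t = 0 the default
  \<open>ln 0 = 0\<close> yields 0, which agrees with the limit.\<close>

definition B_prim :: "real \<Rightarrow> real \<Rightarrow> real" where
  "B_prim k t = ln (1 - exp (- (k * t))) - ln (k * t) + k * t / 2"

text \<open>An antiderivative of \<open>B_prim k\<close>; the dilogarithm arises from integrating ln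
  (1 - exp (- k t)). Its value pi^2 / (6 k) at t = 0 will produce the term pi / (12
  \<alpha>).\<close>

definition B_prim2 :: "real \<Rightarrow> real \<Rightarrow> real" where
  "B_prim2 k t = dilog (exp (- (k * t))) / k - t * ln (k * t) + t + k * t\<^sup>2 / 4"

lemma DERIV_B_prim:
  assumes "k > 0" "t > 0"
  shows "(B_prim k has_real_derivative k * B (k / (2 * pi) * t)) (at t)"
proof -
  have e: "exp (- (k * t)) < 1" "exp (k * t) > 1" using assms by auto
  have "(B_prim k has_real_derivative (k * exp (- (k * t)) / (1 - exp (- (k * t))) - 1 / t + k / 2)) (at t)"
    unfolding B_prim_def[abs_def] using assms e
    by (auto intro!: derivative_eq_intros simp: field_simps)
  moreover have "k * exp (- (k * t)) / (1 - exp (- (k * t))) - 1 / t + k / 2 = k * B (k / (2 * pi) * t)"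
    using assms e by (simp add: B_def exp_minus field_simps)
  ultimately show ?thesis by simp
qed

lemma DERIV_B_prim2:
  assumes "k > 0" "t > 0"
  shows "(B_prim2 k has_real_derivative B_prim k t) (at t)"
proof -
  have e: "exp (- (k * t)) < 1" "exp (k * t) > 1" using assms by auto
  have "((\<lambda>t. dilog (exp (- (k * t)))) has_real_derivative
       - ln (1 - exp (- (k * t))) / exp (- (k * t)) * (exp (- (k * t)) * (- k))) (at t)"
    by (rule DERIV_chain2[OF DERIV_dilog]) (use e in \<open>auto intro!: derivative_eq_intros\<close>)
  then have d: "((\<lambda>t. dilog (exp (- (k * t)))) has_real_derivative k * ln (1 - exp (- (k * t)))) (at t)"
    by (simp add: mult.commute[of "ln _" k])
  show ?thesis
    unfolding B_prim2_def[abs_def] B_prim_def using assms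
    by (auto intro!: derivative_eq_intros d)
qed

lemma B_prim_0: "B_prim k 0 = 0"
  by (simp add: B_prim_def)

lemma B_prim2_0: "B_prim2 k 0 = pi\<^sup>2 / (6 * k)"
  by (simp add: B_prim2_def dilog_1)

lemma continuous_on_B_prim:
  assumes "k > 0"
  shows "continuous_on {0..} (B_prim k)"
  unfolding continuous_on_eq_continuous_within
proof
  fix t :: real assume "t \<in> {0..}"
  show "continuous (at t within {0..}) (B_prim k)"
  proof (cases "t = 0")
    case True
    have "((\<lambda>t. ln (1 - exp (- (k * t))) - ln (k * t) + k * t / 2) \<longlongrightarrow> 0) (at_right 0)"
      using assms by real_asymp
    then show ?thesis
      by (simp add: True continuous_within B_prim_0 at_within_Ici_at_right B_prim_def[abs_def])
  next
    case False
    with \<open>t \<in> {0..}\<close> have "t > 0" by simp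
    from DERIV_isCont[OF DERIV_B_prim[OF assms this]] show ?thesis
      by (rule continuous_at_imp_continuous_at_within)
  qed
qed

lemma continuous_on_B_prim2:
  assumes "k > 0"
  shows "continuous_on {0..} (B_prim2 k)"
proof -
  have 1: "continuous_on {0..} (\<lambda>t. dilog (exp (- (k * t))))"
    by (rule continuous_on_compose2[OF continuous_on_dilog])
       (use assms in \<open>auto intro!: continuous_intros\<close>)
  have 2: "continuous_on {0..} (\<lambda>t. t * ln (k * t))"
    unfolding continuous_on_eq_continuous_within
  proof
    fix t :: real assume t: "t \<in> {0..}"
    show "continuous (at t within {0..}) (\<lambda>t. t * ln (k * t))"
    proof (cases "t = 0")
      case True
      have "((\<lambda>t. t * ln (k * t)) \<longlongrightarrow> 0) (at_right 0)"
        using assms by real_asymp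
      then show ?thesis by (simp add: True continuous_within at_within_Ici_at_right)
    next
      case False
      with t assms have "isCont (\<lambda>t. t * ln (k * t)) t"
        by (auto intro!: continuous_intros)
      then show ?thesis by (rule continuous_at_imp_continuous_at_within)
    qed
  qed
  show ?thesis
    unfolding B_prim2_def[abs_def] by (intro continuous_intros 1 2) (use assms in auto)
qed

lemma B_has_integral:
  assumes "\<alpha> > 0" "\<mu> \<ge> 0"
  shows "((\<lambda>t. 2 * pi * \<alpha> * B (\<alpha> * t)) has_integral B_prim (2 * pi * \<alpha>) \<mu>) {0..\<mu>}"
proof -
  have k: "2 * pi * \<alpha> > 0" using assms by simp
  have "((\<lambda>t. 2 * pi * \<alpha> * B (\<alpha> * t)) has_integral
      (B_prim (2 * pi * \<alpha>) \<mu> - B_prim (2 * pi * \<alpha>) 0)) {0..\<mu>}"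
  \<comment> \<open>Differentiation is claimed only in the interior: at 0 the integrand has the
    default value of \<open>B\<close>, not its limit.\<close>
  proof (rule fundamental_theorem_of_calculus_interior)
    show "continuous_on {0..\<mu>} (B_prim (2 * pi * \<alpha>))"
      by (rule continuous_on_subset[OF continuous_on_B_prim[OF k]]) auto
    show "(B_prim (2 * pi * \<alpha>) has_vector_derivative 2 * pi * \<alpha> * B (\<alpha> * t)) (at t)"
      if "t \<in> {0<..<\<mu>}" for t
      using DERIV_B_prim[OF k, of t] that
      by (simp add: has_real_derivative_iff_has_vector_derivative)
  qed (use assms in auto)
  then show ?thesis by (simp add: B_prim_0)
qed

text \<open>Integration by parts: since the weight has slope 1,
  \<open>(t - \<mu> - 1/2) * B_prim k t - B_prim2 k t\<close> is an antiderivative. Its lower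
  boundary value supplies pi / (12 \<alpha>), which later cancels the leading term of the
  formula.\<close>

lemma weighted_B_has_integral:
  assumes "\<alpha> > 0" "\<mu> \<ge> 0"
  shows "((\<lambda>t. 2 * pi * \<alpha> * ((t - \<mu> - 1/2) * B (\<alpha> * t))) has_integral
     (pi / (12 * \<alpha>) - B_prim (2 * pi * \<alpha>) \<mu> / 2 - B_prim2 (2 * pi * \<alpha>) \<mu>)) {0..\<mu>}"
proof -
  define k where "k = 2 * pi * \<alpha>"
  have k: "k > 0" using assms by (simp add: k_def)
  let ?F = "\<lambda>t. (t - \<mu> - 1/2) * B_prim k t - B_prim2 k t"
  have "((\<lambda>t. k * ((t - \<mu> - 1/2) * B (\<alpha> * t))) has_integral (?F \<mu> - ?F 0)) {0..\<mu>}"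
  proof (rule fundamental_theorem_of_calculus_interior)
    show "continuous_on {0..\<mu>} ?F"
      by (intro continuous_intros continuous_on_subset[OF continuous_on_B_prim[OF k]]
          continuous_on_subset[OF continuous_on_B_prim2[OF k]]) auto
    fix t assume t: "t \<in> {0<..<\<mu>}"
    have d1: "(B_prim k has_real_derivative k * B (\<alpha> * t)) (at t)"
      using DERIV_B_prim[OF k, of t] t by (simp add: k_def)
    have d2: "(B_prim2 k has_real_derivative B_prim k t) (at t)"
      using DERIV_B_prim2[OF k, of t] t by simp
    show "(?F has_vector_derivative k * ((t - \<mu> - 1/2) * B (\<alpha> * t))) (at t)"
      unfolding has_real_derivative_iff_has_vector_derivative[symmetric]
      by (auto intro!: derivative_eq_intros d1 d2 simp: algebra_simps)
  qed (use assms in auto)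
  then show ?thesis
    using assms by (simp add: k_def B_prim_0 B_prim2_0 power2_eq_square field_simps)
qed

lemma set_integrable_times_B:
  fixes p u :: "real \<Rightarrow> real"
  assumes p: "continuous_on {a..b} p" and [measurable]: "u \<in> borel_measurable borel"
  shows "set_integrable lborel {a..b} (\<lambda>t. p t * B (u t))"
proof -
  have i: "set_integrable lborel {a..b} p"
    by (rule borel_integrable_atLeastAtMost') (rule p)
  have m: "set_borel_measurable lborel {a..b} (\<lambda>t. p t * B (u t))"
  proof -
    have "(\<lambda>t. indicat_real {a..b} t *\<^sub>R p t) \<in> borel_measurable lborel"
      using i unfolding set_integrable_def by auto
    then have "(\<lambda>t. (indicat_real {a..b} t *\<^sub>R p t) * B (u t)) \<in> borel_measurable lborel"
      by measurable
    then show ?thesis unfolding set_borel_measurable_def by (simp add: mult.assoc)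
  qed
  show ?thesis
  proof (rule set_integrable_bound[OF i m])
    have "\<bar>p t * B (u t)\<bar> \<le> \<bar>p t\<bar>" for t
      using abs_B_le[of "u t"] by (simp add: abs_mult mult_right_le_one_le)
    then show "AE t in lborel. t \<in> {a..b} \<longrightarrow> norm (p t * B (u t)) \<le> norm (p t)"
      by simp
  qed
qed

section \<open>Fourier sine transform of the Bose kernel\<close>

text \<open>Euler's sine product at the imaginary point i x. All partial products are purely
  imaginary, so taking imaginary parts returns to the reals before the logarithm is applied.\<close>

lemma ln_sinh_sums:
  fixes x :: real
  assumes x: "x > 0"
  shows "(\<lambda>n. ln (1 + x\<^sup>2 / (real (Suc n))\<^sup>2)) sums ln (sinh (pi * x) / (pi * x))"
proof -
  have "(\<lambda>n. Im (of_real pi * (\<i> * of_real x) * (\<Prod>k=1..n. 1 - (\<i> * of_real x)\<^sup>2 / (of_nat k)\<^sup>2)))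
      \<longlonglongrightarrow> Im (sin (of_real pi * (\<i> * of_real x)))"
    by (intro tendsto_intros sin_product_formula_complex)
  also have "sin (of_real pi * (\<i> * of_real x)) = \<i> * of_real (sinh (pi * x))"
  proof -
    have "of_real pi * (\<i> * of_real x) = \<i> * complex_of_real (pi * x)" by simp
    also have "sin \<dots> = \<i> * ((exp (of_real (pi * x)) - inverse (exp (of_real (pi * x)))) / 2)"
      by (rule sin_i_times)
    also have "\<dots> = \<i> * of_real (sinh (pi * x))"
      by (simp add: sinh_field_def exp_minus exp_of_real[symmetric])
    finally show ?thesis .
  qed
  also have "(\<lambda>n. Im (of_real pi * (\<i> * of_real x) * (\<Prod>k=1..n. 1 - (\<i> * of_real x)\<^sup>2 / (of_nat k)\<^sup>2)))
      = (\<lambda>n. pi * x * (\<Prod>k=1..n. 1 + x\<^sup>2 / (real k)\<^sup>2))"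
  proof
    fix n
    have "(\<Prod>k=1..n. 1 - (\<i> * complex_of_real x)\<^sup>2 / (of_nat k)\<^sup>2) = of_real (\<Prod>k=1..n. 1 + x\<^sup>2 / (real k)\<^sup>2)"
      by (simp add: power_mult_distrib)
    then have "of_real pi * (\<i> * of_real x) * (\<Prod>k=1..n. 1 - (\<i> * of_real x)\<^sup>2 / (of_nat k)\<^sup>2)
        = \<i> * complex_of_real (pi * x * (\<Prod>k=1..n. 1 + x\<^sup>2 / (real k)\<^sup>2))"
      by simp
    then show "Im (of_real pi * (\<i> * of_real x) * (\<Prod>k=1..n. 1 - (\<i> * of_real x)\<^sup>2 / (of_nat k)\<^sup>2))
      = pi * x * (\<Prod>k=1..n. 1 + x\<^sup>2 / (real k)\<^sup>2)"
      by (simp only: Im_i_times Re_complex_of_real)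
  qed
  finally have "(\<lambda>n. pi * x * (\<Prod>k=1..n. 1 + x\<^sup>2 / (real k)\<^sup>2)) \<longlonglongrightarrow> sinh (pi * x)"
    by simp
  then have "(\<lambda>n. pi * x * (\<Prod>k=1..n. 1 + x\<^sup>2 / (real k)\<^sup>2) / (pi * x)) \<longlonglongrightarrow> sinh (pi * x) / (pi * x)"
    using x by (intro tendsto_intros) auto
  then have "(\<lambda>n. \<Prod>k=1..n. 1 + x\<^sup>2 / (real k)\<^sup>2) \<longlonglongrightarrow> sinh (pi * x) / (pi * x)"
    using x by simp
  then have "(\<lambda>n. ln (\<Prod>k=1..n. 1 + x\<^sup>2 / (real k)\<^sup>2)) \<longlonglongrightarrow> ln (sinh (pi * x) / (pi * x))"
    using x by (intro tendsto_ln) auto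
  moreover have "ln (\<Prod>k=1..n. 1 + x\<^sup>2 / (real k)\<^sup>2) = (\<Sum>k<n. ln (1 + x\<^sup>2 / (real (Suc k))\<^sup>2))" for n
  proof -
    have pos: "1 + x\<^sup>2 / (real k)\<^sup>2 > 0" for k by (intro add_pos_nonneg) auto
    have "1 + x\<^sup>2 / (real k)\<^sup>2 \<noteq> 0" for k using pos[of k] by linarith
    then have "ln (\<Prod>k=1..n. 1 + x\<^sup>2 / (real k)\<^sup>2) = (\<Sum>k=1..n. ln (1 + x\<^sup>2 / (real k)\<^sup>2))"
      by (subst ln_prod) auto
    also have "\<dots> = (\<Sum>k<n. ln (1 + x\<^sup>2 / (real (Suc k))\<^sup>2))"
      by (simp only: One_nat_def sum.atLeast1_atMost_eq)
    finally show ?thesis .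
  qed
  ultimately show ?thesis by (simp add: sums_def)
qed

text \<open>Logarithmic differentiation of the product for sinh. This is the partial fraction
  expansion of coth, as B x = (coth (pi x) - 1/(pi x)) / 2.\<close>

lemma B_sums:
  assumes x: "x > 0"
  shows "(\<lambda>n. x / (x\<^sup>2 + (real (Suc n))\<^sup>2)) sums (pi * B x)"
proof -
  \<comment> \<open>A bounded neighbourhood of x, on which the differentiated terms have the
    majorant 2 (x + 1) / n^2.\<close>
  define S where "S = {0<..<x + 1}"
  define f where "f = (\<lambda>n y::real. ln (1 + y\<^sup>2 / (real (Suc n))\<^sup>2))"
  define f' where "f' = (\<lambda>n y::real. 2 * (y / (y\<^sup>2 + (real (Suc n))\<^sup>2)))"
  have bound: "norm (f' n y) \<le> 2 * (x + 1) * (1 / (real (Suc n))\<^sup>2)" if "y \<in> S" for n y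
  proof -
    have "y / (y\<^sup>2 + (real (Suc n))\<^sup>2) \<le> (x + 1) / (real (Suc n))\<^sup>2"
      using that by (intro frac_le) (auto simp: S_def)
    then have "2 * (y / (y\<^sup>2 + (real (Suc n))\<^sup>2)) \<le> 2 * ((x + 1) / (real (Suc n))\<^sup>2)"
      by (rule mult_left_mono) simp
    moreover have "f' n y \<ge> 0" using that by (simp add: f'_def S_def)
    ultimately show ?thesis by (simp add: f'_def)
  qed
  have summ: "summable (\<lambda>n. 2 * (x + 1) * (1 / (real (Suc n))\<^sup>2))"
    by (intro summable_mult summable_inverse_Suc_squares)
  have d: "(f n has_real_derivative f' n y) (at y)" for n y
  proof -
    have "1 + y\<^sup>2 / (real (Suc n))\<^sup>2 > 0" by (intro add_pos_nonneg) auto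
    moreover have "(2 * y / (real (Suc n))\<^sup>2) / (1 + y\<^sup>2 / (real (Suc n))\<^sup>2) = f' n y"
    proof -
      have "(real (Suc n))\<^sup>2 > 0" by simp
      then have "(2 * y / (real (Suc n))\<^sup>2) / (1 + y\<^sup>2 / (real (Suc n))\<^sup>2)
          = (2 * y / (real (Suc n))\<^sup>2) * (real (Suc n))\<^sup>2 / ((1 + y\<^sup>2 / (real (Suc n))\<^sup>2) * (real (Suc n))\<^sup>2)"
        by (simp del: of_nat_Suc)
      also have "\<dots> = 2 * y / (y\<^sup>2 + (real (Suc n))\<^sup>2)"
        using \<open>(real (Suc n))\<^sup>2 > 0\<close> by (simp del: of_nat_Suc add: distrib_right add.commute)
      finally show ?thesis by (simp add: f'_def)
    qed
    moreover have "((\<lambda>y. 1 + y\<^sup>2 / (real (Suc n))\<^sup>2) has_real_derivative 2 * y / (real (Suc n))\<^sup>2) (at y)"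
      by (rule DERIV_cong[OF DERIV_add[OF DERIV_const DERIV_cdivide[where D = "2 * y"]]])
         (auto intro!: derivative_eq_intros)
    ultimately show ?thesis
      unfolding f_def using DERIV_chain2[OF DERIV_ln_divide] by fastforce
  qed
  have D: "((\<lambda>y. \<Sum>n. f n y) has_field_derivative (\<Sum>n. f' n x)) (at x)"
  proof (rule has_field_derivative_series'(2)[where S = S and x0 = x])
    show "convex S" by (simp add: S_def)
    show "(f n has_real_derivative f' n y) (at y within S)" for n y
      using d by (rule has_field_derivative_at_within)
    show "uniformly_convergent_on S (\<lambda>n y. \<Sum>i<n. f' i y)"
      by (rule Weierstrass_m_test'[OF bound summ])
    show "x \<in> S" "x \<in> interior S" using x by (auto simp: S_def)
    show "summable (\<lambda>n. f n x)"
      using ln_sinh_sums[OF x] by (simp add: f_def sums_iff)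
  qed
  have sinh_pos: "sinh (pi * x) > 0" using x by simp
  have "((\<lambda>y. ln (sinh (pi * y) / (pi * y))) has_real_derivative
          (pi * cosh (pi * x) / sinh (pi * x) - 1 / x)) (at x)"
    using x sinh_pos by (auto intro!: derivative_eq_intros simp: field_simps)
  moreover have "((\<lambda>y. ln (sinh (pi * y) / (pi * y))) has_real_derivative (\<Sum>n. f' n x)) (at x)"
    using D
  proof (rule DERIV_cong_ev[THEN iffD1, OF refl _ refl, rotated])
    show "\<forall>\<^sub>F y in nhds x. (\<Sum>n. f n y) = ln (sinh (pi * y) / (pi * y))"
      using eventually_nhds_in_open[of "{0<..}" x] x
      by (auto elim!: eventually_mono simp: f_def sums_unique[OF ln_sinh_sums] simp del: of_nat_Suc)
  qed
  ultimately have eq: "(\<Sum>n. f' n x) = pi * cosh (pi * x) / sinh (pi * x) - 1 / x"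
    using DERIV_unique by blast
  have "summable (\<lambda>n. f' n x)"
    by (rule summable_comparison_test'[OF summ, of 0]) (use bound x in \<open>auto simp: S_def\<close>)
  then have "(\<lambda>n. f' n x / 2) sums ((pi * cosh (pi * x) / sinh (pi * x) - 1 / x) / 2)"
    unfolding eq[symmetric] by (intro sums_divide summable_sums)
  also have "(pi * cosh (pi * x) / sinh (pi * x) - 1 / x) / 2 = pi * B x"
  proof -
    define e where "e = exp (pi * x)"
    have e: "e > 1" using x by (simp add: e_def)
    have e2: "exp (2 * pi * x) = e\<^sup>2" unfolding e_def by (simp add: exp_double[symmetric])
    have ne: "e\<^sup>2 - 1 \<noteq> 0" using e by (simp add: power2_eq_1_iff)
    have "cosh (pi * x) / sinh (pi * x) = (e\<^sup>2 + 1) / (e\<^sup>2 - 1)"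
      unfolding cosh_field_def sinh_field_def exp_minus e_def[symmetric]
      using e ne by (simp add: field_simps power2_eq_square)
    also have "\<dots> = 2 / (e\<^sup>2 - 1) + 1"
      using ne by (simp add: field_simps)
    finally have "cosh (pi * x) / sinh (pi * x) = 2 / (e\<^sup>2 - 1) + 1" .
    moreover have "pi * cosh (pi * x) / sinh (pi * x) = pi * (cosh (pi * x) / sinh (pi * x))" by simp
    ultimately have "(pi * cosh (pi * x) / sinh (pi * x) - 1 / x) / 2 = (pi * (2 / (e\<^sup>2 - 1) + 1) - 1 / x) / 2"
      by metis
    also have "\<dots> = pi * (1 / (e\<^sup>2 - 1) - 1 / (2 * pi * x) + 1 / 2)"
      using x ne by (simp add: field_simps)
    finally show ?thesis unfolding B_def e2 .
  qed
  also have "(\<lambda>n. f' n x / 2) = (\<lambda>n. x / (x\<^sup>2 + (real (Suc n))\<^sup>2))"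
    unfolding f'_def by (intro ext nonzero_mult_div_cancel_left) simp
  finally show ?thesis .
qed

lemma set_integrable_exp_neg:
  fixes k :: real assumes "k > 0"
  shows "set_integrable lborel {0<..} (\<lambda>t. exp (- (k * t)))"
    and "(LINT t:{0<..}|lborel. exp (- (k * t))) = 1 / k"
  using integrable_I0i_exp_mscale[OF assms] LBINT_I0i_exp_mscale[OF assms]
  by (simp_all add: mult.commute interval_lebesgue_integral_0_infty)

text \<open>The factor t from |sin (y t)| \<le> |y| t is absorbed by half of the exponential.
  Integrated, this gives O(1/k^2), summable over k = c m; the trivial bound |sin| \<le> 1 would only
  give 1/k.\<close>

lemma abs_sin_times_exp_le:
  fixes k y t :: real assumes "k > 0" "t > 0"
  shows "\<bar>exp (- (k * t)) * sin (y * t)\<bar> \<le> 2 * \<bar>y\<bar> / k * exp (- (k / 2 * t))"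
proof -
  have "\<bar>sin (y * t)\<bar> \<le> \<bar>y\<bar> * t"
    using abs_sin_x_le_abs_x[of "y * t"] assms by (simp add: abs_mult)
  then have "\<bar>exp (- (k * t)) * sin (y * t)\<bar> \<le> exp (- (k * t)) * (\<bar>y\<bar> * t)"
    by (simp add: abs_mult)
  also have "\<dots> = exp (- (k / 2 * t)) * \<bar>y\<bar> * (exp (- (k / 2 * t)) * t)"
    by (simp add: mult_exp_exp)
  also have "\<dots> \<le> exp (- (k / 2 * t)) * \<bar>y\<bar> * (2 / k)"
  proof (rule mult_left_mono)
    have "k / 2 * t \<le> exp (k / 2 * t)" using exp_ge_add_one_self[of "k/2 * t"] by linarith
    then show "exp (- (k / 2 * t)) * t \<le> 2 / k" using assms by (simp add: exp_minus field_simps)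
  qed simp
  finally show ?thesis by (simp add: mult_ac)
qed

lemma LINT_exp_sin:
  fixes k y :: real assumes k: "k > 0"
  shows "set_integrable lborel {0<..} (\<lambda>t. exp (- (k * t)) * sin (y * t))"
    and "(LINT t:{0<..}|lborel. exp (- (k * t)) * sin (y * t)) = y / (y\<^sup>2 + k\<^sup>2)"
    and "(LINT t:{0<..}|lborel. \<bar>exp (- (k * t)) * sin (y * t)\<bar>) \<le> 4 * \<bar>y\<bar> / k\<^sup>2"
proof -
  let ?f = "\<lambda>t. exp (- (k * t)) * sin (y * t)"
  have i2: "set_integrable lborel {0<..} (\<lambda>t. 2 * \<bar>y\<bar> / k * exp (- (k / 2 * t)))"
    using set_integrable_exp_neg(1)[of "k / 2"] k by (intro set_integrable_mult_right) auto
  show i: "set_integrable lborel {0<..} ?f"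
    by (rule set_integrable_bound[OF i2])
       (use abs_sin_times_exp_le[OF k, of _ y] k in \<open>auto simp: set_borel_measurable_def intro!: AE_I2\<close>)
  have "(LINT t:{0<..}|lborel. \<bar>?f t\<bar>) \<le> (LINT t:{0<..}|lborel. 2 * \<bar>y\<bar> / k * exp (- (k / 2 * t)))"
    by (rule set_integral_mono[OF set_integrable_abs[OF i] i2]) (use abs_sin_times_exp_le[OF k] in auto)
  also have "\<dots> = 4 * \<bar>y\<bar> / k\<^sup>2"
    using set_integrable_exp_neg(2)[of "k / 2"] k by (simp add: power2_eq_square)
  finally show "(LINT t:{0<..}|lborel. \<bar>?f t\<bar>) \<le> 4 * \<bar>y\<bar> / k\<^sup>2" .
  have pos: "y\<^sup>2 + k\<^sup>2 > 0" using k by (simp add: add_nonneg_pos)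
  let ?F = "\<lambda>t. - (exp (- (k * t)) * (k * sin (y * t) + y * cos (y * t)) / (y\<^sup>2 + k\<^sup>2))"
  have lim: "(?F \<longlongrightarrow> 0) at_top"
  proof (rule Lim_null_comparison)
    show "\<forall>\<^sub>F t in at_top. norm (?F t) \<le> (k + \<bar>y\<bar>) / (y\<^sup>2 + k\<^sup>2) * exp (- (k * t))"
    proof (rule always_eventually, rule allI)
      fix t
      have "\<bar>k * sin (y * t) + y * cos (y * t)\<bar> \<le> k * \<bar>sin (y * t)\<bar> + \<bar>y\<bar> * \<bar>cos (y * t)\<bar>"
        using k abs_triangle_ineq[of "k * sin (y * t)" "y * cos (y * t)"] by (simp add: abs_mult)
      also have "\<dots> \<le> k * 1 + \<bar>y\<bar> * 1"
        using k by (intro add_mono mult_left_mono) auto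
      finally have "exp (- (k * t)) * \<bar>k * sin (y * t) + y * cos (y * t)\<bar> / (y\<^sup>2 + k\<^sup>2)
          \<le> exp (- (k * t)) * (k + \<bar>y\<bar>) / (y\<^sup>2 + k\<^sup>2)"
        using pos by (intro divide_right_mono mult_left_mono) auto
      then show "norm (?F t) \<le> (k + \<bar>y\<bar>) / (y\<^sup>2 + k\<^sup>2) * exp (- (k * t))"
        using pos by (simp add: abs_mult mult_ac)
    qed
    show "((\<lambda>t. (k + \<bar>y\<bar>) / (y\<^sup>2 + k\<^sup>2) * exp (- (k * t))) \<longlongrightarrow> 0) at_top"
      using k by (intro tendsto_mult_right_zero) real_asymp
  qed
  have "(LBINT t=ereal 0..\<infinity>. ?f t) = 0 - ?F 0"
  proof (rule interval_integral_FTC_integrable)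
    show "(?F has_vector_derivative ?f t) (at t)" for t
    proof -
      have "((\<lambda>t. - 1 / (y\<^sup>2 + k\<^sup>2) * (exp (- (k * t)) * (k * sin (y * t) + y * cos (y * t)))) has_real_derivative
          - 1 / (y\<^sup>2 + k\<^sup>2) * ((exp (- (k * t)) * (- k)) * (k * sin (y * t) + y * cos (y * t))
           + exp (- (k * t)) * (k * (cos (y * t) * y) + y * (- sin (y * t) * y)))) (at t)"
        by (intro DERIV_cmult) (auto intro!: derivative_eq_intros)
      also have "- 1 / (y\<^sup>2 + k\<^sup>2) * ((exp (- (k * t)) * (- k)) * (k * sin (y * t) + y * cos (y * t))
           + exp (- (k * t)) * (k * (cos (y * t) * y) + y * (- sin (y * t) * y)))
          = - 1 / (y\<^sup>2 + k\<^sup>2) * (- (exp (- (k * t)) * sin (y * t) * (y\<^sup>2 + k\<^sup>2)))"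
        by (rule arg_cong[where f = "(*) (- 1 / (y\<^sup>2 + k\<^sup>2))"]) (simp add: algebra_simps power2_eq_square)
      also have "\<dots> = ?f t" using pos by simp
      finally show ?thesis by (simp add: has_real_derivative_iff_has_vector_derivative)
    qed
    show "isCont ?f t" for t by (auto intro!: continuous_intros)
    show "set_integrable lborel (einterval (ereal 0) \<infinity>) ?f" using i by (simp add: einterval_def greaterThan_def)
    have "isCont ?F 0" using pos by (auto intro!: continuous_intros)
    then have "(?F \<longlongrightarrow> ?F 0) (at_right 0)"
      unfolding isCont_def by (rule filterlim_mono) (auto simp: at_le)
    then show "((?F \<circ> real_of_ereal) \<longlongrightarrow> ?F 0) (at_right (ereal 0))"
      by (simp only: ereal_tendsto_simps)
    show "((?F \<circ> real_of_ereal) \<longlongrightarrow> 0) (at_left \<infinity>)"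
      using lim by (simp only: ereal_tendsto_simps)
  qed auto
  then show "(LINT t:{0<..}|lborel. ?f t) = y / (y\<^sup>2 + k\<^sup>2)"
    by (simp add: interval_lebesgue_integral_0_infty zero_ereal_def[symmetric])
qed

text \<open>With c = 2 pi n / \<alpha> this is the factor common to the n-th sine term (at t) and
  the n-th cosine term (at t = 1).\<close>

definition bose :: "real \<Rightarrow> real \<Rightarrow> real" where
  "bose c t = 1 / (exp (c * t) - 1)"

lemma bose_sums:
  assumes "c > 0" "t > 0"
  shows "(\<lambda>m. exp (- (c * real (Suc m) * t))) sums bose c t"
proof -
  have e: "exp (- (c * t)) < 1" using assms by simp
  have "(\<lambda>m. exp (- (c * t)) * exp (- (c * t)) ^ m) sums (exp (- (c * t)) * (1 / (1 - exp (- (c * t)))))"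
    by (intro sums_mult geometric_sums) (use e in auto)
  moreover have "exp (- (c * t)) * (1 / (1 - exp (- (c * t)))) = bose c t"
    using assms by (simp add: bose_def exp_minus field_simps)
  moreover have "exp (- (c * t)) * exp (- (c * t)) ^ m = exp (- (c * real (Suc m) * t))" for m
    by (simp add: exp_of_nat_mult[symmetric] mult_exp_exp algebra_simps)
  ultimately show ?thesis by simp
qed

text \<open>Expand the kernel as a geometric series of exponentials and integrate termwise. The
  elementary integrals y / (y^2 + (c m)^2) are the partial fractions of \<open>B\<close> at y/c, up
  to the factor 1/c.\<close>

lemma LINT_bose_sin_pos:
  assumes c: "c > 0" and y: "y > 0"
  shows "(LINT t:{0<..}|lborel. bose c t * sin (y * t)) = pi / c * B (y / c)"
proof -
  let ?g = "\<lambda>m t. indicator {0<..} t *\<^sub>R (exp (- (c * real (Suc m) * t)) * sin (y * t))"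
  have k: "c * real (Suc m) > 0" for m using c by simp
  have "(\<lambda>m. \<integral>t. ?g m t \<partial>lborel) sums (\<integral>t. (\<Sum>m. ?g m t) \<partial>lborel)"
  proof (rule sums_integral)
    show "integrable lborel (?g m)" for m
      using LINT_exp_sin(1)[OF k[of m], of y] unfolding set_integrable_def .
    show "AE t in lborel. summable (\<lambda>m. norm (?g m t))"
    proof (rule AE_I2)
      fix t
      show "summable (\<lambda>m. norm (?g m t))"
      proof (cases "t > 0")
        case True
        have "summable (\<lambda>m. exp (- (c * real (Suc m) * t)) * \<bar>sin (y * t)\<bar>)"
          using bose_sums[OF c True] by (intro summable_mult2) (simp add: sums_iff)
        then show ?thesis using True by (simp add: abs_mult del: of_nat_Suc)
      qed simp
    qed
    have "norm (\<integral>t. norm (?g m t) \<partial>lborel) \<le> 4 * y / c\<^sup>2 * (1 / (real (Suc m))\<^sup>2)" for m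
    proof -
      have "(\<integral>t. norm (?g m t) \<partial>lborel) = (LINT t:{0<..}|lborel. \<bar>exp (- (c * real (Suc m) * t)) * sin (y * t)\<bar>)"
        unfolding set_lebesgue_integral_def by (rule Bochner_Integration.integral_cong) (auto simp: indicator_def)
      also have "\<dots> \<le> 4 * \<bar>y\<bar> / (c * real (Suc m))\<^sup>2"
        by (rule LINT_exp_sin(3)[OF k])
      finally have "(\<integral>t. norm (?g m t) \<partial>lborel) \<le> 4 * y / c\<^sup>2 * (1 / (real (Suc m))\<^sup>2)"
        using y by (simp add: power_mult_distrib)
      moreover have "(\<integral>t. norm (?g m t) \<partial>lborel) \<ge> 0"
        by (rule integral_nonneg_AE) auto
      ultimately show ?thesis by simp
    qed
    then show "summable (\<lambda>m. \<integral>t. norm (?g m t) \<partial>lborel)"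
      by (intro summable_comparison_test'[OF summable_mult[OF summable_inverse_Suc_squares]])
  qed
  moreover have "(\<integral>t. (\<Sum>m. ?g m t) \<partial>lborel) = (LINT t:{0<..}|lborel. bose c t * sin (y * t))"
    unfolding set_lebesgue_integral_def
  proof (rule Bochner_Integration.integral_cong[OF refl])
    fix t
    show "(\<Sum>m. ?g m t) = indicator {0<..} t *\<^sub>R (bose c t * sin (y * t))"
    proof (cases "t > 0")
      case True
      from sums_mult2[OF bose_sums[OF c True], of "sin (y * t)"] show ?thesis
        using True by (simp add: sums_iff del: of_nat_Suc)
    qed simp
  qed
  moreover have "(\<integral>t. ?g m t \<partial>lborel) = 1 / c * ((y/c) / ((y/c)\<^sup>2 + (real (Suc m))\<^sup>2))" for m
  proof -
    have "(\<integral>t. ?g m t \<partial>lborel) = y / (y\<^sup>2 + (c * real (Suc m))\<^sup>2)"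
      using LINT_exp_sin(2)[OF k[of m], of y] unfolding set_lebesgue_integral_def .
    also have "y\<^sup>2 + (c * real (Suc m))\<^sup>2 = c\<^sup>2 * ((y/c)\<^sup>2 + (real (Suc m))\<^sup>2)"
      using c by (simp add: power_mult_distrib power_divide distrib_left del: of_nat_Suc)
    finally show ?thesis using c by (simp add: power2_eq_square del: of_nat_Suc)
  qed
  ultimately have "(\<lambda>m. 1 / c * ((y/c) / ((y/c)\<^sup>2 + (real (Suc m))\<^sup>2))) sums
     (LINT t:{0<..}|lborel. bose c t * sin (y * t))"
    by simp
  moreover have "(\<lambda>m. 1 / c * ((y/c) / ((y/c)\<^sup>2 + (real (Suc m))\<^sup>2))) sums (1 / c * (pi * B (y / c)))"
    using c y by (intro sums_mult B_sums) auto
  ultimately show ?thesis using sums_unique2 by fastforce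
qed

text \<open>Both sides are odd in y. The point y = 0 is excluded because the integral is 0 there
  while \<open>B 0 = 1/2\<close>.\<close>

lemma LINT_bose_sin:
  assumes c: "c > 0" and y: "y \<noteq> 0"
  shows "(LINT t:{0<..}|lborel. bose c t * sin (y * t)) = pi / c * B (y / c)"
proof (cases "y > 0")
  case False
  then have "(LINT t:{0<..}|lborel. bose c t * sin (- y * t)) = pi / c * B (- y / c)"
    using y by (intro LINT_bose_sin_pos c) auto
  moreover have "B (- y / c) = - B (y / c)"
    using B_minus[of "y / c"] y c by simp
  ultimately show ?thesis by (simp add: set_lebesgue_integral_def)
qed (use LINT_bose_sin_pos[OF c] in auto)

section \<open>The principal value integral as a series\<close>

lemma borel_measurable_bose [measurable]: "bose c \<in> borel_measurable borel"
  unfolding bose_def[abs_def] by measurable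

lemma bose_pos: "c > 0 \<Longrightarrow> t > 0 \<Longrightarrow> bose c t > 0"
  by (simp add: bose_def)

lemma bose_le:
  assumes "c > 0" "t > 0"
  shows "bose c t \<le> exp (- (c * t / 2)) / (c * t)"
proof -
  have ct: "c * t > 0" using assms by simp
  have "bose c t \<le> 1 / (c * t * exp (c * t / 2))"
    unfolding bose_def using mult_exp_half_le[of "c * t"] ct by (intro divide_left_mono) auto
  also have "\<dots> = exp (- (c * t / 2)) / (c * t)"
    by (simp add: exp_minus divide_simps)
  finally show ?thesis .
qed

lemma abs_bose_sin_le:
  assumes "c > 0" "t > 0"
  shows "\<bar>bose c t * sin (a * t)\<bar> \<le> \<bar>a\<bar> / c * exp (- (c / 2 * t))"
proof -
  have "\<bar>bose c t * sin (a * t)\<bar> = bose c t * \<bar>sin (a * t)\<bar>"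
    using bose_pos[OF assms] by (simp add: abs_mult)
  also have "\<dots> \<le> exp (- (c * t / 2)) / (c * t) * (\<bar>a\<bar> * t)"
    using bose_le[OF assms] bose_pos[OF assms] abs_sin_x_le_abs_x[of "a * t"] assms
    by (intro mult_mono) (auto simp: abs_mult)
  also have "\<dots> = \<bar>a\<bar> / c * exp (- (c / 2 * t))"
    using assms by simp
  finally show ?thesis .
qed

lemma DERIV_bose:
  assumes "c > 0" "t > 0"
  shows "(bose c has_real_derivative - (c * exp (c * t) * (bose c t)\<^sup>2)) (at t)"
  unfolding bose_def[abs_def] using assms
  by (auto intro!: derivative_eq_intros simp: power2_eq_square)

text \<open>A Lipschitz constant explicit in c and a, obtained by bounding the derivative on
  {1/2..3/2}. With c and a both proportional to n it is O(1/n), the rate that the sum over n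
  requires.\<close>

lemma bose_sin_lipschitz_at_1:
  assumes c: "c > 0" and t: "1/2 \<le> t" "t \<le> 3/2"
  shows "\<bar>bose c t * sin (a * t) / (1 + t) - bose c 1 * sin a / 2\<bar>
           \<le> (4 / c + 8 * (\<bar>a\<bar> + 1) / c\<^sup>2) * \<bar>t - 1\<bar>"
proof -
  define F where "F = (\<lambda>t. bose c t * sin (a * t) / (1 + t))"
  define F' where "F' = (\<lambda>t. ((- (c * exp (c * t) * (bose c t)\<^sup>2)) * sin (a * t) + cos (a * t) * a * bose c t) / (1 + t)
      - bose c t * sin (a * t) / (1 + t)\<^sup>2)"
  have "norm (F t - F 1) \<le> (4 / c + 8 * (\<bar>a\<bar> + 1) / c\<^sup>2) * norm (t - 1)"
  proof (rule field_differentiable_bound[where S = "{1/2..3/2}" and f' = F'])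
    fix s :: real assume s: "s \<in> {1/2..3/2}"
    have s0: "s > 0" using s by auto
    have "((\<lambda>t. bose c t * sin (a * t)) has_real_derivative
        (- (c * exp (c * s) * (bose c s)\<^sup>2)) * sin (a * s) + cos (a * s) * a * bose c s) (at s)"
      by (rule DERIV_mult[OF DERIV_bose[OF c s0]]) (auto intro!: derivative_eq_intros)
    then have "(F has_real_derivative
        (((- (c * exp (c * s) * (bose c s)\<^sup>2)) * sin (a * s) + cos (a * s) * a * bose c s) * (1 + s)
          - bose c s * sin (a * s) * 1) / ((1 + s) * (1 + s))) (at s)"
      unfolding F_def using s0 by (intro DERIV_divide) (auto intro!: derivative_eq_intros)
    also have "(((- (c * exp (c * s) * (bose c s)\<^sup>2)) * sin (a * s) + cos (a * s) * a * bose c s) * (1 + s)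
          - bose c s * sin (a * s) * 1) / ((1 + s) * (1 + s)) = F' s"
      unfolding F'_def using s0 by (simp add: diff_divide_distrib power2_eq_square)
    finally show "(F has_real_derivative F' s) (at s within {1/2..3/2})"
      by (rule has_field_derivative_at_within)
    have w0: "bose c s > 0" by (rule bose_pos[OF c s0])
    \<comment> \<open>The remaining exponential is traded for another factor 1/c. The resulting
      O(1/c^2) is needed because this quantity gets multiplied by a, which grows like c.\<close>
    have "bose c s \<le> exp (- (c * s / 2)) / (c * s)" by (rule bose_le[OF c s0])
    also have "\<dots> \<le> exp (- (c / 4)) / (c / 2)"
      using c s by (intro frac_le) auto
    also have "exp (- (c / 4)) \<le> 4 / c"
    proof -
      have "c / 4 \<le> exp (c / 4)" using exp_ge_add_one_self[of "c / 4"] by linarith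
      then show ?thesis using c by (simp add: exp_minus field_simps)
    qed
    then have "exp (- (c / 4)) / (c / 2) \<le> 4 / c / (c / 2)"
      using c by (intro divide_right_mono) auto
    finally have w1: "bose c s \<le> 8 / c\<^sup>2" by (simp add: power2_eq_square)
    have "(bose c s)\<^sup>2 \<le> (exp (- (c * s / 2)) / (c * s))\<^sup>2"
      using w0 bose_le[OF c s0] by (intro power_mono) auto
    also have "\<dots> = exp (- (c * s)) / (c * s)\<^sup>2"
      by (simp add: power_divide exp_double[symmetric])
    finally have "c * exp (c * s) * (bose c s)\<^sup>2 \<le> c * exp (c * s) * (exp (- (c * s)) / (c * s)\<^sup>2)"
      using c by (intro mult_left_mono) auto
    also have "\<dots> = 1 / (c * s\<^sup>2)"
      using c s0 by (simp add: exp_minus power2_eq_square field_simps)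
    also have "\<dots> \<le> 1 / (c * (1/2)\<^sup>2)"
      using c s by (intro divide_left_mono mult_left_mono power_mono mult_pos_pos) auto
    finally have w2: "c * exp (c * s) * (bose c s)\<^sup>2 \<le> 4 / c" by (simp add: power2_eq_square)
    have "\<bar>(- (c * exp (c * s) * (bose c s)\<^sup>2)) * sin (a * s)\<bar> \<le> c * exp (c * s) * (bose c s)\<^sup>2 * 1"
      unfolding abs_mult abs_minus_cancel using c by (intro mult_mono) auto
    moreover have "\<bar>cos (a * s) * a * bose c s\<bar> \<le> 1 * \<bar>a\<bar> * bose c s"
      unfolding abs_mult using w0 by (intro mult_mono) auto
    ultimately have n1: "\<bar>(- (c * exp (c * s) * (bose c s)\<^sup>2)) * sin (a * s) + cos (a * s) * a * bose c s\<bar>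
        \<le> c * exp (c * s) * (bose c s)\<^sup>2 + \<bar>a\<bar> * bose c s"
      by linarith
    have n2: "\<bar>x / (1 + s)\<bar> \<le> \<bar>x\<bar>" "\<bar>x / (1 + s)\<^sup>2\<bar> \<le> \<bar>x\<bar>" for x
    proof -
      have "\<bar>x\<bar> / \<bar>1 + s\<bar> \<le> \<bar>x\<bar> / 1" using s0 by (intro divide_left_mono) auto
      then show "\<bar>x / (1 + s)\<bar> \<le> \<bar>x\<bar>" by simp
      have "1 \<le> (1 + s)\<^sup>2" using s0 by (simp add: one_le_power)
      then have "\<bar>x\<bar> / (1 + s)\<^sup>2 \<le> \<bar>x\<bar> / 1" by (intro divide_left_mono) auto
      then show "\<bar>x / (1 + s)\<^sup>2\<bar> \<le> \<bar>x\<bar>" by simp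
    qed
    have n3: "\<bar>bose c s * sin (a * s)\<bar> \<le> bose c s * 1"
      unfolding abs_mult using w0 by (intro mult_mono) auto
    have "\<bar>F' s\<bar> \<le> (c * exp (c * s) * (bose c s)\<^sup>2 + \<bar>a\<bar> * bose c s) + bose c s"
      unfolding F'_def
      using order_trans[OF n2(1) n1] order_trans[OF n2(2) n3] by linarith
    also have "\<dots> \<le> 4 / c + (\<bar>a\<bar> + 1) * (8 / c\<^sup>2)"
      using w2 mult_left_mono[OF w1, of "\<bar>a\<bar> + 1"] by (simp add: algebra_simps)
    finally show "norm (F' s) \<le> 4 / c + 8 * (\<bar>a\<bar> + 1) / c\<^sup>2" by (simp add: mult.commute)
  qed (use t in auto)
  then show ?thesis by (simp add: F_def)
qed

text \<open>On the support of the kernel a factor 1/(1 - t) can be pulled out, leaving minus the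
  difference quotient at 1 of f t / (1 + t). At t = 1 both sides are 0 by division by zero.\<close>

lemma pv_reg_split:
  assumes "1/2 \<le> t" "t \<le> 3/2"
  shows "pv_reg f t = (f t / (1 + t) - f 1 / 2) / (1 - t)"
proof (cases "t = 1")
  case False
  have "1 - t\<^sup>2 = (1 + t) * (1 - t)" by (simp add: power2_eq_square algebra_simps)
  then show ?thesis
    using assms by (simp add: pv_reg_def pv_kernel_def diff_divide_distrib)
qed (simp add: pv_reg_def pv_kernel_def)

lemma pv_reg_outside:
  assumes "\<not> (1/2 \<le> t \<and> t \<le> 3/2)"
  shows "pv_reg f t = f t / (1 - t\<^sup>2)"
  using assms by (auto simp: pv_reg_def pv_kernel_def indicator_def)

lemma abs_pv_reg_bose_sin_le:
  assumes c: "c > 0" and t: "t > 0"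
  shows "\<bar>pv_reg (\<lambda>t. bose c t * sin (a * t)) t\<bar>
     \<le> 4/3 * (\<bar>a\<bar> / c) * exp (- (c / 2 * t)) + (4 / c + 8 * (\<bar>a\<bar> + 1) / c\<^sup>2) * indicator {1/2..3/2} t"
proof (cases "1/2 \<le> t \<and> t \<le> 3/2")
  case True
  let ?K = "4 / c + 8 * (\<bar>a\<bar> + 1) / c\<^sup>2"
  have K: "?K \<ge> 0" using c by (intro add_nonneg_nonneg divide_nonneg_nonneg) auto
  have "\<bar>pv_reg (\<lambda>t. bose c t * sin (a * t)) t\<bar>
      = \<bar>bose c t * sin (a * t) / (1 + t) - bose c 1 * sin a / 2\<bar> / \<bar>t - 1\<bar>"
    using True by (simp add: pv_reg_split abs_minus_commute)
  also have "\<dots> \<le> ?K"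
  proof (cases "t = 1")
    case False
    then show ?thesis
      using bose_sin_lipschitz_at_1[OF c, of t a] True by (subst pos_divide_le_eq) auto
  qed (use K in simp)
  also have "\<dots> \<le> 4/3 * (\<bar>a\<bar> / c) * exp (- (c / 2 * t)) + ?K"
    using c by simp
  finally show ?thesis using True by simp
next
  case False
  \<comment> \<open>The left end t = 1/2 is the critical one; beyond 3/2 the distance is at least
    5/4.\<close>
  have "3/4 \<le> \<bar>1 - t\<^sup>2\<bar>"
  proof (cases "t < 1/2")
    case True
    then have "t\<^sup>2 \<le> (1/2)\<^sup>2" using t by (intro power_mono) auto
    then show ?thesis by (simp add: power2_eq_square)
  next
    case f: False
    then have "(3/2)\<^sup>2 \<le> t\<^sup>2" using False by (intro power_mono) auto
    then show ?thesis by (simp add: power2_eq_square)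
  qed
  then have "\<bar>bose c t * sin (a * t)\<bar> / \<bar>1 - t\<^sup>2\<bar> \<le> (\<bar>a\<bar> / c * exp (- (c / 2 * t))) / (3/4)"
    using abs_bose_sin_le[OF c t, of a] by (intro frac_le) auto
  then show ?thesis using False by (simp add: pv_reg_outside)
qed

lemma pv_reg_bose_sin_integrable:
  assumes c: "c > 0"
  shows "set_integrable lborel {0<..} (pv_reg (\<lambda>t. bose c t * sin (a * t)))"
    and "(LINT t:{0<..}|lborel. \<bar>pv_reg (\<lambda>t. bose c t * sin (a * t)) t\<bar>)
           \<le> 4 / c + 8 / c\<^sup>2 + 11 * \<bar>a\<bar> / c\<^sup>2"
proof -
  let ?K = "4 / c + 8 * (\<bar>a\<bar> + 1) / c\<^sup>2"
  let ?g = "\<lambda>t. 4/3 * (\<bar>a\<bar> / c) * exp (- (c / 2 * t)) + ?K * indicator {1/2..3/2} t"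
  let ?f = "pv_reg (\<lambda>t. bose c t * sin (a * t))"
  have i1: "set_integrable lborel {0<..} (\<lambda>t. 4/3 * (\<bar>a\<bar> / c) * exp (- (c / 2 * t)))"
    using set_integrable_exp_neg(1)[of "c / 2"] c by (intro set_integrable_mult_right) auto
  have i3: "(\<lambda>t::real. indicator {0<..} t *\<^sub>R indicator {1/2..3/2} t) = (indicator {1/2..3/2} :: real \<Rightarrow> real)"
    by (auto simp: indicator_def fun_eq_iff)
  have i2: "set_integrable lborel {0<..} (\<lambda>t::real. ?K * indicator {1/2..3/2} t)"
    by (intro set_integrable_mult_right) (unfold set_integrable_def i3, simp)
  have i: "set_integrable lborel {0<..} ?g"
    by (rule set_integral_add(1)[OF i1 i2])
  have m: "?f \<in> borel_measurable borel"
    unfolding pv_reg_def[abs_def] by measurable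
  have le: "\<bar>?f t\<bar> \<le> ?g t" if "t > 0" for t
    by (rule abs_pv_reg_bose_sin_le[OF c that])
  show f: "set_integrable lborel {0<..} ?f"
  proof (rule set_integrable_bound[OF i])
    show "set_borel_measurable lborel {0<..} ?f"
      using m unfolding set_borel_measurable_def by measurable
    show "AE t in lborel. t \<in> {0<..} \<longrightarrow> norm (?f t) \<le> norm (?g t)"
      using le by (auto intro!: AE_I2 order_trans[OF _ abs_ge_self])
  qed
  have "(LINT t:{0<..}|lborel. \<bar>?f t\<bar>) \<le> (LINT t:{0<..}|lborel. ?g t)"
    by (rule set_integral_mono[OF set_integrable_abs[OF f] i]) (use le in auto)
  also have "\<dots> = 4/3 * (\<bar>a\<bar> / c) * (1 / (c / 2)) + ?K"
  proof -
    have "(LINT t:{0<..}|lborel. indicator {1/2..3/2::real} t :: real) = 1"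
      unfolding set_lebesgue_integral_def i3 by simp
    then show ?thesis
      using set_integral_add(2)[OF i1 i2] set_integrable_exp_neg(2)[of "c / 2"] c by simp
  qed
  \<comment> \<open>The coefficient of |a| / c^2 is 8/3 + 8, rounded up to 11.\<close>
  also have "\<dots> \<le> 4 / c + 8 / c\<^sup>2 + 11 * \<bar>a\<bar> / c\<^sup>2"
    using c by (simp add: field_simps power2_eq_square)
  finally show "(LINT t:{0<..}|lborel. \<bar>?f t\<bar>) \<le> 4 / c + 8 / c\<^sup>2 + 11 * \<bar>a\<bar> / c\<^sup>2" .
qed

definition pv_bose :: "real \<Rightarrow> real \<Rightarrow> real" where
  "pv_bose c a = (LINT t:{0<..}|lborel. pv_reg (\<lambda>t. bose c t * sin (a * t)) t)"

lemma sin_term_eq: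
  "sin_term \<alpha> \<nu> t n = 1 / real (Suc n) * (bose (2 * pi * real (Suc n) / \<alpha>) t * sin (2 * pi * real (Suc n) * \<nu> * t))"
  by (simp add: sin_term_def bose_def mult_ac del: of_nat_Suc)

lemma summable_abs_sin_term:
  assumes "\<alpha> > 0" "t > 0"
  shows "summable (\<lambda>n. \<bar>sin_term \<alpha> \<nu> t n\<bar>)"
proof (rule summable_comparison_test')
  let ?r = "exp (- (pi * t / \<alpha>))"
  show "summable (\<lambda>n. \<alpha> / (2 * pi * t) * ?r ^ Suc n)"
    using assms by (intro summable_mult) (subst summable_Suc_iff, simp)
  fix n :: nat
  let ?c = "2 * pi * real (Suc n) / \<alpha>"
  have c: "?c > 0" using assms by simp
  have w: "bose ?c t > 0" by (rule bose_pos[OF c assms(2)])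
  have "\<bar>sin_term \<alpha> \<nu> t n\<bar> = 1 / real (Suc n) * (bose ?c t * \<bar>sin (2 * pi * real (Suc n) * \<nu> * t)\<bar>)"
    unfolding sin_term_eq using w by (simp add: abs_mult del: of_nat_Suc)
  also have "\<dots> \<le> 1 * (bose ?c t * 1)"
    using w by (intro mult_mono) auto
  also have "\<dots> \<le> exp (- (?c * t / 2)) / (?c * t)"
    using bose_le[OF c assms(2)] by simp
  also have "\<dots> \<le> exp (- (?c * t / 2)) / (2 * pi * t / \<alpha>)"
  proof -
    have p: "0 < 2 * pi * t / \<alpha>" using assms by simp
    have "2 * pi * t / \<alpha> * 1 \<le> 2 * pi * t / \<alpha> * real (Suc n)"
      using assms by (intro mult_left_mono) auto
    then have "2 * pi * t / \<alpha> \<le> ?c * t" by (simp add: mult_ac)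
    then show ?thesis
      by (rule divide_left_mono) (use mult_pos_pos[OF mult_pos_pos[OF c assms(2)] p] in auto)
  qed
  also have "exp (- (?c * t / 2)) = ?r ^ Suc n"
    by (subst exp_of_nat_mult[symmetric]) (simp add: mult_ac del: of_nat_Suc)
  finally show "norm \<bar>sin_term \<alpha> \<nu> t n\<bar> \<le> \<alpha> / (2 * pi * t) * ?r ^ Suc n"
    by (simp add: mult.commute mult.left_commute)
qed

text \<open>\<open>pv_reg\<close> is linear in its function, so the regularised series is the series
  of the regularised terms. Their integrated absolute values are O(1/n^2): one factor 1/n is written
  in the term, the other comes from c and a growing like n. Hence sum and integral may be
  interchanged, and only then is the result read back as a principal value.\<close>

lemma pv_integrand_has_pv_integral:
  fixes \<alpha> \<nu> :: real
  assumes \<alpha>: "\<alpha> > 0"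
  defines "p \<equiv> (\<lambda>n. 1 / real (Suc n) * pv_bose (2 * pi * real (Suc n) / \<alpha>) (2 * pi * real (Suc n) * \<nu>))"
  shows "has_pv_integral (pv_integrand \<alpha> \<nu>) 1 {0<..} (\<Sum>n. p n)"
    and "summable (\<lambda>n. \<bar>p n\<bar>)"
proof -
  define c where "c = (\<lambda>n. 2 * pi * real (Suc n) / \<alpha>)"
  define a where "a = (\<lambda>n. 2 * pi * real (Suc n) * \<nu>)"
  define h where "h = (\<lambda>n t. indicator {0<..} t *\<^sub>R pv_reg (\<lambda>t. sin_term \<alpha> \<nu> t n) t)"
  define C where "C = 2 * \<alpha> / pi + 2 * \<alpha>\<^sup>2 / pi\<^sup>2 + 11 * \<bar>\<nu>\<bar> * \<alpha>\<^sup>2 / (2 * pi)"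
  have c: "c n > 0" for n using \<alpha> by (simp add: c_def)
  have st: "sin_term \<alpha> \<nu> t n = 1 / real (Suc n) * (bose (c n) t * sin (a n * t))" for t n
    unfolding sin_term_eq c_def a_def ..
  have reg: "pv_reg (\<lambda>t. sin_term \<alpha> \<nu> t n) t = 1 / real (Suc n) * pv_reg (\<lambda>t. bose (c n) t * sin (a n * t)) t" for n t
    unfolding st pv_reg_def by (simp add: right_diff_distrib del: of_nat_Suc)
  have hint: "integrable lborel (h n)" for n
    unfolding h_def reg using set_integrable_mult_right[OF pv_reg_bose_sin_integrable(1)[OF c, of n "a n"], of "1 / real (Suc n)"]
    by (simp add: set_integrable_def)
  have hval: "integral\<^sup>L lborel (h n) = p n" for n
    unfolding h_def reg p_def pv_bose_def
    using set_integral_mult_right[of lborel "{0<..}" "1 / real (Suc n)" "pv_reg (\<lambda>t. bose (c n) t * sin (a n * t))"]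
    by (simp add: set_lebesgue_integral_def c_def a_def del: of_nat_Suc)
  have cb: "4 / c n + 8 / (c n)\<^sup>2 + 11 * \<bar>a n\<bar> / (c n)\<^sup>2 \<le> C / real (Suc n)" for n
  proof -
    have N: "real (Suc n) \<ge> 1" by simp
    have "4 / c n = 2 * \<alpha> / pi / real (Suc n)"
      using \<alpha> by (simp add: c_def field_simps del: of_nat_Suc)
    moreover have "8 / (c n)\<^sup>2 \<le> 2 * \<alpha>\<^sup>2 / pi\<^sup>2 / real (Suc n)"
    proof -
      have "8 / (c n)\<^sup>2 = 2 * \<alpha>\<^sup>2 / pi\<^sup>2 / (real (Suc n))\<^sup>2"
        using \<alpha> by (simp add: c_def field_simps power2_eq_square del: of_nat_Suc)
      also have "\<dots> \<le> 2 * \<alpha>\<^sup>2 / pi\<^sup>2 / real (Suc n)"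
        using N by (intro divide_left_mono) (auto simp: power2_eq_square)
      finally show ?thesis .
    qed
    moreover have "11 * \<bar>a n\<bar> / (c n)\<^sup>2 = 11 * \<bar>\<nu>\<bar> * \<alpha>\<^sup>2 / (2 * pi) / real (Suc n)"
      using \<alpha> by (simp add: c_def a_def abs_mult field_simps power2_eq_square del: of_nat_Suc)
    ultimately show ?thesis unfolding C_def by (simp add: add_divide_distrib)
  qed
  have habs: "(\<integral>t. norm (h n t) \<partial>lborel) \<le> C * (1 / (real (Suc n))\<^sup>2)" for n
  proof -
    have "(\<integral>t. norm (h n t) \<partial>lborel) = 1 / real (Suc n) * (LINT t:{0<..}|lborel. \<bar>pv_reg (\<lambda>t. bose (c n) t * sin (a n * t)) t\<bar>)"
      unfolding h_def reg set_lebesgue_integral_def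
      by (subst integral_mult_right_zero[symmetric]) (auto simp: abs_mult intro!: Bochner_Integration.integral_cong)
    also have "\<dots> \<le> 1 / real (Suc n) * (C / real (Suc n))"
      by (intro mult_left_mono order_trans[OF pv_reg_bose_sin_integrable(2)[OF c] cb]) auto
    finally show ?thesis by (simp add: power2_eq_square)
  qed
  have sumh: "summable (\<lambda>n. \<integral>t. norm (h n t) \<partial>lborel)"
  proof (rule summable_comparison_test'[OF summable_mult[OF summable_inverse_Suc_squares]])
    show "norm (\<integral>t. norm (h n t) \<partial>lborel) \<le> C * (1 / (real (Suc n))\<^sup>2)" for n
      using habs[of n] integral_nonneg_AE[where M = lborel and f = "\<lambda>t. norm (h n t)"] by simp
  qed
  have "\<bar>p n\<bar> \<le> (\<integral>t. norm (h n t) \<partial>lborel)" for n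
    using integral_norm_bound[where M = lborel and f = "h n"] hval[of n] by simp
  then show "summable (\<lambda>n. \<bar>p n\<bar>)"
    by (intro summable_comparison_test'[OF sumh]) auto
  have sumn: "AE t in lborel. summable (\<lambda>n. norm (h n t))"
  proof (rule AE_I2)
    fix t
    show "summable (\<lambda>n. norm (h n t))"
    proof (cases "t > 0")
      case True
      have "summable (\<lambda>n. \<bar>sin_term \<alpha> \<nu> t n\<bar> * \<bar>1 / (1 - t\<^sup>2)\<bar> + \<bar>sin_term \<alpha> \<nu> 1 n\<bar> * \<bar>pv_kernel t\<bar>)"
        by (intro summable_add summable_mult2 summable_abs_sin_term \<alpha> True) simp
      then show ?thesis
      proof (rule summable_comparison_test')
        show "norm (norm (h n t)) \<le> \<bar>sin_term \<alpha> \<nu> t n\<bar> * \<bar>1 / (1 - t\<^sup>2)\<bar> + \<bar>sin_term \<alpha> \<nu> 1 n\<bar> * \<bar>pv_kernel t\<bar>" for n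
          using True abs_triangle_ineq4[of "sin_term \<alpha> \<nu> t n / (1 - t\<^sup>2)" "sin_term \<alpha> \<nu> 1 n * pv_kernel t"]
          by (simp add: h_def pv_reg_def abs_mult)
      qed
    qed (simp add: h_def)
  qed
  have eq: "(\<Sum>n. h n t) = indicator {0<..} t *\<^sub>R pv_reg (\<lambda>t. \<Sum>n. sin_term \<alpha> \<nu> t n) t" for t
  proof (cases "t > 0")
    case True
    have s: "summable (sin_term \<alpha> \<nu> u)" if "u > 0" for u
      using summable_abs_sin_term[OF \<alpha> that] by (rule summable_rabs_cancel)
    have "(\<lambda>n. sin_term \<alpha> \<nu> t n / (1 - t\<^sup>2) - sin_term \<alpha> \<nu> 1 n * pv_kernel t) sums
        ((\<Sum>n. sin_term \<alpha> \<nu> t n) / (1 - t\<^sup>2) - (\<Sum>n. sin_term \<alpha> \<nu> 1 n) * pv_kernel t)"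
      by (intro sums_diff sums_divide sums_mult2 summable_sums s True) simp
    then show ?thesis using True by (simp add: h_def pv_reg_def sums_iff)
  qed (simp add: h_def)
  have "integrable lborel (\<lambda>t. \<Sum>n. h n t)" "integral\<^sup>L lborel (\<lambda>t. \<Sum>n. h n t) = (\<Sum>n. p n)"
    using integrable_suminf[OF hint sumn sumh] integral_suminf[OF hint sumn sumh] by (simp_all add: hval)
  then have i: "set_integrable lborel {0<..} (pv_reg (\<lambda>t. \<Sum>n. sin_term \<alpha> \<nu> t n))"
    "(LINT t:{0<..}|lborel. pv_reg (\<lambda>t. \<Sum>n. sin_term \<alpha> \<nu> t n) t) = (\<Sum>n. p n)"
    unfolding set_integrable_def set_lebesgue_integral_def eq by auto
  from has_pv_integral_pv_reg[OF i(1)] show "has_pv_integral (pv_integrand \<alpha> \<nu>) 1 {0<..} (\<Sum>n. p n)"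
    unfolding pv_integrand_def[abs_def] i(2) .
qed

section \<open>Abel summation of the sawtooth series\<close>

text \<open>1 - e^(2 pi i s) = 2 sin (pi s) e^(i pi (s - 1/2)), and for 0 < s < 1 the angle lies in
  the principal range. This is where the sawtooth gets its closed form.\<close>

lemma Im_Ln_one_minus_cis:
  assumes "0 < s" "s < 1"
  shows "Im (Ln (1 - cis (2 * pi * s))) = - (pi * (1/2 - s))"
proof -
  have sn: "sin (pi * s) > 0"
    using assms by (intro sin_gt_zero) auto
  have "exp (Complex (ln (2 * sin (pi * s))) (pi * s - pi / 2)) = 1 - cis (2 * pi * s)"
  proof -
    have "cos (2 * (pi * s)) = 1 - 2 * (sin (pi * s))\<^sup>2" "sin (2 * (pi * s)) = 2 * sin (pi * s) * cos (pi * s)"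
      by (rule cos_double_sin sin_double)+
    then show ?thesis
      using sn by (simp add: complex_eq_iff Re_exp Im_exp cos_diff sin_diff mult.assoc power2_eq_square)
  qed
  moreover have "- pi < pi * s - pi / 2" "pi * s - pi / 2 \<le> pi"
  proof -
    have "0 < pi * s" "pi * s < pi * 1" using assms by (auto intro: mult_strict_left_mono)
    then show "- pi < pi * s - pi / 2" "pi * s - pi / 2 \<le> pi"
      using pi_gt_zero by linarith+
  qed
  ultimately have "Ln (1 - cis (2 * pi * s)) = Complex (ln (2 * sin (pi * s))) (pi * s - pi / 2)"
    by (intro Ln_unique) auto
  then show ?thesis by (simp add: algebra_simps)
qed

lemma sin_power_sums:
  assumes "0 \<le> r" "r < 1"
  shows "(\<lambda>n. r ^ Suc n / real (Suc n) * sin (2 * pi * real (Suc n) * s)) sums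
           (- Im (Ln (1 - of_real r * cis (2 * pi * s))))"
proof -
  let ?z = "of_real r * cis (2 * pi * s)"
  have "norm (- ?z) < 1" using assms by (simp add: norm_mult)
  from Ln_series'[OF this] have "(\<lambda>n. - (?z ^ n) / of_nat n) sums Ln (1 - ?z)"
    by simp
  then have "(\<lambda>n. - Im (- (?z ^ n) / of_nat n)) sums (- Im (Ln (1 - ?z)))"
    by (intro sums_minus sums_Im)
  moreover have "- Im (- (?z ^ n) / of_nat n) = r ^ n / real n * sin (2 * pi * real n * s)" for n
  proof -
    have "?z ^ n = of_real (r ^ n) * cis (real n * (2 * pi * s))"
      by (simp add: power_mult_distrib Complex.DeMoivre)
    moreover have "of_nat n = complex_of_real (real n)" by simp
    ultimately show ?thesis
      by (simp only: minus_divide_left[symmetric] uminus_complex.simps Im_divide_of_real) (simp add: mult_ac)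
  qed
  ultimately have "(\<lambda>n. r ^ n / real n * sin (2 * pi * real n * s)) sums (- Im (Ln (1 - ?z)))"
    by (simp only:)
  \<comment> \<open>The term of index 0 vanishes, so the series may be started at 1.\<close>
  then show ?thesis by (subst sums_Suc_iff) simp
qed

text \<open>Damping by r^n replaces pointwise convergence of the Fourier series: the damped series
  can be integrated termwise, and r -> 1 is taken on both sides. On the series side the assumed
  absolute summability dominates (Tannery). On the integral side 1 - r e^(2 pi i s) stays in the
  right half plane, so its argument is bounded by pi/2 and dominated convergence applies.\<close>

lemma suminf_sin_coeffs:
  fixes \<phi> :: "real \<Rightarrow> real"
  defines "c \<equiv> (\<lambda>n. LINT s:{0..1}|lborel. sin (2 * pi * real (Suc n) * s) * \<phi> s)"
  assumes \<phi>: "set_integrable lborel {0..1} \<phi>"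
    and summ: "summable (\<lambda>n. \<bar>1 / real (Suc n) * c n\<bar>)"
  shows "(\<Sum>n. 1 / real (Suc n) * c n) = pi * (LINT s:{0..1}|lborel. (1/2 - s) * \<phi> s)"
proof -
  define r where "r = (\<lambda>k::nat. 1 - 1 / (real k + 2))"
  define g where "g = (\<lambda>k s. - Im (Ln (1 - of_real (r k) * cis (2 * pi * s))))"
  have r: "0 \<le> r k" "r k < 1" for k by (simp_all add: r_def field_simps)
  have r_lim: "r \<longlonglongrightarrow> 1" unfolding r_def by real_asymp
  have \<phi>i: "integrable lborel (\<lambda>s. indicator {0..1} s * \<phi> s)"
    using \<phi> by (simp add: set_integrable_def)
  have \<phi>m [measurable]: "(\<lambda>s. indicator {0..1} s * \<phi> s) \<in> borel_measurable borel"
    using borel_measurable_integrable[OF \<phi>i] by simp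
  have int: "integrable lborel (\<lambda>s. indicator {0..1} s * (u s * \<phi> s))"
    if [measurable]: "u \<in> borel_measurable borel" and "\<And>s. \<bar>u s\<bar> \<le> 1" for u
  proof (rule Bochner_Integration.integrable_bound[OF \<phi>i])
    have "(\<lambda>s. u s * (indicator {0..1} s * \<phi> s)) \<in> borel_measurable lborel" by measurable
    then show "(\<lambda>s. indicator {0..1} s * (u s * \<phi> s)) \<in> borel_measurable lborel"
      by (simp add: mult_ac)
    have "\<bar>u s\<bar> * \<bar>\<phi> s\<bar> \<le> 1 * \<bar>\<phi> s\<bar>" for s by (rule mult_right_mono) (use that in auto)
    then show "AE s in lborel. norm (indicator {0..1} s * (u s * \<phi> s)) \<le> norm (indicator {0..1} s * \<phi> s)"
      by (auto simp: abs_mult indicator_def)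
  qed
  have A: "(\<lambda>n. r k ^ Suc n * (1 / real (Suc n) * c n)) sums (LINT s:{0..1}|lborel. g k s * \<phi> s)" for k
  proof -
    define h where "h = (\<lambda>n s. indicator {0..1} s * ((r k ^ Suc n / real (Suc n) * sin (2 * pi * real (Suc n) * s)) * \<phi> s))"
    have rn: "\<bar>r k ^ Suc n / real (Suc n) * sin (2 * pi * real (Suc n) * s)\<bar> \<le> r k ^ Suc n" for n s
    proof -
      have "\<bar>r k ^ Suc n / real (Suc n) * sin (2 * pi * real (Suc n) * s)\<bar>
         = r k ^ Suc n * (1 / real (Suc n) * \<bar>sin (2 * pi * real (Suc n) * s)\<bar>)"
        using r(1)[of k] by (simp add: abs_mult del: power_Suc of_nat_Suc)
      also have "\<dots> \<le> r k ^ Suc n * (1 * 1)"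
        using r(1)[of k] by (intro mult_left_mono mult_mono) auto
      finally show ?thesis by simp
    qed
    have r1: "r k ^ Suc n \<le> 1" for n
      using r(1)[of k] r(2)[of k] by (intro power_le_one) auto
    have hi: "integrable lborel (h n)" for n
      unfolding h_def by (rule int) (use order_trans[OF rn r1] in auto)
    have hn: "norm (h n s) \<le> r k ^ Suc n * norm (indicator {0..1} s * \<phi> s)" for n s
      unfolding h_def norm_mult real_norm_def abs_mult[symmetric] mult.left_commute[of "\<bar>indicator {0..1} s\<bar>"]
      using mult_right_mono[OF rn, of "\<bar>indicator {0..1} s * \<phi> s\<bar>" n s]
      by (simp add: abs_mult mult_ac del: power_Suc of_nat_Suc)
    have rs: "summable (\<lambda>n. r k ^ Suc n)"
      using r[of k] by (subst summable_Suc_iff) auto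
    have "(\<lambda>n. integral\<^sup>L lborel (h n)) sums (\<integral>s. (\<Sum>n. h n s) \<partial>lborel)"
    proof (rule sums_integral[OF hi])
      show "AE s in lborel. summable (\<lambda>n. norm (h n s))"
        using summable_mult2[OF rs] hn
        by (intro AE_I2 summable_comparison_test'[OF summable_mult2[OF rs]]) auto
      show "summable (\<lambda>n. \<integral>s. norm (h n s) \<partial>lborel)"
      proof (rule summable_comparison_test'[OF summable_mult2[OF rs]])
        fix n
        have "(\<integral>s. norm (h n s) \<partial>lborel) \<le> (\<integral>s. r k ^ Suc n * norm (indicator {0..1} s * \<phi> s) \<partial>lborel)"
          by (intro integral_mono integrable_norm hi integrable_mult_right \<phi>i hn)
        moreover have "(\<integral>s. norm (h n s) \<partial>lborel) \<ge> 0" by (rule integral_nonneg_AE) auto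
        ultimately show "norm (\<integral>s. norm (h n s) \<partial>lborel) \<le> r k ^ Suc n * (\<integral>s. norm (indicator {0..1} s * \<phi> s) \<partial>lborel)"
          by simp
      qed
    qed
    moreover have "(\<integral>s. (\<Sum>n. h n s) \<partial>lborel) = (LINT s:{0..1}|lborel. g k s * \<phi> s)"
      unfolding set_lebesgue_integral_def
    proof (rule Bochner_Integration.integral_cong[OF refl])
      fix s
      have "(\<lambda>n. h n s) sums (indicator {0..1} s * (g k s * \<phi> s))"
        unfolding h_def g_def by (intro sums_mult sums_mult2 sin_power_sums r)
      then show "(\<Sum>n. h n s) = indicator {0..1} s *\<^sub>R (g k s * \<phi> s)"
        by (simp add: sums_iff)
    qed
    moreover have "integral\<^sup>L lborel (h n) = r k ^ Suc n * (1 / real (Suc n) * c n)" for n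
    proof -
      have "h n = (\<lambda>s. (r k ^ Suc n * (1 / real (Suc n))) * (indicator {0..1} s * (sin (2 * pi * real (Suc n) * s) * \<phi> s)))"
        by (auto simp: h_def fun_eq_iff mult_ac)
      then show ?thesis
        unfolding c_def set_lebesgue_integral_def by (simp del: power_Suc of_nat_Suc)
    qed
    ultimately show ?thesis by simp
  qed
  have "((\<lambda>k. \<Sum>n. r k ^ Suc n * (1 / real (Suc n) * c n)) \<longlongrightarrow> (\<Sum>n. 1 / real (Suc n) * c n)) sequentially"
  proof (rule tannerys_theorem[THEN conjunct2, THEN conjunct2])
    show "(\<lambda>k. r k ^ Suc n * (1 / real (Suc n) * c n)) \<longlonglongrightarrow> 1 / real (Suc n) * c n" for n
      using tendsto_mult_right[OF tendsto_power[OF r_lim, of "Suc n"], of "1 / real (Suc n) * c n"]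
      by (simp del: power_Suc)
    have "r k ^ Suc n * \<bar>1 / real (Suc n) * c n\<bar> \<le> 1 * \<bar>1 / real (Suc n) * c n\<bar>" for k n
      using r(1)[of k] r(2)[of k] by (intro mult_right_mono power_le_one) auto
    then show "\<forall>\<^sub>F (n, k) in sequentially \<times>\<^sub>F sequentially.
        norm (r k ^ Suc n * (1 / real (Suc n) * c n)) \<le> \<bar>1 / real (Suc n) * c n\<bar>"
      using r(1) by (intro always_eventually) (auto simp: abs_mult simp del: power_Suc)
  qed (use summ in auto)
  moreover have "(\<lambda>k. LINT s:{0..1}|lborel. g k s * \<phi> s) \<longlonglongrightarrow> (LINT s:{0..1}|lborel. (pi * (1/2 - s)) * \<phi> s)"
    unfolding set_lebesgue_integral_def real_scaleR_def
  proof (rule integral_dominated_convergence)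
    have re: "Re (1 - of_real (r k) * cis (2 * pi * s)) > 0" for k s
    proof -
      have "Re (of_real (r k) * cis (2 * pi * s)) \<le> norm (of_real (r k) * cis (2 * pi * s))"
        by (rule complex_Re_le_cmod)
      also have "\<dots> < 1" using r[of k] by (simp add: norm_mult)
      finally show ?thesis by simp
    qed
    have gb: "\<bar>g k s\<bar> \<le> pi / 2" for k s
    proof -
      have "1 - of_real (r k) * cis (2 * pi * s) \<noteq> 0"
        using re[of k s] by (metis less_irrefl zero_complex.sel(1))
      from Re_Ln_pos_lt[OF this] re[of k s] have "\<bar>Im (Ln (1 - of_real (r k) * cis (2 * pi * s)))\<bar> < pi / 2"
        by blast
      then show ?thesis by (simp add: g_def)
    qed
    show "integrable lborel (\<lambda>s. pi / 2 * norm (indicator {0..1} s * \<phi> s))"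
      by (intro integrable_mult_right integrable_norm \<phi>i)
    have gm [measurable]: "g k \<in> borel_measurable borel" for k
    proof (rule borel_measurable_continuous_onI)
      have "1 - of_real (r k) * cis (2 * pi * s) \<notin> \<real>\<^sub>\<le>\<^sub>0" for s
        using re[of k s] by (auto simp: complex_nonpos_Reals_iff)
      then show "continuous_on UNIV (g k)"
        unfolding g_def by (intro continuous_intros) auto
    qed
    have "(\<lambda>s. g k s * (indicator {0..1} s * \<phi> s)) \<in> borel_measurable lborel" for k by measurable
    then show "(\<lambda>s. indicator {0..1} s * (g k s * \<phi> s)) \<in> borel_measurable lborel" for k
      by (simp add: mult_ac)
    have "(\<lambda>s. (pi * (1/2 - s)) * (indicator {0..1} s * \<phi> s)) \<in> borel_measurable lborel" by measurable
    then show "(\<lambda>s. indicator {0..1} s * ((pi * (1/2 - s)) * \<phi> s)) \<in> borel_measurable lborel"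
      by (simp add: mult_ac)
    show "AE s in lborel. norm (indicator {0..1} s * (g k s * \<phi> s)) \<le> pi / 2 * norm (indicator {0..1} s * \<phi> s)" for k
      using mult_right_mono[OF gb, of "\<bar>\<phi> _\<bar>"] by (intro AE_I2) (auto simp: indicator_def abs_mult)
    \<comment> \<open>At s = 0 and s = 1 every \<open>g k s\<close> is 0 while the sawtooth formula
      gives pi/2 and -pi/2, so convergence holds only off these two points.\<close>
    show "AE s in lborel. (\<lambda>k. indicator {0..1} s * (g k s * \<phi> s)) \<longlonglongrightarrow> indicator {0..1} s * ((pi * (1/2 - s)) * \<phi> s)"
      using AE_lborel_singleton[of 0] AE_lborel_singleton[of 1]
    proof eventually_elim
      fix s :: real assume s: "s \<noteq> 0" "s \<noteq> 1"
      show "(\<lambda>k. indicator {0..1} s * (g k s * \<phi> s)) \<longlonglongrightarrow> indicator {0..1} s * ((pi * (1/2 - s)) * \<phi> s)"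
      proof (cases "s \<in> {0..1}")
        case True
        then have s': "0 < s" "s < 1" using s by auto
        have "sin (pi * s) > 0" using s' by (intro sin_gt_zero) auto
        then have "cos (2 * pi * s) < 1"
          using cos_double_sin[of "pi * s"] by (simp add: mult.assoc)
        then have "1 - of_real 1 * cis (2 * pi * s) \<notin> \<real>\<^sub>\<le>\<^sub>0"
          by (simp add: complex_nonpos_Reals_iff)
        then have "(\<lambda>k. g k s) \<longlonglongrightarrow> - Im (Ln (1 - of_real 1 * cis (2 * pi * s)))"
          unfolding g_def by (intro tendsto_intros r_lim)
        then have "(\<lambda>k. g k s) \<longlonglongrightarrow> pi * (1/2 - s)"
          using Im_Ln_one_minus_cis[OF s'] by simp
        then show ?thesis by (intro tendsto_intros)
      qed simp
    qed
  qed
  moreover have "(\<lambda>k. LINT s:{0..1}|lborel. g k s * \<phi> s) = (\<lambda>k. \<Sum>n. r k ^ Suc n * (1 / real (Suc n) * c n))"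
    using A by (simp add: sums_iff fun_eq_iff)
  ultimately have "(\<Sum>n. 1 / real (Suc n) * c n) = (LINT s:{0..1}|lborel. (pi * (1/2 - s)) * \<phi> s)"
    by (simp add: LIMSEQ_unique)
  then show ?thesis by (simp add: mult.assoc)
qed

section \<open>Shifting the parameter by an integer\<close>

text \<open>The identity that ties the factor 1/(1 - t^2) to integer shifts. K N is a multiple of 2
  pi, so at both ends sin (K s) vanishes and cos (K s) is 1; the antiderivative comes from
  integrating by parts twice.\<close>

lemma sin_sin_has_integral:
  fixes K t \<nu> :: real
  assumes K: "K = 2 * pi * real n" "n > 0" and t: "t \<ge> 0" "t \<noteq> 1"
  shows "((\<lambda>s. sin (K * s) * sin (K * (\<nu> + s) * t)) has_integral
      (sin (K * \<nu> * t) - sin (K * (\<nu> + real N) * t)) / (K * (1 - t\<^sup>2))) {0..real N}"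
proof -
  let ?D = "K * (1 - t\<^sup>2)"
  have D: "?D \<noteq> 0" using K t by (auto simp: power2_eq_1_iff)
  let ?Q = "\<lambda>s. (t * sin (K * s) * cos (K * (\<nu> + s) * t) - cos (K * s) * sin (K * (\<nu> + s) * t)) / ?D"
  have "((\<lambda>s. sin (K * s) * sin (K * (\<nu> + s) * t)) has_integral (?Q (real N) - ?Q 0)) {0..real N}"
  proof (rule fundamental_theorem_of_calculus)
    fix s
    have "((\<lambda>s. t * sin (K * s) * cos (K * (\<nu> + s) * t) - cos (K * s) * sin (K * (\<nu> + s) * t)) has_real_derivative
        ?D * (sin (K * s) * sin (K * (\<nu> + s) * t))) (at s within {0..real N})"
      by (auto intro!: derivative_eq_intros simp: algebra_simps power2_eq_square)
    from DERIV_cdivide[OF this, of ?D] show "(?Q has_vector_derivative sin (K * s) * sin (K * (\<nu> + s) * t)) (at s within {0..real N})"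
      using D by (simp add: has_real_derivative_iff_has_vector_derivative)
  qed simp
  moreover have "sin (K * real N) = 0" "cos (K * real N) = 1"
  proof -
    have e: "K * real N = 2 * pi * real (n * N)" by (simp add: K)
    show "sin (K * real N) = 0" "cos (K * real N) = 1"
      unfolding e using sin_2npi[of "n * N"] cos_2npi[of "n * N"] by (simp_all add: mult_ac)
  qed
  ultimately show ?thesis by (simp add: diff_divide_distrib)
qed

text \<open>By \<open>sin_sin_has_integral\<close> the difference of the two integrands is K times
  an integral over s. The integrand in (s, t) decays exponentially in t, so Fubini applies, and the
  inner t-integral is the sine transform that yields \<open>B\<close>.\<close>

lemma pv_bose_shift:
  fixes \<alpha> \<nu> :: real
  assumes \<alpha>: "\<alpha> > 0" and n: "n > 0"
  shows "pv_bose (2 * pi * real n / \<alpha>) (2 * pi * real n * \<nu>) - pv_bose (2 * pi * real n / \<alpha>) (2 * pi * real n * (\<nu> + real N))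
    = pi * \<alpha> * (LINT s:{0..real N}|lborel. sin (2 * pi * real n * s) * B (\<alpha> * (\<nu> + s)))"
proof -
  define K where "K = 2 * pi * real n"
  define c where "c = K / \<alpha>"
  define g where "g = (\<lambda>s t. indicator {0..real N} s * (indicator {0<..} t * (sin (K * s) * (bose c t * sin (K * (\<nu> + s) * t)))))"
  have K: "K > 0" using n by (simp add: K_def)
  have c: "c > 0" using \<alpha> K by (simp add: c_def)
  define C where "C = K * (\<bar>\<nu>\<bar> + real N) / c"
  have gm [measurable]: "case_prod g \<in> borel_measurable (lborel \<Otimes>\<^sub>M lborel)"
    unfolding g_def case_prod_beta by measurable
  have gle: "norm (g s t) \<le> indicator {0..real N} s * (C * (indicator {0<..} t * exp (- (c / 2 * t))))" for s t
  proof (cases "s \<in> {0..real N} \<and> t > 0")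
    case True
    have "\<bar>bose c t * sin (K * (\<nu> + s) * t)\<bar> \<le> \<bar>K * (\<nu> + s)\<bar> / c * exp (- (c / 2 * t))"
      using abs_bose_sin_le[OF c, of t "K * (\<nu> + s)"] True by simp
    also have "\<dots> \<le> C * exp (- (c / 2 * t))"
      unfolding C_def using True K c by (intro mult_right_mono divide_right_mono) (auto simp: abs_mult)
    finally have "\<bar>sin (K * s)\<bar> * \<bar>bose c t * sin (K * (\<nu> + s) * t)\<bar> \<le> 1 * (C * exp (- (c / 2 * t)))"
      by (intro mult_mono) auto
    then show ?thesis using True by (simp add: g_def abs_mult)
  qed (auto simp: g_def indicator_def)
  have ei: "integrable lborel (\<lambda>t. indicator {0<..} t * exp (- (c / 2 * t)))"
    using set_integrable_exp_neg(1)[of "c / 2"] c by (simp add: set_integrable_def)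
  have int: "integrable (lborel \<Otimes>\<^sub>M lborel) (case_prod g)"
  proof (rule lborel_pair.Fubini_integrable[OF gm])
    have gi: "integrable lborel (\<lambda>t. g s t)" for s
    proof (rule Bochner_Integration.integrable_bound)
      show "integrable lborel (\<lambda>t. indicator {0..real N} s * (C * (indicator {0<..} t * exp (- (c / 2 * t)))))"
        by (intro integrable_mult_right ei)
      show "g s \<in> borel_measurable lborel" unfolding g_def by measurable
      show "AE t in lborel. norm (g s t) \<le> norm (indicator {0..real N} s * (C * (indicator {0<..} t * exp (- (c / 2 * t)))))"
        using order_trans[OF gle abs_ge_self] by (intro AE_I2) simp
    qed
    then show "AE s in lborel. integrable lborel (\<lambda>t. case_prod g (s, t))" by simp
    define E where "E = C * (\<integral>t. indicator {0<..} t * exp (- (c / 2 * t)) \<partial>lborel)"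
    have "integrable lborel (\<lambda>s. indicator {0..real N} s * E)" by simp
    then show "integrable lborel (\<lambda>s. \<integral>t. norm (case_prod g (s, t)) \<partial>lborel)"
    proof (rule Bochner_Integration.integrable_bound)
      show "(\<lambda>s. \<integral>t. norm (case_prod g (s, t)) \<partial>lborel) \<in> borel_measurable lborel"
        by measurable
      show "AE s in lborel. norm (\<integral>t. norm (case_prod g (s, t)) \<partial>lborel) \<le> norm (indicator {0..real N} s * E)"
      proof (rule AE_I2)
        fix s
        have "(\<integral>t. norm (g s t) \<partial>lborel) \<le> (\<integral>t. indicator {0..real N} s * (C * (indicator {0<..} t * exp (- (c / 2 * t)))) \<partial>lborel)"
          by (intro integral_mono integrable_norm gi gle integrable_mult_right ei)
        also have "\<dots> = indicator {0..real N} s * E" by (simp add: E_def)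
        finally show "norm (\<integral>t. norm (case_prod g (s, t)) \<partial>lborel) \<le> norm (indicator {0..real N} s * E)"
          using integral_nonneg_AE[where M = lborel and f = "\<lambda>t. norm (g s t)"] by simp
      qed
    qed
  qed
  have swap: "(\<integral>t. (\<integral>s. g s t \<partial>lborel) \<partial>lborel) = (\<integral>s. (\<integral>t. g s t \<partial>lborel) \<partial>lborel)"
    by (rule lborel_pair.Fubini_integral[OF int])
  have "(\<integral>s. (\<integral>t. g s t \<partial>lborel) \<partial>lborel) = (\<integral>s. indicator {0..real N} s * (sin (K * s) * (pi / c * B (\<alpha> * (\<nu> + s)))) \<partial>lborel)"
  proof (rule integral_cong_AE)
    show "AE s in lborel. (\<integral>t. g s t \<partial>lborel) = indicator {0..real N} s * (sin (K * s) * (pi / c * B (\<alpha> * (\<nu> + s))))"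
      \<comment> \<open>At s = -\<nu> the frequency is 0, where the transform formula fails because
        of the default value of \<open>B\<close>.\<close>
      using AE_lborel_singleton[of "- \<nu>"]
    proof eventually_elim
      fix s assume s: "s \<noteq> - \<nu>"
      then have "K * (\<nu> + s) \<noteq> 0" using K by auto
      from LINT_bose_sin[OF c this] have "(\<integral>t. indicator {0<..} t * (bose c t * sin (K * (\<nu> + s) * t)) \<partial>lborel) = pi / c * B (\<alpha> * (\<nu> + s))"
        using K \<alpha> by (simp add: set_lebesgue_integral_def c_def mult.commute)
      moreover have "(\<lambda>t. g s t) = (\<lambda>t. indicator {0..real N} s * sin (K * s) * (indicator {0<..} t * (bose c t * sin (K * (\<nu> + s) * t))))"
        by (simp add: g_def mult_ac fun_eq_iff)
      ultimately show "(\<integral>t. g s t \<partial>lborel) = indicator {0..real N} s * (sin (K * s) * (pi / c * B (\<alpha> * (\<nu> + s))))"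
        by simp
    qed
  qed measurable
  also have "\<dots> = pi / c * (LINT s:{0..real N}|lborel. sin (K * s) * B (\<alpha> * (\<nu> + s)))"
    unfolding set_lebesgue_integral_def
    by (subst integral_mult_right_zero[symmetric]) (auto intro!: Bochner_Integration.integral_cong simp: mult_ac)
  finally have R: "(\<integral>s. (\<integral>t. g s t \<partial>lborel) \<partial>lborel) = pi / c * (LINT s:{0..real N}|lborel. sin (K * s) * B (\<alpha> * (\<nu> + s)))" .
  let ?a = "K * \<nu>" and ?b = "K * (\<nu> + real N)"
  \<comment> \<open>Equal values at t = 1 mean that the two subtracted kernels in
    \<open>pv_reg\<close> cancel.\<close>
  have sb: "sin ?b = sin ?a"
  proof -
    have "?b = ?a + 2 * pi * real (n * N)" by (simp add: K_def algebra_simps)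
    then show ?thesis using sin_2npi[of "n * N"] cos_2npi[of "n * N"] by (simp add: sin_add mult_ac)
  qed
  have "pv_bose c ?a - pv_bose c ?b
      = (LINT t:{0<..}|lborel. pv_reg (\<lambda>t. bose c t * sin (?a * t)) t - pv_reg (\<lambda>t. bose c t * sin (?b * t)) t)"
    unfolding pv_bose_def
    by (subst set_integral_diff(2)) (use pv_reg_bose_sin_integrable(1)[OF c] in auto)
  also have "\<dots> = (\<integral>t. K * (\<integral>s. g s t \<partial>lborel) \<partial>lborel)"
    unfolding set_lebesgue_integral_def
  proof (rule integral_cong_AE)
    show "(\<lambda>t. indicat_real {0<..} t *\<^sub>R (pv_reg (\<lambda>t. bose c t * sin (?a * t)) t - pv_reg (\<lambda>t. bose c t * sin (?b * t)) t)) \<in> borel_measurable lborel"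
      unfolding pv_reg_def by measurable
    show "(\<lambda>t. K * (\<integral>s. g s t \<partial>lborel)) \<in> borel_measurable lborel"
      by measurable
    show "AE t in lborel. indicat_real {0<..} t *\<^sub>R (pv_reg (\<lambda>t. bose c t * sin (?a * t)) t - pv_reg (\<lambda>t. bose c t * sin (?b * t)) t)
        = K * (\<integral>s. g s t \<partial>lborel)"
      using AE_lborel_singleton[of 1]
    proof eventually_elim
      fix t :: real assume t1: "t \<noteq> 1"
      show "indicat_real {0<..} t *\<^sub>R (pv_reg (\<lambda>t. bose c t * sin (?a * t)) t - pv_reg (\<lambda>t. bose c t * sin (?b * t)) t)
        = K * (\<integral>s. g s t \<partial>lborel)"
      proof (cases "t > 0")
        case True
        have "set_integrable lborel {0..real N} (\<lambda>s. sin (K * s) * sin (K * (\<nu> + s) * t))"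
          by (rule borel_integrable_atLeastAtMost') (auto intro!: continuous_intros)
        then have "(LINT s:{0..real N}|lborel. sin (K * s) * sin (K * (\<nu> + s) * t))
            = (sin (?a * t) - sin (?b * t)) / (K * (1 - t\<^sup>2))"
          using integral_unique[OF sin_sin_has_integral[OF K_def n _ t1]] True
          by (simp add: set_borel_integral_eq_integral(2))
        moreover have "(\<lambda>s. g s t) = (\<lambda>s. bose c t * (indicator {0..real N} s *\<^sub>R (sin (K * s) * sin (K * (\<nu> + s) * t))))"
          using True by (simp add: g_def fun_eq_iff mult_ac)
        ultimately have "(\<integral>s. g s t \<partial>lborel) = bose c t * ((sin (?a * t) - sin (?b * t)) / (K * (1 - t\<^sup>2)))"
          unfolding set_lebesgue_integral_def by (simp only: integral_mult_right_zero)
        then have "K * (\<integral>s. g s t \<partial>lborel) = bose c t * (sin (?a * t) - sin (?b * t)) / (1 - t\<^sup>2)"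
          using K by simp
        then show ?thesis
          using True sb by (simp add: pv_reg_def diff_divide_distrib right_diff_distrib)
      qed (simp add: g_def)
    qed
  qed
  also have "\<dots> = K * (pi / c * (LINT s:{0..real N}|lborel. sin (K * s) * B (\<alpha> * (\<nu> + s))))"
    using swap R by simp
  also have "\<dots> = pi * \<alpha> * (LINT s:{0..real N}|lborel. sin (K * s) * B (\<alpha> * (\<nu> + s)))"
    using K \<alpha> by (simp add: c_def)
  finally show ?thesis unfolding c_def K_def .
qed

section \<open>Asymptotics of the principal values\<close>

text \<open>Approximate f uniformly by a polynomial. For the polynomial one integration by parts
  gives O(1/x), and the approximation error is bounded independently of x.\<close>

lemma riemann_lebesgue_Icc:
  fixes f :: "real \<Rightarrow> real"
  assumes f: "continuous_on {a..b} f"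
  shows "((\<lambda>x. LINT t:{a..b}|lborel. f t * sin (x * t)) \<longlongrightarrow> 0) at_top"
proof (cases "a \<le> b")
  case ab: True
  have ii: "set_integrable lborel {a..b} (\<lambda>t. g t * sin (x * t))"
    if "continuous_on {a..b} g" for g :: "real \<Rightarrow> real" and x
    by (rule borel_integrable_atLeastAtMost') (intro continuous_intros that)
  have bound: "\<bar>LINT t:{a..b}|lborel. g t\<bar> \<le> M * (b - a)"
    if "continuous_on {a..b} g" "\<And>t. t \<in> {a..b} \<Longrightarrow> \<bar>g t\<bar> \<le> M" for g :: "real \<Rightarrow> real" and M
    using integral_bound[OF ab that(1), of M] that(2)
      set_borel_integral_eq_integral(2)[OF borel_integrable_atLeastAtMost'[OF that(1)]] by simp
  show ?thesis
  proof (rule tendstoI)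
    fix e :: real assume e: "e > 0"
    \<comment> \<open>The added 1 keeps the denominator positive when a = b.\<close>
    define d where "d = e / 2 / (b - a + 1)"
    have d: "d > 0" using e ab by (simp add: d_def)
    obtain p where p: "real_polynomial_function p" "\<And>t. t \<in> {a..b} \<Longrightarrow> \<bar>f t - p t\<bar> < d"
      using Stone_Weierstrass_real_polynomial_function[OF compact_Icc f d] by blast
    obtain p' where p': "real_polynomial_function p'" "\<And>x. (p has_real_derivative p' x) (at x)"
      using has_real_derivative_polynomial_function[OF p(1)] by blast
    have pc: "continuous_on {a..b} p" "continuous_on {a..b} p'"
      using p(1) p'(1) by (auto intro!: continuous_on_polymonial_function simp: real_polynomial_function_eq)
    have "bounded (p' ` {a..b})"
      by (intro compact_imp_bounded compact_continuous_image pc compact_Icc)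
    then obtain M where "\<forall>t\<in>{a..b}. \<bar>p' t\<bar> \<le> M"
      by (auto simp: bounded_iff)
    then have M: "\<bar>p' t\<bar> \<le> M" if "t \<in> {a..b}" for t using that by blast
    define C where "C = \<bar>p a\<bar> + \<bar>p b\<bar> + M * (b - a)"
    have parts: "\<bar>LINT t:{a..b}|lborel. p t * sin (x * t)\<bar> \<le> C / x" if x: "x > 0" for x
    proof -
      have hi: "((\<lambda>t. p t * sin (x * t) - p' t * cos (x * t) / x) has_integral
          ((- (p b * cos (x * b) / x)) - (- (p a * cos (x * a) / x)))) {a..b}"
      proof (rule fundamental_theorem_of_calculus[OF ab])
        fix t
        have "((\<lambda>t. p t * cos (x * t)) has_real_derivative (p' t * cos (x * t) + (- sin (x * t) * x) * p t)) (at t within {a..b})"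
          by (rule DERIV_mult) (auto intro!: derivative_eq_intros has_field_derivative_at_within[OF p'(2)])
        then have "((\<lambda>t. - (p t * cos (x * t) / x)) has_real_derivative
            - ((p' t * cos (x * t) + (- sin (x * t) * x) * p t) / x)) (at t within {a..b})"
          by (intro DERIV_minus DERIV_cdivide)
        also have "- ((p' t * cos (x * t) + (- sin (x * t) * x) * p t) / x) = p t * sin (x * t) - p' t * cos (x * t) / x"
          using x by (simp add: field_simps)
        finally show "((\<lambda>t. - (p t * cos (x * t) / x)) has_vector_derivative p t * sin (x * t) - p' t * cos (x * t) / x) (at t within {a..b})"
          by (simp add: has_real_derivative_iff_has_vector_derivative)
      qed
      have c1: "continuous_on {a..b} (\<lambda>t. p t * sin (x * t))" "continuous_on {a..b} (\<lambda>t. p' t * cos (x * t) / x)"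
        using x by (auto intro!: continuous_intros pc)
      have "(LINT t:{a..b}|lborel. p t * sin (x * t)) - (LINT t:{a..b}|lborel. p' t * cos (x * t) / x)
          = (LINT t:{a..b}|lborel. p t * sin (x * t) - p' t * cos (x * t) / x)"
        by (rule set_integral_diff(2)[symmetric]) (intro borel_integrable_atLeastAtMost' c1)+
      also have "\<dots> = integral {a..b} (\<lambda>t. p t * sin (x * t) - p' t * cos (x * t) / x)"
        by (intro set_borel_integral_eq_integral(2) borel_integrable_atLeastAtMost' continuous_on_diff c1)
      also have "\<dots> = (- (p b * cos (x * b) / x)) - (- (p a * cos (x * a) / x))"
        by (rule integral_unique[OF hi])
      finally have "(LINT t:{a..b}|lborel. p t * sin (x * t)) - (LINT t:{a..b}|lborel. p' t * cos (x * t) / x)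
          = (- (p b * cos (x * b) / x)) - (- (p a * cos (x * a) / x))" .
      moreover have "\<bar>LINT t:{a..b}|lborel. p' t * cos (x * t) / x\<bar> \<le> M / x * (b - a)"
      proof (rule bound[OF c1(2)])
        fix t assume "t \<in> {a..b}"
        then have "\<bar>p' t\<bar> * \<bar>cos (x * t)\<bar> \<le> M * 1" using M by (intro mult_mono) (auto intro: order_trans[OF abs_ge_zero])
        then show "\<bar>p' t * cos (x * t) / x\<bar> \<le> M / x" using x by (simp add: abs_mult divide_right_mono)
      qed
      moreover have "\<bar>p s * cos (x * s) / x\<bar> \<le> \<bar>p s\<bar> / x" for s
        using x mult_left_mono[of "\<bar>cos (x * s)\<bar>" 1 "\<bar>p s\<bar>"] by (simp add: abs_mult divide_right_mono)
      note this[of a] this[of b]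
      moreover have "C / x = \<bar>p a\<bar> / x + \<bar>p b\<bar> / x + M / x * (b - a)"
        by (simp add: C_def add_divide_distrib)
      ultimately show ?thesis by linarith
    qed
    have "((\<lambda>x. C / x) \<longlongrightarrow> 0) at_top" by real_asymp
    then have "\<forall>\<^sub>F x in at_top. C / x < e / 2" using e by (intro order_tendstoD(2)) auto
    with eventually_gt_at_top[of 0] show "\<forall>\<^sub>F x in at_top. dist (LINT t:{a..b}|lborel. f t * sin (x * t)) 0 < e"
    proof eventually_elim
      fix x :: real assume x: "0 < x" "C / x < e / 2"
      have "(LINT t:{a..b}|lborel. f t * sin (x * t)) - (LINT t:{a..b}|lborel. p t * sin (x * t))
          = (LINT t:{a..b}|lborel. (f t - p t) * sin (x * t))"
        by (subst set_integral_diff(2)[symmetric]) (auto intro!: ii f pc simp: left_diff_distrib)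
      moreover have "\<bar>LINT t:{a..b}|lborel. (f t - p t) * sin (x * t)\<bar> \<le> d * (b - a)"
      proof (rule bound)
        show "continuous_on {a..b} (\<lambda>t. (f t - p t) * sin (x * t))" by (intro continuous_intros f pc)
        fix t assume "t \<in> {a..b}"
        then have "\<bar>f t - p t\<bar> * \<bar>sin (x * t)\<bar> \<le> d * 1" using p(2)[of t] d by (intro mult_mono) auto
        then show "\<bar>(f t - p t) * sin (x * t)\<bar> \<le> d" by (simp add: abs_mult)
      qed
      moreover have "d * (b - a) \<le> e / 2"
      proof -
        have "d * (b - a) \<le> d * (b - a + 1)" using d by (intro mult_left_mono) auto
        also have "\<dots> = e / 2"
        proof -
          have q: "e / 2 / X * X = e / 2" if "X \<noteq> 0" for X :: real using that by simp
          show ?thesis unfolding d_def by (rule q) (use ab in linarith)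
        qed
        finally show ?thesis .
      qed
      ultimately show "dist (LINT t:{a..b}|lborel. f t * sin (x * t)) 0 < e"
        using parts[OF x(1)] x(2) unfolding dist_real_def by linarith
    qed
  qed
qed (simp add: set_lebesgue_integral_def)

text \<open>The tail beyond b is bounded by the integral of |f|, uniformly in x; the compact case
  handles the rest.\<close>

lemma riemann_lebesgue_Ici:
  fixes f :: "real \<Rightarrow> real"
  assumes f: "continuous_on {a..} f" and i: "set_integrable lborel {a..} f"
  shows "((\<lambda>x. LINT t:{a..}|lborel. f t * sin (x * t)) \<longlongrightarrow> 0) at_top"
proof (rule tendstoI)
  fix e :: real assume e: "e > 0"
  have ia: "set_integrable lborel {a..} (\<lambda>t. \<bar>f t\<bar>)" by (rule set_integrable_abs[OF i])
  have "((\<lambda>b. LINT t:{a..b}|lborel. \<bar>f t\<bar>) \<longlongrightarrow> (LINT t:{a..}|lborel. \<bar>f t\<bar>)) at_top"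
    by (rule tendsto_set_lebesgue_integral_at_top[OF _ ia]) auto
  then have "\<forall>\<^sub>F b in at_top. (LINT t:{a..}|lborel. \<bar>f t\<bar>) - e / 2 < (LINT t:{a..b}|lborel. \<bar>f t\<bar>)"
    using e by (intro order_tendstoD(1)) auto
  with eventually_ge_at_top[of a] have "\<forall>\<^sub>F b in at_top. b \<ge> a \<and> (LINT t:{a..}|lborel. \<bar>f t\<bar>) - e / 2 < (LINT t:{a..b}|lborel. \<bar>f t\<bar>)"
    by eventually_elim auto
  then obtain b where b: "b \<ge> a" "(LINT t:{a..}|lborel. \<bar>f t\<bar>) - e / 2 < (LINT t:{a..b}|lborel. \<bar>f t\<bar>)"
    unfolding eventually_at_top_linorder by blast
  have split: "{a..} = {a..b} \<union> {b<..}" using b by auto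
  have "(LINT t:{a..}|lborel. \<bar>f t\<bar>) = (LINT t:{a..b}|lborel. \<bar>f t\<bar>) + (LINT t:{b<..}|lborel. \<bar>f t\<bar>)"
    unfolding split by (rule set_integral_Un) (use b in \<open>auto intro!: set_integrable_subset[OF ia]\<close>)
  with b have tail: "(LINT t:{b<..}|lborel. \<bar>f t\<bar>) < e / 2" by simp
  have ix: "set_integrable lborel {a..} (\<lambda>t. f t * sin (x * t))" for x
  proof (rule set_integrable_bound[OF i])
    have "(\<lambda>t. (indicator {a..} t *\<^sub>R f t) * sin (x * t)) \<in> borel_measurable lborel"
      using i unfolding set_integrable_def by measurable
    then show "set_borel_measurable lborel {a..} (\<lambda>t. f t * sin (x * t))"
      by (simp add: set_borel_measurable_def mult.assoc)
    show "AE t in lborel. t \<in> {a..} \<longrightarrow> norm (f t * sin (x * t)) \<le> norm (f t)"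
      by (simp add: abs_mult mult_right_le_one_le)
  qed
  have "((\<lambda>x. LINT t:{a..b}|lborel. f t * sin (x * t)) \<longlongrightarrow> 0) at_top"
    by (intro riemann_lebesgue_Icc continuous_on_subset[OF f]) auto
  then have "\<forall>\<^sub>F x in at_top. \<bar>LINT t:{a..b}|lborel. f t * sin (x * t)\<bar> < e / 2"
    using e by (auto dest!: tendstoD[where e = "e / 2"] simp: dist_real_def)
  then show "\<forall>\<^sub>F x in at_top. dist (LINT t:{a..}|lborel. f t * sin (x * t)) 0 < e"
  proof eventually_elim
    fix x assume x: "\<bar>LINT t:{a..b}|lborel. f t * sin (x * t)\<bar> < e / 2"
    have "(LINT t:{a..}|lborel. f t * sin (x * t)) = (LINT t:{a..b}|lborel. f t * sin (x * t)) + (LINT t:{b<..}|lborel. f t * sin (x * t))"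
      unfolding split by (rule set_integral_Un) (use b in \<open>auto intro!: set_integrable_subset[OF ix]\<close>)
    moreover have "\<bar>LINT t:{b<..}|lborel. f t * sin (x * t)\<bar> \<le> (LINT t:{b<..}|lborel. \<bar>f t\<bar>)"
    proof -
      have s1: "set_integrable lborel {b<..} (\<lambda>t. f t * sin (x * t))" "set_integrable lborel {b<..} (\<lambda>t. \<bar>f t\<bar>)"
        using b by (auto intro!: set_integrable_subset[OF ix] set_integrable_subset[OF ia])
      have "\<bar>LINT t:{b<..}|lborel. f t * sin (x * t)\<bar> \<le> (LINT t:{b<..}|lborel. \<bar>f t * sin (x * t)\<bar>)"
        unfolding set_lebesgue_integral_def
        using integral_abs_bound[of lborel "\<lambda>t. indicat_real {b<..} t *\<^sub>R (f t * sin (x * t))"]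
        by (simp add: abs_mult)
      also have "\<dots> \<le> (LINT t:{b<..}|lborel. \<bar>f t\<bar>)"
        by (rule set_integral_mono[OF set_integrable_abs[OF s1(1)] s1(2)]) (simp add: abs_mult mult_right_le_one_le)
      finally show ?thesis .
    qed
    ultimately show "dist (LINT t:{a..}|lborel. f t * sin (x * t)) 0 < e"
      using x tail by (simp add: dist_real_def)
  qed
qed

section \<open>Contributions of the poles at 0 and 1\<close>

lemma LINT_sin_over_id:
  assumes "a > 0"
  shows "set_integrable lborel {0<..<1/2} (\<lambda>t. sin (a * t) / t)"
    and "(LINT t:{0<..<1/2}|lborel. sin (a * t) / t) = Si (a / 2)"
proof -
  have E: "einterval 0 (ereal (1/2)) = {0<..<1/2}" by (auto simp: einterval_def)
  show "set_integrable lborel {0<..<1/2} (\<lambda>t. sin (a * t) / t)"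
    using integrable_sinc'[of "1/2" a] by (simp add: interval_lebesgue_integrable_def zero_ereal_def[symmetric] E mult.commute)
  show "(LINT t:{0<..<1/2}|lborel. sin (a * t) / t) = Si (a / 2)"
    using LBINT_I0c_sin_scale_divide[of "1/2" a] assms
    by (simp add: interval_lebesgue_integral_def E mult.commute)
qed

text \<open>Folding the interval about 1 makes the constant sin a disappear: the values of the
  integrand at 1 + v and 1 - v add up to -2 cos a sin (a v) / v, whose integral is a sine
  integral.\<close>

lemma LINT_pv_sin:
  assumes a: "a > 0"
  shows "set_integrable lborel {1/2..3/2} (\<lambda>t. (sin (a * t) - sin a) / (1 - t))"
    and "(LINT t:{1/2..3/2}|lborel. (sin (a * t) - sin a) / (1 - t)) = - (2 * cos a * Si (a / 2))"
proof -
  define g where "g = (\<lambda>t. (sin (a * t) - sin a) / (1 - t))"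
  have gb: "\<bar>g t\<bar> \<le> a" for t
  proof -
    have "\<bar>sin (a * t) - sin (a * 1)\<bar> \<le> a * \<bar>t - 1\<bar>"
    proof -
      have "norm ((\<lambda>t. sin (a * t)) t - (\<lambda>t. sin (a * t)) 1) \<le> a * norm (t - 1)"
      proof (rule field_differentiable_bound[where S = UNIV and f' = "\<lambda>t. cos (a * t) * a"])
        show "norm (cos (a * s) * a) \<le> a" for s
          using a mult_right_mono[of "\<bar>cos (a * s)\<bar>" 1 a] by (simp add: abs_mult)
      qed (auto intro!: derivative_eq_intros)
      then show ?thesis by simp
    qed
    then show ?thesis
      using a unfolding g_def by (cases "t = 1") (auto simp: abs_minus_commute divide_le_eq)
  qed
  have gm [measurable]: "g \<in> borel_measurable borel" unfolding g_def by measurable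
  have gi: "set_integrable lborel {1/2..3/2} g"
    by (rule set_integrable_bound[where f = "\<lambda>_. a"])
       (use gb in \<open>auto simp: set_borel_measurable_def set_integrable_def intro!: AE_I2 order_trans[OF gb]\<close>)
  then show "set_integrable lborel {1/2..3/2} (\<lambda>t. (sin (a * t) - sin a) / (1 - t))" unfolding g_def .
  define h where "h = (\<lambda>t. indicator {1/2..3/2} t * g t)"
  have hi: "integrable lborel h" using gi by (simp add: h_def set_integrable_def)
  define I where "I = integral\<^sup>L lborel h"
  define s where "s = (\<lambda>v. indicator {0<..<1/2} v * (sin (a * v) / v))"
  have si: "integrable lborel s" "integral\<^sup>L lborel s = Si (a / 2)"
    using LINT_sin_over_id[OF a] by (simp_all add: s_def set_integrable_def set_lebesgue_integral_def)
  have "I = integral\<^sup>L lborel (\<lambda>v. h (1 + 1 * v))" "I = integral\<^sup>L lborel (\<lambda>v. h (1 + (-1) * v))"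
    unfolding I_def using lborel_integral_real_affine[of 1 h 1] lborel_integral_real_affine[of "-1" h 1] by simp_all
  moreover have "integrable lborel (\<lambda>v. h (1 + 1 * v))" "integrable lborel (\<lambda>v. h (1 + (-1) * v))"
    using lborel_integrable_real_affine[OF hi, of 1 1] lborel_integrable_real_affine[OF hi, of "-1" 1] by simp_all
  ultimately have "2 * I = integral\<^sup>L lborel (\<lambda>v. h (1 + 1 * v) + h (1 + (-1) * v))"
    by (subst Bochner_Integration.integral_add) auto
  also have "\<dots> = integral\<^sup>L lborel (\<lambda>v. - 2 * cos a * (s v + s (0 + (-1) * v)))"
  proof (rule integral_cong_AE)
    show "AE v in lborel. h (1 + 1 * v) + h (1 + (-1) * v) = - 2 * cos a * (s v + s (0 + (-1) * v))"
      using AE_lborel_singleton[of 0] AE_lborel_singleton[of "1/2"] AE_lborel_singleton[of "-1/2"]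
    proof eventually_elim
      fix v :: real assume v: "v \<noteq> 0" "v \<noteq> 1/2" "v \<noteq> -1/2"
      have e: "g (1 + v) + g (1 - v) = - 2 * cos a * (sin (a * v) / v)"
        using v by (simp add: g_def distrib_left right_diff_distrib sin_add sin_diff add_divide_distrib[symmetric] divide_simps)
      have i1: "indicator {1/2..3/2} (1 + v) = (indicator {1/2..3/2} (1 - v) :: real)"
        by (auto simp: indicator_def)
      have "h (1 + 1 * v) + h (1 + (-1) * v) = indicator {1/2..3/2} (1 - v) * (g (1 + v) + g (1 - v))"
        by (simp add: h_def i1 distrib_left)
      also have "\<dots> = - 2 * cos a * (s v + s (0 + (-1) * v))"
        unfolding e s_def using v by (auto simp: indicator_def)
      finally show "h (1 + 1 * v) + h (1 + (-1) * v) = - 2 * cos a * (s v + s (0 + (-1) * v))" .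
    qed
  qed (simp_all add: h_def s_def)
  also have "\<dots> = - 2 * cos a * (integral\<^sup>L lborel s + integral\<^sup>L lborel (\<lambda>v. s (0 + (-1) * v)))"
    using si(1) lborel_integrable_real_affine[OF si(1), of "-1" 0]
    by (subst integral_mult_right_zero, subst Bochner_Integration.integral_add) auto
  also have "integral\<^sup>L lborel (\<lambda>v. s (0 + (-1) * v)) = integral\<^sup>L lborel s"
    using lborel_integral_real_affine[of "-1" s 0] by simp
  finally have "I = - (2 * cos a * Si (a / 2))" using si(2) by simp
  then show "(LINT t:{1/2..3/2}|lborel. (sin (a * t) - sin a) / (1 - t)) = - (2 * cos a * Si (a / 2))"
    by (simp add: I_def h_def g_def set_lebesgue_integral_def)
qed

text \<open>For t > 0 the function is bose c t / (1 - t^2) - 1/(c t), that is, the kernel with its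
  pole at 0 removed. It is rewritten so that the pole is subtracted from \<open>bose c t\<close>
  directly; the limit of 1/(e^x - 1) - 1/x at 0 is -1/2.\<close>

lemma continuous_on_quotient_bose:
  assumes c: "c > 0"
  shows "continuous_on {0..1/2} (\<lambda>t. if t = 0 then - 1/2 else (bose c t - 1 / (c * t)) / (1 - t\<^sup>2) + t / (c * (1 - t\<^sup>2)))"
    (is "continuous_on _ ?k")
  unfolding continuous_on_eq_continuous_within
proof
  fix t :: real assume t: "t \<in> {0..1/2}"
  show "continuous (at t within {0..1/2}) ?k"
  proof (cases "t = 0")
    case True
    have l: "((\<lambda>x::real. 1 / (exp x - 1) - 1 / x) \<longlongrightarrow> - 1/2) (at_right 0)"
      by real_asymp
    have "filterlim (\<lambda>t. c * t) (at_right 0) (at_right 0)"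
      using c by real_asymp
    from filterlim_compose[OF l this]
    have "((\<lambda>t. (1 / (exp (c * t) - 1) - 1 / (c * t)) / (1 - t\<^sup>2) + t / (c * (1 - t\<^sup>2))) \<longlongrightarrow>
        (- 1/2) / (1 - 0\<^sup>2) + 0 / (c * (1 - 0\<^sup>2))) (at_right 0)"
      using c by (intro tendsto_intros) auto
    then have "((\<lambda>t. (1 / (exp (c * t) - 1) - 1 / (c * t)) / (1 - t\<^sup>2) + t / (c * (1 - t\<^sup>2))) \<longlongrightarrow> - 1/2) (at_right 0)"
      by simp
    then have "(?k \<longlongrightarrow> - 1/2) (at_right 0)"
      by (rule Lim_transform_eventually) (auto simp: eventually_at_right_field bose_def intro!: exI[of _ 1])
    moreover have "at 0 within {0..1/2::real} = at_right 0"
      by (rule at_within_Icc_at_right) simp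
    ultimately show ?thesis by (simp add: True continuous_within)
  next
    case False
    then have t0: "t > 0" and t2: "1 - t\<^sup>2 \<noteq> 0" "t < 1" using t by (auto simp: power2_eq_1_iff)
    have "isCont (\<lambda>t. (bose c t - 1 / (c * t)) / (1 - t\<^sup>2) + t / (c * (1 - t\<^sup>2))) t"
      using t0 t2 c DERIV_isCont[OF DERIV_bose[OF c t0]] by (intro continuous_intros) auto
    moreover have "\<forall>\<^sub>F x in nhds t. ?k x = (bose c x - 1 / (c * x)) / (1 - x\<^sup>2) + x / (c * (1 - x\<^sup>2))"
      using t0 by (intro eventually_mono[OF eventually_nhds_in_open[of "{0<..}" t]]) auto
    ultimately have "isCont ?k t" using isCont_cong by fast
    then show ?thesis by (rule continuous_at_imp_continuous_at_within)
  qed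
qed

lemma continuous_on_difference_quotient:
  fixes u :: "real \<Rightarrow> real"
  assumes u: "continuous_on S u" and d: "(u has_real_derivative D) (at x)"
  shows "continuous_on S (\<lambda>t. if t = x then - D else (u t - u x) / (x - t))"
  unfolding continuous_on_eq_continuous_within
proof
  let ?k = "\<lambda>t. if t = x then - D else (u t - u x) / (x - t)"
  fix t assume t: "t \<in> S"
  show "continuous (at t within S) ?k"
  proof (cases "t = x")
    case True
    have "((\<lambda>t. - ((u t - u x) / (t - x))) \<longlongrightarrow> - D) (at x)"
      using d by (intro tendsto_minus) (simp add: has_field_derivative_iff)
    then have "(?k \<longlongrightarrow> - D) (at x)"
      by (rule Lim_transform_eventually)
         (auto simp: eventually_at_filter minus_divide_right intro!: always_eventually)
    then have "(?k \<longlongrightarrow> - D) (at x within S)" by (rule tendsto_within_subset) auto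
    then show ?thesis using True by (simp add: continuous_within)
  next
    case False
    have "continuous (at t within S) (\<lambda>t. (u t - u x) / (x - t))"
      using False u t by (intro continuous_intros) (auto simp: continuous_on_eq_continuous_within)
    moreover have "\<forall>\<^sub>F y in at t within S. (u y - u x) / (x - y) = ?k y"
      using eventually_neq_at_within[of x t S] by eventually_elim simp
    ultimately show ?thesis
      using False unfolding continuous_within by (auto elim: Lim_transform_eventually)
  qed
qed

text \<open>On each of the pieces cut at 1/2 and 3/2 the integrand is a continuous amplitude times
  sin (a t), negligible by Riemann-Lebesgue, plus an explicit pole part. The poles leave Si (a/2)
  with weights 1/c (at 0) and - bose c 1 cos a (at 1), and Si tends to pi/2. The oscillating cos a
  is kept on the left; along a = 2 pi n (\<nu> + N) it does not depend on N.\<close>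

lemma pv_bose_asymptotics:
  assumes c: "c > 0"
  shows "((\<lambda>a. pv_bose c a + pi / 2 * bose c 1 * cos a) \<longlongrightarrow> pi / (2 * c)) at_top"
proof -
  define k0 where "k0 = (\<lambda>t. if t = 0 then - 1/2 else (bose c t - 1 / (c * t)) / (1 - t\<^sup>2) + t / (c * (1 - t\<^sup>2)))"
  define u where "u = (\<lambda>t. bose c t / (1 + t))"
  have bc: "continuous_on S (bose c)" if "S \<subseteq> {0<..}" for S
    using that DERIV_isCont[OF DERIV_bose[OF c]] by (intro continuous_at_imp_continuous_on) auto
  have "(u has_real_derivative (- (c * exp (c * 1) * (bose c 1)\<^sup>2) * (1 + 1) - bose c 1 * 1) / ((1 + 1) * (1 + 1))) (at 1)"
    unfolding u_def by (rule DERIV_divide[OF DERIV_bose[OF c]]) (auto intro!: derivative_eq_intros)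
  then obtain D where D: "(u has_real_derivative D) (at 1)" by blast
  define k1 where "k1 = (\<lambda>t. if t = 1 then - D else (u t - u 1) / (1 - t))"
  define k2 where "k2 = (\<lambda>t. bose c t / (1 - t\<^sup>2))"
  have k0: "continuous_on {0..1/2} k0" unfolding k0_def by (rule continuous_on_quotient_bose[OF c])
  have k1: "continuous_on {1/2..3/2} k1"
    unfolding k1_def by (rule continuous_on_difference_quotient[OF _ D])
      (unfold u_def, intro continuous_intros bc, auto)
  have k2: "continuous_on {3/2..} k2"
  proof -
    have "1 - t\<^sup>2 \<noteq> 0" if "t \<ge> 3/2" for t :: real using that by (auto simp: power2_eq_1_iff)
    then show ?thesis unfolding k2_def by (intro continuous_intros bc) auto
  qed
  have k2i: "set_integrable lborel {3/2..} k2"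
  proof (rule set_integrable_bound)
    show "set_integrable lborel {3/2..} (\<lambda>t. 1 / c * exp (- (c / 2 * t)))"
      using set_integrable_exp_neg(1)[of "c / 2"] c
      by (intro set_integrable_mult_right) (auto elim!: set_integrable_subset)
    show "set_borel_measurable lborel {3/2..} k2"
      unfolding set_borel_measurable_def k2_def by measurable
    have "\<bar>k2 t\<bar> \<le> 1 / c * exp (- (c / 2 * t))" if t: "t \<ge> 3/2" for t
    proof -
      have "(3/2)\<^sup>2 \<le> t\<^sup>2" using t by (intro power_mono) auto
      then have t2: "1 \<le> \<bar>1 - t\<^sup>2\<bar>" by (simp add: power2_eq_square)
      have "bose c t \<le> exp (- (c * t / 2)) / (c * t)" using t by (intro bose_le c) auto
      also have "\<dots> \<le> exp (- (c * t / 2)) / (c * 1)" using t c by (intro divide_left_mono) auto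
      finally have "\<bar>bose c t\<bar> / \<bar>1 - t\<^sup>2\<bar> \<le> (exp (- (c * t / 2)) / (c * 1)) / 1"
        using bose_pos[OF c, of t] t t2 by (intro frac_le) auto
      then show ?thesis by (simp add: k2_def)
    qed
    then show "AE t in lborel. t \<in> {3/2..} \<longrightarrow> norm (k2 t) \<le> norm (1 / c * exp (- (c / 2 * t)))"
      using c by (intro AE_I2) auto
  qed
  define R where "R = (\<lambda>a. (LINT t:{0..1/2}|lborel. k0 t * sin (a * t)) + (LINT t:{1/2..3/2}|lborel. k1 t * sin (a * t))
     + (LINT t:{3/2..}|lborel. k2 t * sin (a * t)))"
  have R: "(R \<longlongrightarrow> 0) at_top"
    unfolding R_def using tendsto_add[OF tendsto_add[OF riemann_lebesgue_Icc[OF k0] riemann_lebesgue_Icc[OF k1]] riemann_lebesgue_Ici[OF k2 k2i]]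
    by simp
  have eq: "pv_bose c a = R a + Si (a / 2) / c - bose c 1 * cos a * Si (a / 2)" if a: "a > 0" for a
  proof -
    let ?f = "\<lambda>t. bose c t * sin (a * t)"
    have i: "set_integrable lborel S (pv_reg ?f)" if "S \<in> sets lborel" "S \<subseteq> {0<..}" for S
      using pv_reg_bose_sin_integrable(1)[OF c, of a] that by (rule set_integrable_subset)
    have split: "{0<..} = ({0<..<1/2} \<union> {1/2..3/2}) \<union> {(3/2::real)<..}" by auto
    have "pv_bose c a = (LINT t:{0<..<1/2}|lborel. pv_reg ?f t) + (LINT t:{1/2..3/2}|lborel. pv_reg ?f t) + (LINT t:{3/2<..}|lborel. pv_reg ?f t)"
      unfolding pv_bose_def split by (subst set_integral_Un; (intro i)?; auto)+
    also have "(LINT t:{0<..<1/2}|lborel. pv_reg ?f t) = (LINT t:{0..1/2}|lborel. k0 t * sin (a * t)) + Si (a / 2) / c"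
    proof -
      have k0i: "set_integrable lborel {0..1/2} (\<lambda>t. k0 t * sin (a * t))"
        by (intro borel_integrable_atLeastAtMost' continuous_intros k0)
      have "(LINT t:{0<..<1/2}|lborel. pv_reg ?f t) = (LINT t:{0<..<1/2}|lborel. k0 t * sin (a * t) + (sin (a * t) / t) / c)"
      proof (rule set_lebesgue_integral_cong, simp, intro allI impI)
        fix t :: real assume t: "t \<in> {0<..<1/2}"
        then have t2: "1 - t\<^sup>2 \<noteq> 0" by (auto simp: power2_eq_1_iff)
        have "1 / (c * t) = (1 - t\<^sup>2) / (c * t * (1 - t\<^sup>2))" using t2 by simp
        also have "\<dots> = 1 / (c * t) / (1 - t\<^sup>2) - t / (c * (1 - t\<^sup>2))"
          using t c by (simp add: diff_divide_distrib power2_eq_square)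
        finally have "1 / (c * t) = 1 / (c * t) / (1 - t\<^sup>2) - t / (c * (1 - t\<^sup>2))" .
        moreover have "k0 t = bose c t / (1 - t\<^sup>2) - 1 / (c * t) / (1 - t\<^sup>2) + t / (c * (1 - t\<^sup>2))"
          using t by (simp add: k0_def diff_divide_distrib)
        ultimately have "bose c t / (1 - t\<^sup>2) = k0 t + 1 / (c * t)"
          by linarith
        then have "pv_reg ?f t = (k0 t + 1 / (c * t)) * sin (a * t)"
          using t by (simp add: pv_reg_outside times_divide_eq_left[symmetric] del: times_divide_eq_left)
        then show "pv_reg ?f t = k0 t * sin (a * t) + (sin (a * t) / t) / c"
          by (simp add: distrib_right mult.commute[of c t])
      qed
      also have "\<dots> = (LINT t:{0<..<1/2}|lborel. k0 t * sin (a * t)) + (LINT t:{0<..<1/2}|lborel. (sin (a * t) / t) / c)"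
        by (intro set_integral_add(2) set_integrable_subset[OF k0i] set_integrable_divide LINT_sin_over_id(1) a) auto
      also have "(LINT t:{0<..<1/2}|lborel. (sin (a * t) / t) / c) = Si (a / 2) / c"
        by (simp only: set_integral_divide_zero LINT_sin_over_id(2)[OF a])
      also have "(LINT t:{0<..<1/2}|lborel. k0 t * sin (a * t)) = (LINT t:{0..1/2}|lborel. k0 t * sin (a * t))"
      proof (rule set_integral_cong_set)
        show "set_borel_measurable lborel {0..1/2} (\<lambda>t. k0 t * sin (a * t))" "set_borel_measurable lborel {0<..<1/2} (\<lambda>t. k0 t * sin (a * t))"
        proof -
          have "set_integrable lborel {0<..<1/2} (\<lambda>t. k0 t * sin (a * t))"
            by (rule set_integrable_subset[OF k0i]) auto
          with k0i show "set_borel_measurable lborel {0..1/2} (\<lambda>t. k0 t * sin (a * t))" "set_borel_measurable lborel {0<..<1/2} (\<lambda>t. k0 t * sin (a * t))"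
            by (auto simp: set_integrable_def set_borel_measurable_def)
        qed
        show "AE t in lborel. (t \<in> {0..1/2}) = (t \<in> {0<..<1/2::real})"
          using AE_lborel_singleton[of 0] AE_lborel_singleton[of "1/2"] by eventually_elim auto
      qed
      finally show ?thesis .
    qed
    also have "(LINT t:{1/2..3/2}|lborel. pv_reg ?f t) = (LINT t:{1/2..3/2}|lborel. k1 t * sin (a * t)) - bose c 1 * cos a * Si (a / 2)"
    proof -
      have k1i: "set_integrable lborel {1/2..3/2} (\<lambda>t. k1 t * sin (a * t))"
        by (intro borel_integrable_atLeastAtMost' continuous_intros k1)
      have gi: "set_integrable lborel {1/2..3/2} (\<lambda>t. u 1 * ((sin (a * t) - sin a) / (1 - t)))"
        by (intro set_integrable_mult_right LINT_pv_sin(1) a)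
      \<comment> \<open>Splitting u(t) sin (a t) - u(1) sin a as (u(t) - u(1)) sin (a t) + u(1) (sin
        (a t) - sin a) separates the amplitude from the pole.\<close>
      have "(LINT t:{1/2..3/2}|lborel. pv_reg ?f t) = (LINT t:{1/2..3/2}|lborel. k1 t * sin (a * t) + u 1 * ((sin (a * t) - sin a) / (1 - t)))"
        unfolding set_lebesgue_integral_def
      proof (rule integral_cong_AE)
        show "(\<lambda>t. indicat_real {1/2..3/2} t *\<^sub>R pv_reg ?f t) \<in> borel_measurable lborel"
          unfolding pv_reg_def by measurable
        show "(\<lambda>t. indicat_real {1/2..3/2} t *\<^sub>R (k1 t * sin (a * t) + u 1 * ((sin (a * t) - sin a) / (1 - t)))) \<in> borel_measurable lborel"
          using set_integral_add(1)[OF k1i gi] by (auto simp: set_integrable_def)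
        show "AE t in lborel. indicat_real {1/2..3/2} t *\<^sub>R pv_reg ?f t
            = indicat_real {1/2..3/2} t *\<^sub>R (k1 t * sin (a * t) + u 1 * ((sin (a * t) - sin a) / (1 - t)))"
          using AE_lborel_singleton[of 1]
        proof eventually_elim
          fix t :: real assume "t \<noteq> 1"
          then have "k1 t * sin (a * t) + u 1 * ((sin (a * t) - sin a) / (1 - t)) = (u t * sin (a * t) - u 1 * sin a) / (1 - t)"
            by (simp add: k1_def add_divide_distrib[symmetric] algebra_simps)
          then show "indicat_real {1/2..3/2} t *\<^sub>R pv_reg ?f t
            = indicat_real {1/2..3/2} t *\<^sub>R (k1 t * sin (a * t) + u 1 * ((sin (a * t) - sin a) / (1 - t)))"
            by (auto simp: indicator_def pv_reg_split u_def)
        qed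
      qed
      also have "\<dots> = (LINT t:{1/2..3/2}|lborel. k1 t * sin (a * t)) + (LINT t:{1/2..3/2}|lborel. u 1 * ((sin (a * t) - sin a) / (1 - t)))"
        by (rule set_integral_add(2)[OF k1i gi])
      also have "(LINT t:{1/2..3/2}|lborel. u 1 * ((sin (a * t) - sin a) / (1 - t))) = - bose c 1 * cos a * Si (a / 2)"
        by (subst set_integral_mult_right, subst LINT_pv_sin(2)[OF a]) (simp add: u_def)
      finally show ?thesis by simp
    qed
    also have "(LINT t:{3/2<..}|lborel. pv_reg ?f t) = (LINT t:{3/2..}|lborel. k2 t * sin (a * t))"
      unfolding set_lebesgue_integral_def
    proof (rule integral_cong_AE)
      show "(\<lambda>t. indicat_real {3/2<..} t *\<^sub>R pv_reg ?f t) \<in> borel_measurable lborel"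
        unfolding pv_reg_def by measurable
      show "(\<lambda>t. indicat_real {3/2..} t *\<^sub>R (k2 t * sin (a * t))) \<in> borel_measurable lborel"
        unfolding k2_def by measurable
      show "AE t in lborel. indicat_real {3/2<..} t *\<^sub>R pv_reg ?f t = indicat_real {3/2..} t *\<^sub>R (k2 t * sin (a * t))"
        using AE_lborel_singleton[of "3/2"]
        by eventually_elim (auto simp: indicator_def pv_reg_outside k2_def)
    qed
    finally show ?thesis by (simp add: R_def)
  qed
  have Si: "((\<lambda>a. Si (a / 2)) \<longlongrightarrow> pi / 2) at_top"
    by (rule filterlim_compose[OF Si_at_top]) real_asymp
  have z: "((\<lambda>a. cos a * (pi / 2 - Si (a / 2))) \<longlongrightarrow> 0) at_top"
  proof (rule Lim_null_comparison)
    have "((\<lambda>a. \<bar>pi / 2 - Si (a / 2)\<bar>) \<longlongrightarrow> \<bar>pi / 2 - pi / 2\<bar>) at_top"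
      by (intro tendsto_intros Si)
    then show "((\<lambda>a. \<bar>pi / 2 - Si (a / 2)\<bar>) \<longlongrightarrow> 0) at_top" by simp
    show "\<forall>\<^sub>F a in at_top. norm (cos a * (pi / 2 - Si (a / 2))) \<le> \<bar>pi / 2 - Si (a / 2)\<bar>"
      by (intro always_eventually allI) (simp add: abs_mult mult_left_le_one_le)
  qed
  have "((\<lambda>a. R a + Si (a / 2) / c + bose c 1 * (cos a * (pi / 2 - Si (a / 2)))) \<longlongrightarrow> 0 + (pi / 2) / c + bose c 1 * 0) at_top"
    using c by (intro tendsto_intros R Si z) auto
  then have "((\<lambda>a. R a + Si (a / 2) / c + bose c 1 * (cos a * (pi / 2 - Si (a / 2)))) \<longlongrightarrow> pi / (2 * c)) at_top"
    by simp
  then show ?thesis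
  proof (rule Lim_transform_eventually)
    show "\<forall>\<^sub>F a in at_top. R a + Si (a / 2) / c + bose c 1 * (cos a * (pi / 2 - Si (a / 2)))
        = pv_bose c a + pi / 2 * bose c 1 * cos a"
      using eventually_gt_at_top[of 0] by eventually_elim (simp add: eq algebra_simps)
  qed
qed

section \<open>Stirling's formula\<close>

text \<open>The quotient being squared is 4^n divided by the central binomial coefficient. In this
  form the logarithm of the Wallis product can be matched with factorials.\<close>

lemma wallis_partial_product:
  "(\<Prod>k=1..n. (4 * real k ^ 2) / (4 * real k ^ 2 - 1))
     = (4 ^ n * (fact n)\<^sup>2 / fact (2 * n))\<^sup>2 / (2 * real n + 1)"
proof (induction n)
  case (Suc n)
  have f: "(fact (2 * Suc n) :: real) = (2 * real n + 2) * (2 * real n + 1) * fact (2 * n)"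
    by (simp add: algebra_simps)
  have g: "(fact (Suc n) :: real) = (real n + 1) * fact n"
    by (simp add: algebra_simps)
  have h: "4 * real (Suc n) ^ 2 - 1 = (2 * real n + 1) * (2 * real n + 3)"
    by (simp add: algebra_simps power2_eq_square)
  have "(\<Prod>k=1..Suc n. (4 * real k ^ 2) / (4 * real k ^ 2 - 1))
      = (4 ^ n * (fact n)\<^sup>2 / fact (2 * n))\<^sup>2 / (2 * real n + 1)
          * ((4 * (real n + 1) ^ 2) / ((2 * real n + 1) * (2 * real n + 3)))"
    using Suc h by (simp add: add.commute)
  also have "\<dots> = (4 ^ Suc n * (fact (Suc n))\<^sup>2 / fact (2 * Suc n))\<^sup>2 / (2 * real (Suc n) + 1)"
  proof -
    have "(x * y\<^sup>2 / z)\<^sup>2 / A * (4 * u\<^sup>2 / (A * C)) = (4 * x * (u * y)\<^sup>2 / (2 * u * A * z))\<^sup>2 / C"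
      if "u \<noteq> 0" "A \<noteq> 0" "C \<noteq> 0" "z \<noteq> 0" for x y z A C u :: real
      using that by (simp add: field_simps power2_eq_square)
    from this[of "real n + 1" "2 * real n + 1" "2 * real n + 3" "fact (2 * n)" "4 ^ n" "fact n"]
    show ?thesis
      unfolding f g by (simp add: add_nonneg_eq_0_iff add.commute mult.assoc)
  qed
  finally show ?case .
qed auto

text \<open>The increments are O(1/n^2), so the sequence converges to some c. To identify it, 2 st n
  - st (2n) tends to 2 c - c, and it is also a combination of elementary logarithms and the
  logarithm of the Wallis product.\<close>

lemma stirling_ln_fact:
  "(\<lambda>n. ln (fact n) - (real n + 1/2) * ln (real n) + real n) \<longlonglongrightarrow> ln (2 * pi) / 2"
proof -
  define st where "st = (\<lambda>n::nat. ln (fact n) - (real n + 1/2) * ln (real n) + real n)"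
  have diff: "st (Suc n) - st n = ln (real n + 1) - (real n + 3/2) * ln (real n + 1) + 1 + (real n + 1/2) * ln (real n)" for n
  proof -
    have "(fact (Suc n) :: real) = (real n + 1) * fact n"
      by (simp add: algebra_simps)
    then have "ln (fact (Suc n) :: real) = ln (real n + 1) + ln (fact n)"
      by (simp only: ln_mult fact_nonzero) (simp add: ln_mult)
    then show ?thesis by (simp add: st_def add.commute algebra_simps del: fact_Suc)
  qed
  have "(\<lambda>n. st (Suc n) - st n) \<in> O(\<lambda>n. 1 / real n ^ 2)"
    unfolding diff by real_asymp
  moreover have "summable (\<lambda>n. norm (1 / real n ^ 2))"
    using inverse_power_summable[of 2, where ?'a = real] by (simp add: field_simps)
  ultimately have "summable (\<lambda>n. st (Suc n) - st n)"
    by (rule summable_comparison_test_bigo[rotated])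
  then have "convergent (\<lambda>n. \<Sum>k<n. st (Suc k) - st k)"
    by (simp add: summable_iff_convergent)
  then have "convergent (\<lambda>n. (st n - st 0) + st 0)"
    unfolding sum_lessThan_telescope by (intro convergent_add convergent_const)
  then obtain c where c: "st \<longlonglongrightarrow> c"
    by (auto simp: convergent_def)
  have "strict_mono (\<lambda>n::nat. 2 * n)"
    by (auto simp: strict_mono_def)
  from LIMSEQ_subseq_LIMSEQ[OF c this] have c2: "(\<lambda>n. 2 * st n - st (2 * n)) \<longlonglongrightarrow> 2 * c - c"
    by (intro tendsto_intros c) (simp add: o_def)
  have "(\<lambda>n. ln (\<Prod>k=1..n. (4 * real k ^ 2) / (4 * real k ^ 2 - 1))) \<longlonglongrightarrow> ln (pi / 2)"
    by (intro tendsto_ln wallis) auto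
  moreover have "(\<lambda>n. ln (2 * real n + 1) - ln (real n)) \<longlonglongrightarrow> ln 2"
    by real_asymp
  ultimately have lim: "(\<lambda>n. (ln (\<Prod>k=1..n. (4 * real k ^ 2) / (4 * real k ^ 2 - 1))
      + (ln (2 * real n + 1) - ln (real n)) + ln 2) / 2) \<longlonglongrightarrow> (ln (pi / 2) + ln 2 + ln 2) / 2"
    by (rule tendsto_divide[OF tendsto_add[OF tendsto_add tendsto_const] tendsto_const]) auto
  have "\<forall>\<^sub>F n in sequentially. (ln (\<Prod>k=1..n. (4 * real k ^ 2) / (4 * real k ^ 2 - 1))
      + (ln (2 * real n + 1) - ln (real n)) + ln 2) / 2 = 2 * st n - st (2 * n)"
    using eventually_gt_at_top[of 0]
  proof eventually_elim
    fix n :: nat assume n: "n > 0"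
    have l1: "ln ((4 ^ n * (fact n)\<^sup>2 / fact (2 * n))\<^sup>2 / (2 * real n + 1))
        = 2 * (real n * (2 * ln 2) + 2 * ln (fact n) - ln (fact (2 * n))) - ln (2 * real n + 1)"
    proof -
      have "ln (4 :: real) = 2 * ln 2"
        using ln_realpow[of 2 2] by simp
      moreover have "2 * real n + 1 > 0" by simp
      ultimately show ?thesis
        by (simp add: ln_div ln_realpow ln_mult)
    qed
    have l2: "ln (real (2 * n)) = ln 2 + ln (real n)"
      using n by (simp add: ln_mult)
    show "(ln (\<Prod>k=1..n. (4 * real k ^ 2) / (4 * real k ^ 2 - 1))
      + (ln (2 * real n + 1) - ln (real n)) + ln 2) / 2 = 2 * st n - st (2 * n)"
      unfolding wallis_partial_product l1 st_def l2 by (simp add: field_simps)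
  qed
  from Lim_transform_eventually[OF lim this] c2
  have "2 * c - c = (ln (pi / 2) + ln 2 + ln 2) / 2"
    using LIMSEQ_unique by blast
  then have "c = ln (2 * pi) / 2"
    by (simp add: ln_mult ln_div)
  with c show ?thesis by (simp add: st_def)
qed

text \<open>The Gauss limit for Gamma compares Gamma (z + n + 1) with n! n^z, which reduces the real
  argument to the factorial case.\<close>

lemma stirling_ln_Gamma_shift:
  fixes z :: real
  assumes "z > 0"
  shows "(\<lambda>n. ln (Gamma (z + real n + 1)) - (z + real n + 1/2) * ln (z + real n) + (z + real n))
           \<longlonglongrightarrow> ln (2 * pi) / 2"
proof -
  have nz: "z \<notin> \<int>\<^sub>\<le>\<^sub>0" using assms nonpos_Ints_nonpos by force
  have G: "Gamma z > 0" "Gamma (z + real n + 1) > 0" for n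
    using assms by (auto intro!: Gamma_real_pos add_pos_nonneg)
  have "(\<lambda>n. ln (Gamma_series z n) - ln (Gamma z)) \<longlonglongrightarrow> ln (Gamma z) - ln (Gamma z)"
    using G by (intro tendsto_intros) auto
  also have "(\<lambda>n. ln (Gamma_series z n) - ln (Gamma z))
      = (\<lambda>n. ln (fact n) + z * ln (real n) - ln (Gamma (z + real n + 1)))"
  proof
    fix n
    have "pochhammer z (n + 1) = Gamma (z + real n + 1) / Gamma z"
      using pochhammer_Gamma[of z "n + 1", OF nz] by (simp add: add_ac)
    then have "Gamma_series z n = fact n * exp (z * ln (real n)) * Gamma z / Gamma (z + real n + 1)"
      by (simp add: Gamma_series_def)
    then show "ln (Gamma_series z n) - ln (Gamma z) = ln (fact n) + z * ln (real n) - ln (Gamma (z + real n + 1))"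
      using G(1) G(2)[of n] by (simp add: ln_div ln_mult)
  qed
  finally have 1: "(\<lambda>n. ln (fact n) + z * ln (real n) - ln (Gamma (z + real n + 1))) \<longlonglongrightarrow> 0"
    by simp
  have 2: "(\<lambda>n. (real n + 1/2) * ln (real n) - real n + z * ln (real n)
      - (z + real n + 1/2) * ln (z + real n) + (z + real n)) \<longlonglongrightarrow> 0"
    by real_asymp
  from tendsto_add[OF tendsto_diff[OF stirling_ln_fact 1] 2] show ?thesis
    by (simp add: algebra_simps)
qed

section \<open>The functional equation and its limit\<close>

lemma abs_integral_sin_le:
  fixes K :: real
  assumes "K > 0" "x \<le> y"
  shows "\<bar>integral {x..y} (\<lambda>s. sin (K * s))\<bar> \<le> 2 / K"
proof -
  have "((\<lambda>s. sin (K * s)) has_integral ((- cos (K * y) / K) - (- cos (K * x) / K))) {x..y}"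
    by (rule fundamental_theorem_of_calculus)
       (use assms in \<open>auto intro!: derivative_eq_intros simp: has_real_derivative_iff_has_vector_derivative[symmetric]\<close>)
  then have "integral {x..y} (\<lambda>s. sin (K * s)) = (cos (K * x) - cos (K * y)) / K"
    by (simp add: integral_unique diff_divide_distrib)
  moreover have "\<bar>cos (K * x) - cos (K * y)\<bar> \<le> 2"
    using abs_cos_le_one[of "K * x"] abs_cos_le_one[of "K * y"] by linarith
  ultimately show ?thesis using assms by (simp add: divide_right_mono)
qed

text \<open>The point is independence of N. \<open>B\<close> is monotone along the range since \<nu>
  > 0 keeps its argument positive, so the second mean value theorem leaves two pure sine integrals,
  each at most 2/K with weight at most 1/2; here K = 2 pi n.\<close>

lemma abs_LINT_sin_B_le:
  assumes \<alpha>: "\<alpha> > 0" and \<nu>: "\<nu> > 0" and n: "n > 0"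
  shows "\<bar>LINT s:{0..real N}|lborel. sin (2 * pi * real n * s) * B (\<alpha> * (\<nu> + s))\<bar> \<le> 1 / (pi * real n)"
proof -
  define K where "K = 2 * pi * real n"
  have K: "K > 0" using n by (simp add: K_def)
  have "set_integrable lborel {0..real N} (\<lambda>s. sin (K * s) * B (\<alpha> * (\<nu> + s)))"
    by (rule set_integrable_times_B) (auto intro!: continuous_intros)
  then have eq: "(LINT s:{0..real N}|lborel. sin (K * s) * B (\<alpha> * (\<nu> + s)))
      = integral {0..real N} (\<lambda>s. B (\<alpha> * (\<nu> + s)) * sin (K * s))"
    by (simp add: set_borel_integral_eq_integral(2) mult.commute)
  have "(\<lambda>s. sin (K * s)) integrable_on {0..real N}"
    by (intro integrable_continuous_interval continuous_intros)
  moreover have "B (\<alpha> * (\<nu> + x)) \<le> B (\<alpha> * (\<nu> + y))" if "0 \<le> x" "x \<le> y" for x y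
    using that \<alpha> \<nu> by (intro B_mono) auto
  ultimately obtain m where m: "m \<in> {0..real N}"
    "integral {0..real N} (\<lambda>s. B (\<alpha> * (\<nu> + s)) * sin (K * s))
       = B (\<alpha> * (\<nu> + 0)) * integral {0..m} (\<lambda>s. sin (K * s)) + B (\<alpha> * (\<nu> + real N)) * integral {m..real N} (\<lambda>s. sin (K * s))"
    using second_mean_value_theorem[of "\<lambda>s. sin (K * s)" 0 "real N" "\<lambda>s. B (\<alpha> * (\<nu> + s))"] by auto
  have "\<bar>B u * integral {x..y} (\<lambda>s. sin (K * s))\<bar> \<le> 1/2 * (2 / K)" if "x \<le> y" for u x y
    unfolding abs_mult by (intro mult_mono abs_B_le abs_integral_sin_le K that) auto
  from this[of 0 m "\<alpha> * (\<nu> + 0)"] this[of m "real N" "\<alpha> * (\<nu> + real N)"] m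
  have "\<bar>integral {0..real N} (\<lambda>s. B (\<alpha> * (\<nu> + s)) * sin (K * s))\<bar> \<le> 1/2 * (2 / K) + 1/2 * (2 / K)"
    unfolding m(2) by (intro order_trans[OF abs_triangle_ineq] add_mono) auto
  also have "\<dots> = 1 / (pi * real n)" by (simp add: K_def)
  finally show ?thesis using eq unfolding K_def by simp
qed

section \<open>The series of principal values: shift and limit\<close>

definition pv_coeff :: "real \<Rightarrow> real \<Rightarrow> nat \<Rightarrow> real" where
  "pv_coeff \<alpha> \<nu> n = 1 / real (Suc n) * pv_bose (2 * pi * real (Suc n) / \<alpha>) (2 * pi * real (Suc n) * \<nu>)"

lemma pv_integrand_sums:
  assumes "\<alpha> > 0"
  shows "has_pv_integral (pv_integrand \<alpha> \<nu>) 1 {0<..} (\<Sum>n. pv_coeff \<alpha> \<nu> n)"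
    and "summable (\<lambda>n. \<bar>pv_coeff \<alpha> \<nu> n\<bar>)"
  using pv_integrand_has_pv_integral[OF assms, of \<nu>] unfolding pv_coeff_def by simp_all

lemma pv_coeff_shift:
  assumes "\<alpha> > 0"
  shows "pv_coeff \<alpha> \<nu> n - pv_coeff \<alpha> (\<nu> + real N) n
    = pi * \<alpha> * (1 / real (Suc n) * (LINT s:{0..real N}|lborel. sin (2 * pi * real (Suc n) * s) * B (\<alpha> * (\<nu> + s))))"
  using pv_bose_shift[OF assms, of "Suc n" \<nu> N]
  by (simp add: pv_coeff_def diff_divide_distrib[symmetric] del: of_nat_Suc)

lemma suminf_pv_coeff_shift:
  assumes \<alpha>: "\<alpha> > 0"
  shows "(\<Sum>n. pv_coeff \<alpha> \<nu> n) - (\<Sum>n. pv_coeff \<alpha> (\<nu> + 1) n)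
    = pi\<^sup>2 * \<alpha> * (LINT s:{0..1}|lborel. (1/2 - s) * B (\<alpha> * (\<nu> + s)))"
proof -
  define c where "c = (\<lambda>n. LINT s:{0..1}|lborel. sin (2 * pi * real (Suc n) * s) * B (\<alpha> * (\<nu> + s)))"
  have s: "summable (pv_coeff \<alpha> \<mu>)" for \<mu>
    using pv_integrand_sums(2)[OF \<alpha>] by (rule summable_rabs_cancel)
  have eq: "1 / real (Suc n) * c n = (pv_coeff \<alpha> \<nu> n - pv_coeff \<alpha> (\<nu> + 1) n) / (pi * \<alpha>)" for n
    using pv_coeff_shift[OF \<alpha>, of \<nu> n 1] \<alpha> by (simp add: c_def field_simps)
  \<comment> \<open>No decay of Fourier coefficients is estimated: absolute summability is inherited
    from the principal values at \<nu> and \<nu> + 1.\<close>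
  have "summable (\<lambda>n. \<bar>1 / real (Suc n) * c n\<bar>)"
  proof (rule summable_comparison_test')
    show "summable (\<lambda>n. (\<bar>pv_coeff \<alpha> \<nu> n\<bar> + \<bar>pv_coeff \<alpha> (\<nu> + 1) n\<bar>) / (pi * \<alpha>))"
      by (intro summable_divide summable_add pv_integrand_sums(2) \<alpha>)
    show "norm \<bar>1 / real (Suc n) * c n\<bar> \<le> (\<bar>pv_coeff \<alpha> \<nu> n\<bar> + \<bar>pv_coeff \<alpha> (\<nu> + 1) n\<bar>) / (pi * \<alpha>)" for n
      unfolding eq using \<alpha> by (auto intro!: divide_right_mono)
  qed
  moreover have "set_integrable lborel {0..1} (\<lambda>s. B (\<alpha> * (\<nu> + s)))"
    using set_integrable_times_B[of 0 1 "\<lambda>_. 1" "\<lambda>s. \<alpha> * (\<nu> + s)"] by simp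
  ultimately have "(\<Sum>n. 1 / real (Suc n) * c n) = pi * (LINT s:{0..1}|lborel. (1/2 - s) * B (\<alpha> * (\<nu> + s)))"
    unfolding c_def by (intro suminf_sin_coeffs)
  moreover have "(\<Sum>n. 1 / real (Suc n) * c n) = ((\<Sum>n. pv_coeff \<alpha> \<nu> n) - (\<Sum>n. pv_coeff \<alpha> (\<nu> + 1) n)) / (pi * \<alpha>)"
    unfolding eq by (simp add: suminf_divide[OF summable_diff[OF s s]] suminf_diff[OF s s])
  ultimately have "(\<Sum>n. pv_coeff \<alpha> \<nu> n) - (\<Sum>n. pv_coeff \<alpha> (\<nu> + 1) n)
     = (pi * (LINT s:{0..1}|lborel. (1/2 - s) * B (\<alpha> * (\<nu> + s)))) * (pi * \<alpha>)"
    using \<alpha> by (simp add: divide_eq_eq)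
  then show ?thesis by (simp add: power2_eq_square mult_ac)
qed

lemma cos_term_eq:
  "cos_term \<alpha> \<nu> n = 1 / real (Suc n) * (bose (2 * pi * real (Suc n) / \<alpha>) 1 * cos (2 * pi * real (Suc n) * \<nu>))"
  by (simp add: cos_term_def bose_def mult_ac del: of_nat_Suc)

lemma cos_shift_nat: "cos (2 * pi * real n * (\<nu> + real N)) = cos (2 * pi * real n * \<nu>)"
proof -
  have "2 * pi * real n * (\<nu> + real N) = 2 * pi * real n * \<nu> + 2 * pi * real (n * N)"
    by (simp add: algebra_simps)
  then show ?thesis using sin_2npi[of "n * N"] cos_2npi[of "n * N"] by (simp add: cos_add mult_ac)
qed

lemma cos_term_shift: "cos_term \<alpha> (\<nu> + real N) = cos_term \<alpha> \<nu>"
  unfolding cos_term_eq fun_eq_iff cos_shift_nat by simp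

text \<open>Tannery's theorem, dominated by the terms at \<nu> itself plus the shift integral bound
  \<alpha> / n^2. The termwise limit is \<alpha> / (4 n^2) from the pole at 0 minus pi/2 times the
  cosine term from the pole at 1. Summability of the cosine series follows because both other parts
  are summable.\<close>

lemma suminf_pv_coeff_limit:
  assumes \<alpha>: "\<alpha> > 0" and \<nu>: "\<nu> > 0"
  shows "summable (cos_term \<alpha> \<nu>)"
    and "(\<lambda>N. \<Sum>n. pv_coeff \<alpha> (\<nu> + real N) n) \<longlonglongrightarrow> pi\<^sup>2 * \<alpha> / 24 - pi / 2 * (\<Sum>n. cos_term \<alpha> \<nu> n)"
proof -
  define b where "b = (\<lambda>n. \<alpha> / 4 * (1 / (real (Suc n))\<^sup>2) - pi / 2 * cos_term \<alpha> \<nu> n)"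
  have lim: "(\<lambda>N. pv_coeff \<alpha> (\<nu> + real N) n) \<longlonglongrightarrow> b n" for n
  proof -
    let ?c = "2 * pi * real (Suc n) / \<alpha>"
    have c: "?c > 0" using \<alpha> by simp
    have "filterlim (\<lambda>N. 2 * pi * real (Suc n) * (\<nu> + real N)) at_top sequentially"
      by (rule filterlim_tendsto_pos_mult_at_top[OF tendsto_const])
         (simp_all add: filterlim_tendsto_add_at_top[OF tendsto_const filterlim_real_sequentially] del: of_nat_Suc)
    from filterlim_compose[OF pv_bose_asymptotics[OF c] this]
    have "(\<lambda>N. pv_bose ?c (2 * pi * real (Suc n) * (\<nu> + real N)) + pi / 2 * bose ?c 1 * cos (2 * pi * real (Suc n) * \<nu>))
        \<longlonglongrightarrow> pi / (2 * ?c)"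
      unfolding cos_shift_nat .
    then have "(\<lambda>N. 1 / real (Suc n) * ((pv_bose ?c (2 * pi * real (Suc n) * (\<nu> + real N)) + pi / 2 * bose ?c 1 * cos (2 * pi * real (Suc n) * \<nu>))
          - pi / 2 * bose ?c 1 * cos (2 * pi * real (Suc n) * \<nu>)))
        \<longlonglongrightarrow> 1 / real (Suc n) * (pi / (2 * ?c) - pi / 2 * bose ?c 1 * cos (2 * pi * real (Suc n) * \<nu>))"
      by (intro tendsto_intros)
    moreover have "1 / real (Suc n) * (pi / (2 * ?c) - pi / 2 * bose ?c 1 * cos (2 * pi * real (Suc n) * \<nu>)) = b n"
      using \<alpha> unfolding b_def cos_term_eq by (simp add: right_diff_distrib power2_eq_square mult_ac del: of_nat_Suc)
    ultimately show ?thesis by (simp add: pv_coeff_def del: of_nat_Suc)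
  qed
  have bound: "\<bar>pv_coeff \<alpha> (\<nu> + real N) n\<bar> \<le> \<bar>pv_coeff \<alpha> \<nu> n\<bar> + \<alpha> * (1 / (real (Suc n))\<^sup>2)" for n N
  proof -
    let ?I = "LINT s:{0..real N}|lborel. sin (2 * pi * real (Suc n) * s) * B (\<alpha> * (\<nu> + s))"
    have "\<bar>?I\<bar> \<le> 1 / (pi * real (Suc n))" by (rule abs_LINT_sin_B_le[OF \<alpha> \<nu>]) simp
    then have "pi * \<alpha> * (1 / real (Suc n) * \<bar>?I\<bar>) \<le> pi * \<alpha> * (1 / real (Suc n) * (1 / (pi * real (Suc n))))"
      using \<alpha> by (intro mult_left_mono) auto
    also have "\<dots> = \<alpha> * (1 / (real (Suc n))\<^sup>2)" by (simp add: power2_eq_square del: of_nat_Suc)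
    finally have "\<bar>pv_coeff \<alpha> \<nu> n - pv_coeff \<alpha> (\<nu> + real N) n\<bar> \<le> \<alpha> * (1 / (real (Suc n))\<^sup>2)"
      unfolding pv_coeff_shift[OF \<alpha>] using \<alpha> by (simp add: abs_mult del: of_nat_Suc)
    then show ?thesis by linarith
  qed
  have sb: "summable (\<lambda>n. norm (b n))"
    and L: "(\<lambda>N. \<Sum>n. pv_coeff \<alpha> (\<nu> + real N) n) \<longlonglongrightarrow> (\<Sum>n. b n)"
  proof -
    let ?M = "\<lambda>n. \<bar>pv_coeff \<alpha> \<nu> n\<bar> + \<alpha> * (1 / (real (Suc n))\<^sup>2)"
    have "\<forall>\<^sub>F (n, N) in sequentially \<times>\<^sub>F sequentially. norm (pv_coeff \<alpha> (\<nu> + real N) n) \<le> ?M n"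
      using bound by (intro always_eventually) auto
    moreover have "summable ?M"
      by (intro summable_add summable_mult pv_integrand_sums(2) \<alpha> summable_inverse_Suc_squares)
    ultimately have "(\<forall>\<^sub>F N in sequentially. summable (\<lambda>n. norm (pv_coeff \<alpha> (\<nu> + real N) n))) \<and> summable (\<lambda>n. norm (b n))
        \<and> (\<lambda>N. \<Sum>n. pv_coeff \<alpha> (\<nu> + real N) n) \<longlonglongrightarrow> (\<Sum>n. b n)"
      using lim by (intro tannerys_theorem[where a = "\<lambda>n N. pv_coeff \<alpha> (\<nu> + real N) n"]) auto
    then show "summable (\<lambda>n. norm (b n))" "(\<lambda>N. \<Sum>n. pv_coeff \<alpha> (\<nu> + real N) n) \<longlonglongrightarrow> (\<Sum>n. b n)"
      by blast+
  qed
  have sq: "(\<lambda>n. \<alpha> / 4 * (1 / (real (Suc n))\<^sup>2)) sums (\<alpha> / 4 * (pi\<^sup>2 / 6))"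
    using inverse_squares_sums by (intro sums_mult) (simp add: add.commute)
  have "cos_term \<alpha> \<nu> = (\<lambda>n. 2 / pi * (\<alpha> / 4 * (1 / (real (Suc n))\<^sup>2) - b n))"
    by (simp add: b_def fun_eq_iff del: of_nat_Suc)
  moreover have "summable (\<lambda>n. 2 / pi * (\<alpha> / 4 * (1 / (real (Suc n))\<^sup>2) - b n))"
    by (intro summable_mult summable_diff summable_inverse_Suc_squares summable_norm_cancel[OF sb])
  ultimately show sc: "summable (cos_term \<alpha> \<nu>)" by simp
  have "b sums (\<alpha> / 4 * (pi\<^sup>2 / 6) - pi / 2 * (\<Sum>n. cos_term \<alpha> \<nu> n))"
    unfolding b_def by (intro sums_diff sq sums_mult summable_sums sc)
  with L show "(\<lambda>N. \<Sum>n. pv_coeff \<alpha> (\<nu> + real N) n) \<longlonglongrightarrow> pi\<^sup>2 * \<alpha> / 24 - pi / 2 * (\<Sum>n. cos_term \<alpha> \<nu> n)"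
    by (simp add: sums_iff mult.commute)
qed

lemma summable_cos_term:
  assumes "\<alpha> > 0" "\<nu> > -1"
  shows "summable (cos_term \<alpha> \<nu>)"
  using suminf_pv_coeff_limit(1)[of \<alpha> "\<nu> + real 1"] assms cos_term_shift[of \<alpha> \<nu> 1] by simp

lemma M_eq:
  assumes "\<alpha> > 0"
  shows "M \<alpha> \<nu> = - (\<Sum>n. cos_term \<alpha> \<nu> n) - 2 / pi * (\<Sum>n. pv_coeff \<alpha> \<nu> n)"
  using pv_integral_eqI[OF pv_integrand_sums(1)[OF assms]] by (simp add: M_def)

lemma M_shift:
  assumes "\<alpha> > 0"
  shows "M \<alpha> (\<nu> + 1) - M \<alpha> \<nu> = 2 * pi * \<alpha> * (LINT s:{0..1}|lborel. (1/2 - s) * B (\<alpha> * (\<nu> + s)))"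
proof -
  have "M \<alpha> (\<nu> + 1) - M \<alpha> \<nu> = 2 / pi * ((\<Sum>n. pv_coeff \<alpha> \<nu> n) - (\<Sum>n. pv_coeff \<alpha> (\<nu> + 1) n))"
    using cos_term_shift[of \<alpha> \<nu> 1] unfolding M_eq[OF assms] by (simp add: right_diff_distrib)
  then show ?thesis
    unfolding suminf_pv_coeff_shift[OF assms] by (simp add: power2_eq_square)
qed

lemma M_limit:
  assumes "\<alpha> > 0" "\<nu> > 0"
  shows "(\<lambda>N. M \<alpha> (\<nu> + real N)) \<longlonglongrightarrow> - (pi * \<alpha> / 12)"
proof -
  have "(\<lambda>N. - (\<Sum>n. cos_term \<alpha> \<nu> n) - 2 / pi * (\<Sum>n. pv_coeff \<alpha> (\<nu> + real N) n)) \<longlonglongrightarrow>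
     - (\<Sum>n. cos_term \<alpha> \<nu> n) - 2 / pi * (pi\<^sup>2 * \<alpha> / 24 - pi / 2 * (\<Sum>n. cos_term \<alpha> \<nu> n))"
    by (intro tendsto_intros suminf_pv_coeff_limit(2)[OF assms])
  moreover have "- (\<Sum>n. cos_term \<alpha> \<nu> n) - 2 / pi * (pi\<^sup>2 * \<alpha> / 24 - pi / 2 * (\<Sum>n. cos_term \<alpha> \<nu> n)) = - (pi * \<alpha> / 12)"
    by (simp add: right_diff_distrib power2_eq_square)
  ultimately show ?thesis
    unfolding M_eq[OF assms(1)] cos_term_shift by simp
qed

section \<open>The weighted integral of B and the assembled formula\<close>

definition weighted_B_integral :: "real \<Rightarrow> real \<Rightarrow> real" where
  "weighted_B_integral \<alpha> \<nu> = (LBINT t=ereal 0..ereal \<nu>. (t - \<nu> - 1/2) * B (\<alpha> * t))"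

lemma interval_integrable_times_B:
  fixes p u :: "real \<Rightarrow> real"
  assumes "continuous_on UNIV p" "u \<in> borel_measurable borel"
  shows "interval_lebesgue_integrable lborel (ereal a) (ereal b) (\<lambda>t. p t * B (u t))"
proof -
  have "set_integrable lborel {x<..<y} (\<lambda>t. p t * B (u t))" for x y
    by (rule set_integrable_subset[OF set_integrable_times_B[of x y]])
       (use assms continuous_on_subset in auto)
  then show ?thesis by (simp add: interval_lebesgue_integrable_def)
qed

text \<open>Raising \<nu> by 1 lowers the weight by 1, which produces the plain integral of
  \<open>B\<close>, i.e. \<open>B_prim\<close>. The new piece of the domain, from \<nu> to \<nu> +
  1, carries the weight s - 1/2: the sawtooth integral of \<open>M_shift\<close> with the opposite
  sign. The integrals are oriented, so negative \<nu> causes no case split.\<close>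

lemma weighted_B_integral_shift:
  assumes \<alpha>: "\<alpha> > 0" and \<nu>: "\<nu> > -1"
  shows "2 * pi * \<alpha> * (weighted_B_integral \<alpha> (\<nu> + 1) - weighted_B_integral \<alpha> \<nu>)
     = - B_prim (2 * pi * \<alpha>) (\<nu> + 1) - 2 * pi * \<alpha> * (LINT s:{0..1}|lborel. (1/2 - s) * B (\<alpha> * (\<nu> + s)))"
proof -
  define f where "f = (\<lambda>t. (t - \<nu> - 1/2) * B (\<alpha> * t))"
  have fi: "interval_lebesgue_integrable lborel (ereal a) (ereal b) f" for a b
    unfolding f_def by (rule interval_integrable_times_B) (auto intro!: continuous_intros)
  have Bi: "interval_lebesgue_integrable lborel (ereal a) (ereal b) (\<lambda>t. B (\<alpha> * t))" for a b
    using interval_integrable_times_B[of "\<lambda>_. 1" "\<lambda>t. \<alpha> * t" a b] by simp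
  have "weighted_B_integral \<alpha> (\<nu> + 1) = (LBINT t=ereal 0..ereal (\<nu> + 1). f t - B (\<alpha> * t))"
    unfolding weighted_B_integral_def f_def by (simp add: algebra_simps)
  also have "\<dots> = (LBINT t=ereal 0..ereal (\<nu> + 1). f t) - (LBINT t=ereal 0..ereal (\<nu> + 1). B (\<alpha> * t))"
    by (rule interval_lebesgue_integral_diff(2)[OF fi Bi])
  also have "(LBINT t=ereal 0..ereal (\<nu> + 1). f t) = weighted_B_integral \<alpha> \<nu> + (LBINT t=ereal \<nu>..ereal (\<nu> + 1). f t)"
    unfolding weighted_B_integral_def f_def[symmetric]
    by (rule interval_integral_sum[symmetric]) (use fi in \<open>simp add: min_def max_def\<close>)
  also have "(LBINT t=ereal \<nu>..ereal (\<nu> + 1). f t) = (LINT t:{\<nu>..\<nu> + 1}|lborel. f t)"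
    by (rule interval_integral_Icc) simp
  also have "\<dots> = - (LINT s:{0..1}|lborel. (1/2 - s) * B (\<alpha> * (\<nu> + s)))"
  proof -
    have "(LINT t:{\<nu>..\<nu> + 1}|lborel. f t) = (\<integral>s. indicator {\<nu>..\<nu> + 1} (\<nu> + 1 * s) *\<^sub>R f (\<nu> + 1 * s) \<partial>lborel)"
      unfolding set_lebesgue_integral_def
      using lborel_integral_real_affine[of 1 "\<lambda>t. indicator {\<nu>..\<nu> + 1} t *\<^sub>R f t" \<nu>] by simp
    also have "\<dots> = (\<integral>s. - (indicator {0..1} s *\<^sub>R ((1/2 - s) * B (\<alpha> * (\<nu> + s)))) \<partial>lborel)"
      by (intro Bochner_Integration.integral_cong) (auto simp: f_def indicator_def algebra_simps)
    finally show ?thesis by (simp add: set_lebesgue_integral_def)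
  qed
  finally have "weighted_B_integral \<alpha> (\<nu> + 1) - weighted_B_integral \<alpha> \<nu>
      = - (LINT s:{0..1}|lborel. (1/2 - s) * B (\<alpha> * (\<nu> + s))) - (LBINT t=ereal 0..ereal (\<nu> + 1). B (\<alpha> * t))"
    by simp
  moreover have "2 * pi * \<alpha> * (LBINT t=ereal 0..ereal (\<nu> + 1). B (\<alpha> * t)) = B_prim (2 * pi * \<alpha>) (\<nu> + 1)"
  proof -
    have "set_integrable lborel {0..\<nu> + 1} (\<lambda>t. B (\<alpha> * t))"
      using set_integrable_times_B[of 0 "\<nu> + 1" "\<lambda>_. 1" "\<lambda>t. \<alpha> * t"] by simp
    then have "(LBINT t=ereal 0..ereal (\<nu> + 1). B (\<alpha> * t)) = integral {0..\<nu> + 1} (\<lambda>t. B (\<alpha> * t))"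
      using \<nu> by (intro interval_integral_eq_integral) auto
    then show ?thesis
      using integral_unique[OF B_has_integral[OF \<alpha>, of "\<nu> + 1"]] \<nu> by simp
  qed
  ultimately show ?thesis by (simp add: right_diff_distrib)
qed

lemma weighted_B_integral_eq:
  assumes \<alpha>: "\<alpha> > 0" and \<mu>: "\<mu> > 0"
  shows "2 * pi * \<alpha> * weighted_B_integral \<alpha> \<mu>
     = pi / (12 * \<alpha>) - B_prim (2 * pi * \<alpha>) \<mu> / 2 - B_prim2 (2 * pi * \<alpha>) \<mu>"
proof -
  have "set_integrable lborel {0..\<mu>} (\<lambda>t. (t - \<mu> - 1/2) * B (\<alpha> * t))"
    by (rule set_integrable_times_B) (auto intro!: continuous_intros)
  then have "weighted_B_integral \<alpha> \<mu> = integral {0..\<mu>} (\<lambda>t. (t - \<mu> - 1/2) * B (\<alpha> * t))"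
    unfolding weighted_B_integral_def using \<mu> by (intro interval_integral_eq_integral) auto
  then show ?thesis
    using integral_unique[OF weighted_B_has_integral[OF \<alpha>, of \<mu>]] \<mu> by simp
qed

definition ln_qpoch_formula :: "real \<Rightarrow> real \<Rightarrow> real" where
  "ln_qpoch_formula \<alpha> \<nu> =
     - pi / (12 * \<alpha>) - (\<nu> + 1/2) * ln (2 * pi * \<alpha>) + ln (sqrt (2 * pi) / Gamma (\<nu> + 1))
     + pi / 2 * (\<nu> + 1) * \<nu> * \<alpha> + pi / 12 * \<alpha>
     + 2 * pi * \<alpha> * weighted_B_integral \<alpha> \<nu> + M \<alpha> \<nu>"

lemma ln_sqrt_over_Gamma:
  assumes "\<nu> > -1"
  shows "ln (sqrt (2 * pi) / Gamma (\<nu> + 1)) = ln (2 * pi) / 2 - ln (Gamma (\<nu> + 1))"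
proof -
  have "Gamma (\<nu> + 1) > 0" using assms by (intro Gamma_real_pos) simp
  then show ?thesis by (simp add: ln_div ln_sqrt)
qed

text \<open>The sawtooth integrals from \<open>M\<close> and from the weighted integral cancel,
  leaving \<open>B_prim\<close> at \<nu> + 1. Its logarithm ln (2 pi \<alpha> (\<nu> + 1)) is
  absorbed by the power of 2 pi \<alpha> and by Gamma, its linear part by the quadratic term; what
  survives is the new factor of the product.\<close>

lemma ln_qpoch_formula_shift:
  assumes \<alpha>: "\<alpha> > 0" and \<nu>: "\<nu> > -1"
  shows "ln_qpoch_formula \<alpha> \<nu> - ln_qpoch_formula \<alpha> (\<nu> + 1) = ln (1 - exp (- (2 * pi * \<alpha> * (\<nu> + 1))))"
proof -
  have "Gamma (\<nu> + 1 + 1) = (\<nu> + 1) * Gamma (\<nu> + 1)"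
    using \<nu> nonpos_Ints_nonpos[of "\<nu> + 1"] by (intro Gamma_plus1) force
  then have G: "ln (Gamma (\<nu> + 1 + 1)) = ln (\<nu> + 1) + ln (Gamma (\<nu> + 1))"
  proof -
    have "Gamma (\<nu> + 1) > 0" using \<nu> by (intro Gamma_real_pos) simp
    then have "ln ((\<nu> + 1) * Gamma (\<nu> + 1)) = ln (\<nu> + 1) + ln (Gamma (\<nu> + 1))"
      using \<nu> by (intro ln_mult_pos) auto
    then show ?thesis using \<open>Gamma (\<nu> + 1 + 1) = _\<close> by simp
  qed
  have L: "ln (2 * pi * \<alpha> * (\<nu> + 1)) = ln (2 * pi * \<alpha>) + ln (\<nu> + 1)"
    using \<alpha> \<nu> by (intro ln_mult_pos) auto
  have g: "ln (sqrt (2 * pi) / Gamma (\<nu> + 1)) - ln (sqrt (2 * pi) / Gamma (\<nu> + 1 + 1)) = ln (\<nu> + 1)"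
    using ln_sqrt_over_Gamma[of \<nu>] ln_sqrt_over_Gamma[of "\<nu> + 1"] \<nu> G by simp
  have p: "pi / 2 * (\<nu> + 1) * \<nu> * \<alpha> - pi / 2 * (\<nu> + 1 + 1) * (\<nu> + 1) * \<alpha> = - (pi * \<alpha> * (\<nu> + 1))"
    by (simp add: field_simps)
  have l: "(\<nu> + 1/2) * ln (2 * pi * \<alpha>) - (\<nu> + 1 + 1/2) * ln (2 * pi * \<alpha>) = - ln (2 * pi * \<alpha>)"
    by (simp add: algebra_simps)
  have b: "B_prim (2 * pi * \<alpha>) (\<nu> + 1) = ln (1 - exp (- (2 * pi * \<alpha> * (\<nu> + 1)))) - (ln (2 * pi * \<alpha>) + ln (\<nu> + 1)) + pi * \<alpha> * (\<nu> + 1)"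
    unfolding B_prim_def L by simp
  have w: "2 * pi * \<alpha> * weighted_B_integral \<alpha> \<nu> - 2 * pi * \<alpha> * weighted_B_integral \<alpha> (\<nu> + 1)
      = B_prim (2 * pi * \<alpha>) (\<nu> + 1) + 2 * pi * \<alpha> * (LINT s:{0..1}|lborel. (1/2 - s) * B (\<alpha> * (\<nu> + s)))"
    using weighted_B_integral_shift[OF \<alpha> \<nu>] by (simp add: right_diff_distrib)
  show ?thesis
    unfolding ln_qpoch_formula_def using g p l w b M_shift[OF \<alpha>, of \<nu>] by linarith
qed

text \<open>Once the weighted integral is evaluated, its polynomial part, pi / (12 \<alpha>) and all
  ln k cancel against the elementary terms. What remains is a Stirling remainder, \<open>M\<close>
  plus pi \<alpha> / 12, and two quantities that vanish with exp (- k \<mu>).\<close>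

lemma ln_qpoch_formula_limit:
  assumes \<alpha>: "\<alpha> > 0" and \<nu>: "\<nu> > 0"
  shows "(\<lambda>N. ln_qpoch_formula \<alpha> (\<nu> + real N)) \<longlonglongrightarrow> 0"
proof -
  define k where "k = 2 * pi * \<alpha>"
  have k: "k > 0" using \<alpha> by (simp add: k_def)
  define E where "E = (\<lambda>\<mu>. exp (- (k * \<mu>)))"
  have E0: "(\<lambda>N. E (\<nu> + real N)) \<longlonglongrightarrow> 0"
    unfolding E_def using k by real_asymp
  have eq: "ln_qpoch_formula \<alpha> \<mu> =
      (ln (2 * pi) / 2 - (ln (Gamma (\<mu> + 1)) - (\<mu> + 1/2) * ln \<mu> + \<mu>)) + (pi * \<alpha> / 12 + M \<alpha> \<mu>)
      - ln (1 - E \<mu>) / 2 - dilog (E \<mu>) / k" if \<mu>: "\<mu> > 0" for \<mu>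
  proof -
    have L: "ln (k * \<mu>) = ln k + ln \<mu>" using k \<mu> by (intro ln_mult_pos) auto
    have w: "k * weighted_B_integral \<alpha> \<mu> = pi / (12 * \<alpha>) - B_prim k \<mu> / 2 - B_prim2 k \<mu>"
      unfolding k_def by (rule weighted_B_integral_eq[OF \<alpha> \<mu>])
    have p: "pi / 2 * (\<mu> + 1) * \<mu> * \<alpha> = k * \<mu> / 4 + k * \<mu>\<^sup>2 / 4"
      by (simp add: k_def field_simps power2_eq_square)
    show ?thesis
      unfolding ln_qpoch_formula_def k_def[symmetric] w p B_prim_def B_prim2_def L E_def
      using ln_sqrt_over_Gamma[of \<mu>] \<mu> by (simp add: field_simps)
  qed
  have "(dilog \<circ> (\<lambda>N. E (\<nu> + real N))) \<longlonglongrightarrow> dilog 0"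
  proof -
    have "E (\<nu> + real N) \<in> {0..1}" for N
      using k \<nu> by (simp add: E_def)
    then show ?thesis
      using continuous_on_dilog E0 unfolding continuous_on_sequentially by auto
  qed
  then have d: "(\<lambda>N. dilog (E (\<nu> + real N))) \<longlonglongrightarrow> 0" by (simp add: o_def dilog_0)
  have "(\<lambda>N. (ln (2 * pi) / 2 - (ln (Gamma (\<nu> + real N + 1)) - (\<nu> + real N + 1/2) * ln (\<nu> + real N) + (\<nu> + real N)))
      + (pi * \<alpha> / 12 + M \<alpha> (\<nu> + real N)) - ln (1 - E (\<nu> + real N)) / 2 - dilog (E (\<nu> + real N)) / k)
    \<longlonglongrightarrow> (ln (2 * pi) / 2 - ln (2 * pi) / 2) + (pi * \<alpha> / 12 + - (pi * \<alpha> / 12)) - ln (1 - 0) / 2 - 0 / k"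
    using k by (intro tendsto_add tendsto_diff tendsto_divide tendsto_const tendsto_ln M_limit[OF \<alpha> \<nu>] d E0
        stirling_ln_Gamma_shift[OF \<nu>]) auto
  then show ?thesis using eq \<nu> by (simp add: add_pos_nonneg)
qed

lemma ln_qpoch_formula_sums:
  assumes \<alpha>: "\<alpha> > 0" and \<nu>: "\<nu> > -1"
  shows "(\<lambda>n. ln (1 - exp (- (2 * pi * \<alpha> * (\<nu> + real n + 1))))) sums ln_qpoch_formula \<alpha> \<nu>"
proof -
  \<comment> \<open>The limit is available for positive parameters, so it is taken from \<nu> + 1
    and the index is then moved back by one.\<close>
  have "(\<lambda>N. ln_qpoch_formula \<alpha> (\<nu> + 1 + real N)) \<longlonglongrightarrow> 0"
    using ln_qpoch_formula_limit[OF \<alpha>, of "\<nu> + 1"] \<nu> by simp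
  then have "(\<lambda>N. ln_qpoch_formula \<alpha> (\<nu> + real (Suc N))) \<longlonglongrightarrow> 0"
    by (simp add: add_ac)
  then have lim: "(\<lambda>N. ln_qpoch_formula \<alpha> (\<nu> + real N)) \<longlonglongrightarrow> 0"
    by (rule LIMSEQ_imp_Suc)
  have "(\<Sum>n<N. ln (1 - exp (- (2 * pi * \<alpha> * (\<nu> + real n + 1))))) = ln_qpoch_formula \<alpha> \<nu> - ln_qpoch_formula \<alpha> (\<nu> + real N)" for N
  proof (induction N)
    case (Suc N)
    have "ln_qpoch_formula \<alpha> (\<nu> + real N) - ln_qpoch_formula \<alpha> (\<nu> + real N + 1) = ln (1 - exp (- (2 * pi * \<alpha> * (\<nu> + real N + 1))))"
      using \<nu> by (intro ln_qpoch_formula_shift \<alpha>) auto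
    with Suc show ?case by (simp add: add_ac)
  qed simp
  moreover have "(\<lambda>N. ln_qpoch_formula \<alpha> \<nu> - ln_qpoch_formula \<alpha> (\<nu> + real N)) \<longlonglongrightarrow> ln_qpoch_formula \<alpha> \<nu> - 0"
    by (intro tendsto_intros lim)
  ultimately show ?thesis by (simp add: sums_def)
qed

section \<open>From the series of logarithms to the infinite product\<close>

lemma convergent_prod_one_minus_geometric:
  fixes x q :: real
  assumes "\<bar>q\<bar> < 1"
  shows "convergent_prod (\<lambda>n. 1 - x * q ^ n)"
proof -
  have "summable (\<lambda>n. \<bar>x\<bar> * \<bar>q\<bar> ^ n)"
    using assms by (intro summable_mult summable_geometric) auto
  then have "abs_convergent_prod (\<lambda>n. 1 - x * q ^ n)"
    by (simp add: abs_convergent_prod_conv_summable abs_mult power_abs)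
  then show ?thesis by (rule abs_convergent_prod_imp_convergent_prod)
qed

theorem theorem2:
  fixes \<alpha> \<nu> q x :: real
  assumes "\<alpha> > 0" and "\<nu> > -1"
    and "q = exp (- 2 * pi * \<alpha>)"
    and "x = exp (- 2 * pi * (1 + \<nu>) * \<alpha>)"
  shows "convergent_prod (\<lambda>n. 1 - x * q ^ n) \<and>
         interval_lebesgue_integrable lborel (ereal 0) (ereal \<nu>)
           (\<lambda>t. (t - \<nu> - 1 / 2) * B (\<alpha> * t)) \<and>
         summable (cos_term \<alpha> \<nu>) \<and>
         (\<forall>t>0. summable (sin_term \<alpha> \<nu> t)) \<and>
         pv_integrable (pv_integrand \<alpha> \<nu>) 1 {0<..} \<and>
         ln (qpoch_inf x q) =
           - pi / (12 * \<alpha>) - (\<nu> + 1 / 2) * ln (2 * pi * \<alpha>) + ln (sqrt (2 * pi) / Gamma (\<nu> + 1))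
           + pi / 2 * (\<nu> + 1) * \<nu> * \<alpha> + pi / 12 * \<alpha>
           + 2 * pi * \<alpha> * (LBINT t=ereal 0..ereal \<nu>. (t - \<nu> - 1 / 2) * B (\<alpha> * t))
           + M \<alpha> \<nu>"
proof (intro conjI allI impI)
  have q: "\<bar>q\<bar> < 1" using assms by simp
  show conv: "convergent_prod (\<lambda>n. 1 - x * q ^ n)"
    by (rule convergent_prod_one_minus_geometric[OF q])
  show "interval_lebesgue_integrable lborel (ereal 0) (ereal \<nu>) (\<lambda>t. (t - \<nu> - 1 / 2) * B (\<alpha> * t))"
    by (rule interval_integrable_times_B) (auto intro!: continuous_intros)
  show "summable (cos_term \<alpha> \<nu>)"
    using assms by (intro summable_cos_term)
  show "summable (sin_term \<alpha> \<nu> t)" if "t > 0" for t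
    using summable_abs_sin_term[OF assms(1) that] by (rule summable_rabs_cancel)
  show "pv_integrable (pv_integrand \<alpha> \<nu>) 1 {0<..}"
    unfolding pv_integrable_def using pv_integrand_sums(1)[OF assms(1)] by blast
  \<comment> \<open>Each factor is positive because \<nu> + n + 1 > 0. Working with exponentials of
    partial sums identifies the product as an exponential, which also settles its positivity before
    ln is applied.\<close>
  have factor: "1 - x * q ^ n = exp (ln (1 - exp (- (2 * pi * \<alpha> * (\<nu> + real n + 1)))))" for n
  proof -
    have "x * q ^ n = exp (- (2 * pi * \<alpha> * (\<nu> + real n + 1)))"
      unfolding assms(3,4) exp_of_nat_mult[symmetric] mult_exp_exp by (simp add: algebra_simps)
    moreover have "exp (- (2 * pi * \<alpha> * (\<nu> + real n + 1))) < 1"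
      using assms(1,2) by simp
    ultimately show ?thesis by simp
  qed
  have "(\<lambda>n. \<Prod>i\<le>n. 1 - x * q ^ i) \<longlonglongrightarrow> qpoch_inf x q"
    unfolding qpoch_inf_def by (rule convergent_prod_LIMSEQ[OF conv])
  moreover have "(\<lambda>n. exp (\<Sum>i\<le>n. ln (1 - exp (- (2 * pi * \<alpha> * (\<nu> + real i + 1)))))) \<longlonglongrightarrow> exp (ln_qpoch_formula \<alpha> \<nu>)"
    using ln_qpoch_formula_sums[OF assms(1,2)] unfolding sums_def_le by (rule tendsto_exp)
  ultimately have "qpoch_inf x q = exp (ln_qpoch_formula \<alpha> \<nu>)"
    unfolding factor exp_sum[OF finite_atMost] using LIMSEQ_unique by blast
  then show "ln (qpoch_inf x q) =
           - pi / (12 * \<alpha>) - (\<nu> + 1 / 2) * ln (2 * pi * \<alpha>) + ln (sqrt (2 * pi) / Gamma (\<nu> + 1))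
           + pi / 2 * (\<nu> + 1) * \<nu> * \<alpha> + pi / 12 * \<alpha>
           + 2 * pi * \<alpha> * (LBINT t=ereal 0..ereal \<nu>. (t - \<nu> - 1 / 2) * B (\<alpha> * t))
           + M \<alpha> \<nu>"
    by (simp add: ln_qpoch_formula_def weighted_B_integral_def)
qed

end
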